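(* Let $M$ be a compact complex curve with Kähler form $\omega_0$, and let $(J,\alpha)\in T^*\mathscr{J}$ be a point with $\frac14\|\alpha\|^2<1$ everywhere on $M$. Let $$\psi(\alpha)=\frac{1}{1+\sqrt{1-\frac14\|\alpha\|^2}},\qquad Q(J,\alpha)=\tfrac12\operatorname{Re}\left(g_J(\nabla^a\alpha,\bar\alpha)\,\partial_a\right),$$ where all metric quantities are computed with respect to $g_J$. Then, under the $L^2$ product, the real moment map $\mathfrak{m}_{\bm{\Omega}_{\bm{I}}}$ is identified with the function $$\mathfrak{m}_{\bm{\Omega}_{\bm{I}}}(J,\alpha)=2\,s(g_J)-2\,\hat s+\Delta\left(\log\left(1+\sqrt{1-\tfrac14\|\alpha\|^2}\right)\right)+\mathrm{div}\left(\psi(\alpha)\,Q(J,\alpha)\right),$$ i.e. $\langle\mathfrak{m}_{\bm{\Omega}_{\bm{I}}}(J,\alpha),h\rangle=\int_M h\cdot(\text{this function})\,\omega_0$ for all $h\in C^\infty_0(M)$.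
   Context: Let $n=\dim_{\mathbb C}M=1$. $\mathscr{J}$ is the space of almost complex structures $J$ on $M$ with $\omega_0(J\cdot,J\cdot)=\omega_0$ and $g_J:=\omega_0(\cdot,J\cdot)>0$. Points of the holomorphic cotangent bundle $T^*\mathscr{J}$ are pairs $(J,\alpha)$ with $\alpha\in\Gamma(\mathrm{End}(T^*M)\otimes\mathbb{C})$, $J^\intercal\alpha=\mathrm{i}\alpha$, $\alpha J^\intercal=-\mathrm{i}\alpha$, and $A:=\mathrm{Re}(\alpha)^\intercal$ such that $g_J(A\cdot,\cdot)$ is symmetric; in $J$-holomorphic coordinates $\alpha=\alpha_a{}^{\bar b}\,\partial_{\bar b}\otimes\mathrm{d}z^a$. The group $\mathcal{G}=\mathrm{Ham}(M,\omega_0)$ acts by pushforward, with Lie algebra the zero-average functions $C^\infty_0(M)$ and infinitesimal action $\hat h=(\mathcal{L}_{X_h}J,\mathcal{L}_{X_h}\alpha)$, where $\mathrm{d}h=-X_h\lrcorner\omega_0$. The real moment map is defined by $$\langle\mathfrak{m}_{\bm{\Omega}_{\bm I}}(J,\alpha),h\rangle=\int_M2(s(g_J)-\hat s)h\,\frac{\omega_0^n}{n!}+\int_{x\in M}\mathrm{d}^c\rho_{(J(x),\alpha(x))}(\mathcal{L}_{X_h}J,\mathcal{L}_{X_h}\alpha)\,\frac{\omega_0^n}{n!},$$ where $s$ is the scalar curvature normalised as $s=g^{a\bar b}\mathrm{Ric}_{a\bar b}$ (half of the Riemannian scalar curvature), $\hat s$ is its average, and $\rho$ is the Biquard–Gauduchon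 function on the holomorphic cotangent bundle of the space $\mathcal{AC}^+$ of linear complex structures $J$ on $\mathbb R^{2n}$ compatible with the standard symplectic form (Darboux coordinates are used to view $(J(x),\alpha(x))$ as a point of ${T^{1,0}}^*\mathcal{AC}^+$). $\mathcal{AC}^+$ has complex structure $A\mapsto JA$ and metric $\frac12\mathrm{Tr}(AB)$ on $T_J\mathcal{AC}^+$; covectors pair with vectors by $\frac12\mathrm{Tr}(\alpha^\intercal A)$. With $\Xi(A):B\mapsto-\frac12(A^2B+BA^2)$ on $T_J\mathcal{AC}^+$ and $f(x)=\frac1x\left(\sqrt{1+x}-1-\log\frac{1+\sqrt{1+x}}2\right)$, $\rho(J,\alpha)=\frac12\mathrm{Tr}(f(\Xi(A))(A)\,A)$, $A=\mathrm{Re}(\alpha)^\intercal$ (for $n=1$: $\rho=1-\sqrt{1+\det A}+\log\frac{1+\sqrt{1+\det A}}{2}$). $\mathrm{d}^c\rho(v)=-\mathrm{d}\rho(Iv)$, with $I$ the canonical complex structure of ${T^{1,0}}^*\mathcal{AC}^+$. Conventions: $\Delta=\mathrm{d}\mathrm{d}^*+\mathrm{d}^*\mathrm{d}$, so $\Delta\varphi=-\mathrm{div}\,\mathrm{grad}\,\varphi=-2g^{a\bar b}\partial_a\partial_{\bar b}\varphi$; $\nabla$ is the Levi-Civita connection of $g_J$, $\nabla^a=g^{a\bar b}\nabla_{\bar b}$; $\|\alpha\|^2=g^{a\bar c}g_{d\bar b}\,\alpha_a{}^{\bar b}\,\overline{\alpha_c{}^{\bar d}}$ and $g_J(\nabla^a\alpha,\bar\alpha)=g^{a\bar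 b}g^{c\bar e}g_{d\bar f}\,\nabla_{\bar b}\alpha_c{}^{\bar f}\,\overline{\alpha_e{}^{\bar d}}$. $\operatorname{Re}(V)=\frac12(V+\bar V)$. *)

theory Defs
  imports "HOL-Analysis.Analysis"
begin

section \<open>Calculus in a coordinate patch of the plane\<close>

text \<open>Coordinates take values in \<^typ>\<open>complex\<close>, with real coordinates $x = \mathrm{Re}\, z$ (index 1)
  and $y = \mathrm{Im}\, z$ (index 2). Tangent vectors have components in \<^typ>\<open>real^2\<close> with respect to
  $\partial_x, \partial_y$.\<close>

definition cbasis :: "2 \<Rightarrow> complex" where
  "cbasis k = (if k = 1 then 1 else \<i>)"

definition pd :: "2 \<Rightarrow> (complex \<Rightarrow> 'b::real_normed_vector) \<Rightarrow> complex \<Rightarrow> 'b" where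
  "pd k f z = frechet_derivative f (at z) (cbasis k)"

text \<open>$C^\infty$ on an open set: \<open>D i j\<close> is $\partial_x^i \partial_y^j f$, and all of these are differentiable.\<close>

definition Cinf_on :: "complex set \<Rightarrow> (complex \<Rightarrow> 'b::real_normed_vector) \<Rightarrow> bool" where
  "Cinf_on S f \<longleftrightarrow> (\<exists>D :: nat \<Rightarrow> nat \<Rightarrow> complex \<Rightarrow> 'b.
     (\<forall>z\<in>S. D 0 0 z = f z) \<and>
     (\<forall>i j. \<forall>z\<in>S. (D i j has_derivative
        (\<lambda>v. Re v *\<^sub>R D (Suc i) j z + Im v *\<^sub>R D i (Suc j) z)) (at z)))"

definition jac :: "(complex \<Rightarrow> complex) \<Rightarrow> complex \<Rightarrow> real^2^2" where
  "jac F z = (\<chi> i j. if i = 1 then Re (pd j F z) else Im (pd j F z))"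

abbreviation cmat :: "real^2^2 \<Rightarrow> complex^2^2" where
  "cmat \<equiv> map_matrix complex_of_real"

text \<open>The matrix of $dx \wedge dy$; a 2-form with matrix $W$ is $(u, v) \mapsto u \cdot W v$.\<close>

definition Om :: "real^2^2" where
  "Om = vector [vector [0, 1], vector [-1, 0]]"

section \<open>Compact complex curves and Kaehler forms\<close>

text \<open>A chart is a pair $(U, \varphi)$ of a domain and a coordinate map.\<close>

type_synonym 'm chart = "'m set \<times> ('m \<Rightarrow> complex)"

abbreviation dom_ch :: "'m chart \<Rightarrow> 'm set" where
  "dom_ch c \<equiv> fst c"

abbreviation ran_ch :: "'m chart \<Rightarrow> complex set" where
  "ran_ch c \<equiv> snd c ` fst c"

definition pt :: "'m chart \<Rightarrow> complex \<Rightarrow> 'm" where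
  "pt c = inv_into (fst c) (snd c)"

definition transition :: "'m chart \<Rightarrow> 'm chart \<Rightarrow> complex \<Rightarrow> complex" where
  "transition c d = snd d \<circ> pt c"

definition compact_complex_curve :: "('m::t2_space) chart set \<Rightarrow> bool" where
  "compact_complex_curve \<A> \<longleftrightarrow>
     compact (UNIV :: 'm set) \<and> connected (UNIV :: 'm set) \<and>
     (\<Union>c\<in>\<A>. dom_ch c) = UNIV \<and>
     (\<forall>c\<in>\<A>. open (dom_ch c) \<and> open (ran_ch c) \<and>
        homeomorphism (dom_ch c) (ran_ch c) (snd c) (pt c)) \<and>
     (\<forall>c\<in>\<A>. \<forall>d\<in>\<A>. transition c d holomorphic_on snd c ` (dom_ch c \<inter> dom_ch d))"

text \<open>On a curve every 2-form is closed and of type $(1,1)$; in the chart $c$ it is $w_c\, dx \wedge dy$,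
  and it is positive iff $w_c > 0$.\<close>

definition kaehler_form :: "'m chart set \<Rightarrow> ('m chart \<Rightarrow> complex \<Rightarrow> real) \<Rightarrow> bool" where
  "kaehler_form \<A> w \<longleftrightarrow>
     (\<forall>c\<in>\<A>. Cinf_on (ran_ch c) (w c) \<and> (\<forall>z\<in>ran_ch c. w c z > 0)) \<and>
     (\<forall>c\<in>\<A>. \<forall>d\<in>\<A>. \<forall>z\<in>snd c ` (dom_ch c \<inter> dom_ch d).
        w c z = w d (transition c d z) * det (jac (transition c d) z))"

definition form_mat :: "('m chart \<Rightarrow> complex \<Rightarrow> real) \<Rightarrow> 'm chart \<Rightarrow> complex \<Rightarrow> real^2^2" where
  "form_mat w c z = w c z *\<^sub>R Om"

text \<open>The measure on $M$ whose integral is $\int_M f\, \omega_0$.\<close>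

definition area_measure :: "('m::t2_space) chart set \<Rightarrow> ('m chart \<Rightarrow> complex \<Rightarrow> real) \<Rightarrow> 'm measure" where
  "area_measure \<A> w = (THE \<mu>. sets \<mu> = sets borel \<and>
     (\<forall>c\<in>\<A>. \<forall>B\<in>sets borel. B \<subseteq> dom_ch c \<longrightarrow>
        emeasure \<mu> B = (\<integral>\<^sup>+ z. ennreal (w c z) * indicator (snd c ` B) z \<partial>lborel)))"

definition chart_at :: "'m chart set \<Rightarrow> 'm \<Rightarrow> 'm chart" where
  "chart_at \<A> p = (SOME c. c \<in> \<A> \<and> p \<in> dom_ch c)"

text \<open>The scalar function on $M$ given by coordinate expressions that agree on chart overlaps.\<close>

definition globally :: "'m chart set \<Rightarrow> ('m chart \<Rightarrow> complex \<Rightarrow> real) \<Rightarrow> 'm \<Rightarrow> real" where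
  "globally \<A> T p = T (chart_at \<A> p) (snd (chart_at \<A> p) p)"

definition smooth_fun :: "'m chart set \<Rightarrow> ('m \<Rightarrow> real) \<Rightarrow> bool" where
  "smooth_fun \<A> h \<longleftrightarrow> (\<forall>c\<in>\<A>. Cinf_on (ran_ch c) (h \<circ> pt c))"

definition C0inf :: "('m::t2_space) chart set \<Rightarrow> ('m chart \<Rightarrow> complex \<Rightarrow> real) \<Rightarrow> ('m \<Rightarrow> real) set" where
  "C0inf \<A> w = {h. smooth_fun \<A> h \<and> (\<integral>p. h p \<partial>area_measure \<A> w) = 0}"

section \<open>Points of the holomorphic cotangent bundle\<close>

text \<open>An endomorphism $J$ of the tangent space is its matrix on $\partial_x, \partial_y$; an endomorphism
  $\alpha$ of the complexified cotangent space is its matrix on $dx, dy$, so that passing to the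
  transposed map is \<^const>\<open>transpose\<close>. Here $g_J = \omega(\cdot, J \cdot)$ has matrix $W J$.\<close>

definition compatible :: "real^2^2 \<Rightarrow> real^2^2 \<Rightarrow> bool" where
  "compatible W J \<longleftrightarrow> J ** J = - mat 1 \<and> transpose J ** W ** J = W \<and>
     (\<forall>v. v \<noteq> 0 \<longrightarrow> v \<bullet> ((W ** J) *v v) > 0)"

definition re_transpose :: "complex^2^2 \<Rightarrow> real^2^2" where
  "re_transpose \<alpha> = transpose (map_matrix Re \<alpha>)"

definition cotangent :: "real^2^2 \<Rightarrow> real^2^2 \<Rightarrow> complex^2^2 \<Rightarrow> bool" where
  "cotangent W J \<alpha> \<longleftrightarrow>
     cmat (transpose J) ** \<alpha> = mat \<i> ** \<alpha> \<and>
     \<alpha> ** cmat (transpose J) = mat (- \<i>) ** \<alpha> \<and>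
     transpose (transpose (re_transpose \<alpha>) ** (W ** J)) = transpose (re_transpose \<alpha>) ** (W ** J)"

definition cotangent_point ::
  "'m chart set \<Rightarrow> ('m chart \<Rightarrow> complex \<Rightarrow> real) \<Rightarrow> ('m chart \<Rightarrow> complex \<Rightarrow> real^2^2) \<Rightarrow>
   ('m chart \<Rightarrow> complex \<Rightarrow> complex^2^2) \<Rightarrow> bool" where
  "cotangent_point \<A> w J \<alpha> \<longleftrightarrow>
     (\<forall>c\<in>\<A>. Cinf_on (ran_ch c) (J c) \<and> Cinf_on (ran_ch c) (\<alpha> c) \<and>
        (\<forall>z\<in>ran_ch c. compatible (form_mat w c z) (J c z) \<and>
                       cotangent (form_mat w c z) (J c z) (\<alpha> c z))) \<and>
     (\<forall>c\<in>\<A>. \<forall>d\<in>\<A>. \<forall>z\<in>snd c ` (dom_ch c \<inter> dom_ch d).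
        let P = jac (transition c d) z; z' = transition c d z in
          J d z' ** P = P ** J c z \<and>
          cmat (transpose P) ** \<alpha> d z' = \<alpha> c z ** cmat (transpose P))"

section \<open>Riemannian quantities of the metric\<close>

definition met :: "('m chart \<Rightarrow> complex \<Rightarrow> real) \<Rightarrow> ('m chart \<Rightarrow> complex \<Rightarrow> real^2^2) \<Rightarrow>
    'm chart \<Rightarrow> complex \<Rightarrow> real^2^2" where
  "met w J c z = form_mat w c z ** J c z"

definition christoffel :: "(complex \<Rightarrow> real^2^2) \<Rightarrow> 2 \<Rightarrow> 2 \<Rightarrow> 2 \<Rightarrow> complex \<Rightarrow> real" where
  "christoffel G i j k z = (1/2) * (\<Sum>l\<in>UNIV. matrix_inv (G z) $ i $ l *
     (pd j (\<lambda>y. G y $ k $ l) z + pd k (\<lambda>y. G y $ j $ l) z - pd l (\<lambda>y. G y $ j $ k) z))"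

definition ricci :: "(complex \<Rightarrow> real^2^2) \<Rightarrow> complex \<Rightarrow> real^2^2" where
  "ricci G z = (\<chi> j l. \<Sum>i\<in>UNIV.
      pd i (christoffel G i l j) z - pd l (christoffel G i i j) z +
      (\<Sum>m\<in>UNIV. christoffel G i i m z * christoffel G m l j z
               - christoffel G i l m z * christoffel G m i j z))"

text \<open>Complex bilinear extension of a real bilinear form.\<close>

definition cbil :: "real^2^2 \<Rightarrow> complex^2 \<Rightarrow> complex^2 \<Rightarrow> complex" where
  "cbil B u v = (\<Sum>i\<in>UNIV. \<Sum>j\<in>UNIV. of_real (B $ i $ j) * u $ i * v $ j)"

definition cnjv :: "complex^2 \<Rightarrow> complex^2" where
  "cnjv v = (\<chi> i. cnj (v $ i))"

text \<open>The $(1,0)$-part $\frac12(1 - \mathrm{i}J)\partial_x$ of $\partial_x$ with respect to $J$. It spans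
  $T^{1,0}_J$ and plays the role of $\partial_a$ for $J$-holomorphic coordinates: the components of tensors
  at a point depend on the coordinates only through the value of $\partial_a$ there, any nonzero
  $(1,0)$-vector is such a value, and the expressions below in which all indices are contracted
  do not change when it is rescaled.\<close>

definition hol_vec :: "real^2^2 \<Rightarrow> complex^2" where
  "hol_vec J = (\<chi> i. (1/2) * (of_real (axis 1 1 $ i) - \<i> * of_real (J $ i $ 1)))"

text \<open>$g_{a\bar b}$ and $g^{a\bar b}$, with $g_{a \bar b} = g_J(\partial_a, \partial_{\bar b})$.\<close>

definition g_low :: "real^2^2 \<Rightarrow> real^2^2 \<Rightarrow> complex" where
  "g_low G J = cbil G (hol_vec J) (cnjv (hol_vec J))"

definition g_up :: "real^2^2 \<Rightarrow> real^2^2 \<Rightarrow> complex" where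
  "g_up G J = inverse (g_low G J)"

text \<open>For $B$ an endomorphism of the complexified tangent space, the component
  $B_a{}^{\bar b}$, i.e. the $\partial_{\bar b}$-coefficient of $B \partial_a$. It is extracted by pairing
  with $\partial_b$ because $g(\partial_a, \partial_b) = 0$.\<close>

definition comp_bar :: "real^2^2 \<Rightarrow> real^2^2 \<Rightarrow> complex^2^2 \<Rightarrow> complex" where
  "comp_bar G J B = g_up G J * cbil G (B *v hol_vec J) (hol_vec J)"

definition scal :: "('m chart \<Rightarrow> complex \<Rightarrow> real) \<Rightarrow> ('m chart \<Rightarrow> complex \<Rightarrow> real^2^2) \<Rightarrow>
    'm chart \<Rightarrow> complex \<Rightarrow> real" where
  "scal w J c z = Re (g_up (met w J c z) (J c z) *
      cbil (ricci (met w J c) z) (hol_vec (J c z)) (cnjv (hol_vec (J c z))))"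

definition norm_sq :: "('m chart \<Rightarrow> complex \<Rightarrow> real) \<Rightarrow> ('m chart \<Rightarrow> complex \<Rightarrow> real^2^2) \<Rightarrow>
    ('m chart \<Rightarrow> complex \<Rightarrow> complex^2^2) \<Rightarrow> 'm chart \<Rightarrow> complex \<Rightarrow> real" where
  "norm_sq w J \<alpha> c z = (let G = met w J c z; a = comp_bar G (J c z) (transpose (\<alpha> c z)) in
      Re (g_up G (J c z) * g_low G (J c z) * a * cnj a))"

text \<open>The covariant derivative $\nabla_{\partial_k} B$ of a field $B$ of endomorphisms of the
  (complexified) tangent bundle.\<close>

definition nabla :: "(complex \<Rightarrow> real^2^2) \<Rightarrow> (complex \<Rightarrow> complex^2^2) \<Rightarrow> 2 \<Rightarrow> complex \<Rightarrow> complex^2^2" where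
  "nabla G B k z = (\<chi> i j. pd k (\<lambda>y. B y $ i $ j) z +
      (\<Sum>l\<in>UNIV. of_real (christoffel G i k l z) * B z $ l $ j
               - of_real (christoffel G l k j z) * B z $ i $ l))"

definition nabla_vec :: "(complex \<Rightarrow> real^2^2) \<Rightarrow> (complex \<Rightarrow> complex^2^2) \<Rightarrow> complex^2 \<Rightarrow> complex \<Rightarrow> complex^2^2" where
  "nabla_vec G B v z = (\<Sum>k\<in>UNIV. mat (v $ k) ** nabla G B k z)"

text \<open>The component of $g_J(\nabla^a \alpha, \bar\alpha)$ with respect to $\partial_a$.\<close>

definition grad_pairing :: "('m chart \<Rightarrow> complex \<Rightarrow> real) \<Rightarrow> ('m chart \<Rightarrow> complex \<Rightarrow> real^2^2) \<Rightarrow>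
    ('m chart \<Rightarrow> complex \<Rightarrow> complex^2^2) \<Rightarrow> 'm chart \<Rightarrow> complex \<Rightarrow> complex" where
  "grad_pairing w J \<alpha> c z = (let G = met w J c z; K = J c z; B = (\<lambda>y. transpose (\<alpha> c y)) in
      g_up G K * g_up G K * g_low G K *
      comp_bar G K (nabla_vec (met w J c) B (cnjv (hol_vec K)) z) *
      cnj (comp_bar G K (B z)))"

definition Q_field :: "('m chart \<Rightarrow> complex \<Rightarrow> real) \<Rightarrow> ('m chart \<Rightarrow> complex \<Rightarrow> real^2^2) \<Rightarrow>
    ('m chart \<Rightarrow> complex \<Rightarrow> complex^2^2) \<Rightarrow> 'm chart \<Rightarrow> complex \<Rightarrow> real^2" where
  "Q_field w J \<alpha> c z = (\<chi> i. (1/2) * Re (grad_pairing w J \<alpha> c z * hol_vec (J c z) $ i))"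

definition div_loc :: "(complex \<Rightarrow> real^2^2) \<Rightarrow> (complex \<Rightarrow> real^2) \<Rightarrow> complex \<Rightarrow> real" where
  "div_loc G V z = (\<Sum>i\<in>UNIV. pd i (\<lambda>y. sqrt (det (G y)) * V y $ i) z) / sqrt (det (G z))"

definition grad_loc :: "(complex \<Rightarrow> real^2^2) \<Rightarrow> (complex \<Rightarrow> real) \<Rightarrow> complex \<Rightarrow> real^2" where
  "grad_loc G f z = matrix_inv (G z) *v (\<chi> i. pd i f z)"

definition divergence :: "('m chart \<Rightarrow> complex \<Rightarrow> real) \<Rightarrow> ('m chart \<Rightarrow> complex \<Rightarrow> real^2^2) \<Rightarrow>
    ('m chart \<Rightarrow> complex \<Rightarrow> real^2) \<Rightarrow> 'm chart \<Rightarrow> complex \<Rightarrow> real" where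
  "divergence w J V c z = div_loc (met w J c) (V c) z"

definition laplacian :: "('m chart \<Rightarrow> complex \<Rightarrow> real) \<Rightarrow> ('m chart \<Rightarrow> complex \<Rightarrow> real^2^2) \<Rightarrow>
    ('m \<Rightarrow> real) \<Rightarrow> 'm chart \<Rightarrow> complex \<Rightarrow> real" where
  "laplacian w J f c z = - div_loc (met w J c) (grad_loc (met w J c) (f \<circ> pt c)) z"

section \<open>The Biquard--Gauduchon function\<close>

definition T_AC :: "real^2^2 \<Rightarrow> (real^2^2) set" where
  "T_AC J = {A. A ** J + J ** A = 0 \<and> transpose A ** Om ** J + transpose J ** Om ** A = 0}"

text \<open>$f(L)v$ for an operator $L$ that is diagonalisable on the subspace \<open>V\<close>: decompose $v$
  into eigenvectors.\<close>

definition fun_calc :: "(real^2^2) set \<Rightarrow> (real \<Rightarrow> real) \<Rightarrow> (real^2^2 \<Rightarrow> real^2^2) \<Rightarrow> real^2^2 \<Rightarrow> real^2^2" where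
  "fun_calc V f L v = (THE x. \<exists>\<Lambda> u. finite \<Lambda> \<and>
      (\<forall>t\<in>\<Lambda>. u t \<in> V \<and> L (u t) = t *\<^sub>R u t) \<and>
      v = (\<Sum>t\<in>\<Lambda>. u t) \<and> x = (\<Sum>t\<in>\<Lambda>. f t *\<^sub>R u t))"

definition Xi :: "real^2^2 \<Rightarrow> real^2^2 \<Rightarrow> real^2^2" where
  "Xi A B = (-1/2) *\<^sub>R (A ** A ** B + B ** A ** A)"

text \<open>The singularity at 0 is removable, with value $\frac14$.\<close>

definition f_BG :: "real \<Rightarrow> real" where
  "f_BG x = (if x = 0 then 1/4 else (1/x) * (sqrt (1 + x) - 1 - ln ((1 + sqrt (1 + x)) / 2)))"

definition rho :: "(real^2^2) \<times> (complex^2^2) \<Rightarrow> real" where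
  "rho = (\<lambda>(J, \<alpha>). let A = re_transpose \<alpha> in
      (1/2) * trace (fun_calc (T_AC J) f_BG (Xi A) A ** A))"

definition Tstar_AC :: "((real^2^2) \<times> (complex^2^2)) set" where
  "Tstar_AC = {(J, \<alpha>). compatible Om J \<and> cotangent Om J \<alpha>}"

text \<open>The differential at \<open>x\<close> of a function defined on a submanifold \<open>N\<close>, applied to a tangent vector \<open>v\<close>.\<close>

definition diff_on :: "('a::real_normed_vector) set \<Rightarrow> ('a \<Rightarrow> real) \<Rightarrow> 'a \<Rightarrow> 'a \<Rightarrow> real" where
  "diff_on N F x v = (THE d. \<exists>\<gamma>. \<gamma> 0 = x \<and> (\<forall>\<^sub>F t in nhds (0::real). \<gamma> t \<in> N) \<and>
      (\<gamma> has_vector_derivative v) (at 0) \<and> ((F \<circ> \<gamma>) has_real_derivative d) (at 0))"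

text \<open>The canonical complex structure of the holomorphic cotangent bundle of $\mathcal{AC}^+$. Write
  $T^{0,1}_J = \mathbb{C} v$ with $v = \partial_{\bar z} + \mu \partial_z$. For the complex structure
  $A \mapsto JA$ the Beltrami coefficient $\mu$ is a holomorphic coordinate on $\mathcal{AC}^+$. The
  covectors at $J$ are those with $\alpha^\intercal = c\, v \otimes \omega_0(v, \cdot)$, and since
  $\frac12 \mathrm{Tr}(\alpha^\intercal \dot J)$ is a constant multiple of $c\, \dot\mu$, the dual fibre
  coordinate is a constant multiple of $c$. So the entries of the matrix $\alpha$ are
  holomorphic in the canonical coordinates, and $I$ multiplies $\dot\alpha$ by $\mathrm{i}$.\<close>

definition I_can :: "(real^2^2) \<times> (complex^2^2) \<Rightarrow> (real^2^2) \<times> (complex^2^2) \<Rightarrow> (real^2^2) \<times> (complex^2^2)" where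
  "I_can = (\<lambda>(J, \<alpha>) (J', \<alpha>'). (J ** J', mat \<i> ** \<alpha>'))"

definition dc_rho :: "(real^2^2) \<times> (complex^2^2) \<Rightarrow> (real^2^2) \<times> (complex^2^2) \<Rightarrow> real" where
  "dc_rho x v = - diff_on Tstar_AC rho x (I_can x v)"

section \<open>The real moment map\<close>

text \<open>$\mathrm{d}h = - X_h \lrcorner \omega_0$.\<close>

definition ham_vf :: "('m chart \<Rightarrow> complex \<Rightarrow> real) \<Rightarrow> ('m \<Rightarrow> real) \<Rightarrow> 'm chart \<Rightarrow> complex \<Rightarrow> real^2" where
  "ham_vf w h c z = (THE X. \<forall>k. pd k (h \<circ> pt c) z = - (X \<bullet> (form_mat w c z *v axis k 1)))"

definition vf_jac :: "(complex \<Rightarrow> real^2) \<Rightarrow> complex \<Rightarrow> real^2^2" where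
  "vf_jac X z = (\<chi> i j. pd j (\<lambda>y. X y $ i) z)"

text \<open>Lie derivatives of an endomorphism field of $TM$, respectively of $T^*M \otimes \mathbb{C}$.\<close>

definition lie_J :: "(complex \<Rightarrow> real^2) \<Rightarrow> (complex \<Rightarrow> real^2^2) \<Rightarrow> complex \<Rightarrow> real^2^2" where
  "lie_J X J z = (\<Sum>k\<in>UNIV. X z $ k *\<^sub>R pd k J z) - vf_jac X z ** J z + J z ** vf_jac X z"

definition lie_\<alpha> :: "(complex \<Rightarrow> real^2) \<Rightarrow> (complex \<Rightarrow> complex^2^2) \<Rightarrow> complex \<Rightarrow> complex^2^2" where
  "lie_\<alpha> X \<alpha> z = (\<Sum>k\<in>UNIV. X z $ k *\<^sub>R pd k \<alpha> z)
      + cmat (transpose (vf_jac X z)) ** \<alpha> z - \<alpha> z ** cmat (transpose (vf_jac X z))"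

definition darboux_coord :: "(complex \<Rightarrow> real) \<Rightarrow> complex \<Rightarrow> (complex \<Rightarrow> complex) \<Rightarrow> bool" where
  "darboux_coord w z F \<longleftrightarrow> (\<exists>S. open S \<and> z \<in> S \<and> Cinf_on S F \<and> inj_on F S \<and>
      (\<forall>y\<in>S. transpose (jac F y) ** Om ** jac F y = w y *\<^sub>R Om))"

text \<open>Components in the coordinates \<open>F\<close> with Jacobian $P$; by $\mathrm{Sp}$-invariance the value of
  \<open>dc_rho_at\<close> does not depend on the choice of Darboux coordinates.\<close>

definition push :: "real^2^2 \<Rightarrow> (real^2^2) \<times> (complex^2^2) \<Rightarrow> (real^2^2) \<times> (complex^2^2)" where
  "push P = (\<lambda>(A, \<beta>). (P ** A ** matrix_inv P,
      cmat (transpose (matrix_inv P)) ** \<beta> ** cmat (transpose P)))"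

definition dc_rho_at :: "('m chart \<Rightarrow> complex \<Rightarrow> real) \<Rightarrow> ('m chart \<Rightarrow> complex \<Rightarrow> real^2^2) \<Rightarrow>
    ('m chart \<Rightarrow> complex \<Rightarrow> complex^2^2) \<Rightarrow> ('m \<Rightarrow> real) \<Rightarrow> 'm chart \<Rightarrow> complex \<Rightarrow> real" where
  "dc_rho_at w J \<alpha> h c z = (let P = jac (SOME F. darboux_coord (w c) z F) z; X = ham_vf w h c in
      dc_rho (push P (J c z, \<alpha> c z)) (push P (lie_J X (J c) z, lie_\<alpha> X (\<alpha> c) z)))"

definition average :: "'m measure \<Rightarrow> ('m \<Rightarrow> real) \<Rightarrow> real" where
  "average \<mu> f = (\<integral>p. f p \<partial>\<mu>) / measure \<mu> (space \<mu>)"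

definition real_moment_map :: "('m::t2_space) chart set \<Rightarrow> ('m chart \<Rightarrow> complex \<Rightarrow> real) \<Rightarrow>
    ('m chart \<Rightarrow> complex \<Rightarrow> real^2^2) \<Rightarrow> ('m chart \<Rightarrow> complex \<Rightarrow> complex^2^2) \<Rightarrow> ('m \<Rightarrow> real) \<Rightarrow> real" where
  "real_moment_map \<A> w J \<alpha> h = (let \<mu> = area_measure \<A> w; s = globally \<A> (scal w J) in
      (\<integral>p. 2 * (s p - average \<mu> s) * h p \<partial>\<mu>)
      + (\<integral>p. globally \<A> (dc_rho_at w J \<alpha> h) p \<partial>\<mu>))"

definition norm2 :: "'m chart set \<Rightarrow> ('m chart \<Rightarrow> complex \<Rightarrow> real) \<Rightarrow>
    ('m chart \<Rightarrow> complex \<Rightarrow> real^2^2) \<Rightarrow> ('m chart \<Rightarrow> complex \<Rightarrow> complex^2^2) \<Rightarrow> 'm \<Rightarrow> real" where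
  "norm2 \<A> w J \<alpha> = globally \<A> (norm_sq w J \<alpha>)"

definition psi :: "'m chart set \<Rightarrow> ('m chart \<Rightarrow> complex \<Rightarrow> real) \<Rightarrow>
    ('m chart \<Rightarrow> complex \<Rightarrow> real^2^2) \<Rightarrow> ('m chart \<Rightarrow> complex \<Rightarrow> complex^2^2) \<Rightarrow> 'm \<Rightarrow> real" where
  "psi \<A> w J \<alpha> p = 1 / (1 + sqrt (1 - (1/4) * norm2 \<A> w J \<alpha> p))"

section \<open>The closed form of the Biquard--Gauduchon function\<close>

lemmas mat2 = vec_eq_iff forall_2 sum_2 matrix_matrix_mult_def det_2 mat_def transpose_def
  trace_def map_matrix_def re_transpose_def Om_def

lemma cotangent_T_AC:
  assumes "(J, \<alpha>) \<in> Tstar_AC"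
  shows "re_transpose \<alpha> \<in> T_AC J"
proof -
  let ?A = "re_transpose \<alpha>"
  have c1: "cmat (transpose J) ** \<alpha> = mat \<i> ** \<alpha>"
    and c2: "\<alpha> ** cmat (transpose J) = mat (- \<i>) ** \<alpha>"
    and c3: "transpose (transpose ?A ** (Om ** J)) = transpose ?A ** (Om ** J)"
    using assms by (auto simp: Tstar_AC_def cotangent_def)
  have "cmat (transpose J) ** \<alpha> + \<alpha> ** cmat (transpose J) = 0"
    unfolding c1 c2 by (simp add: mat2)
  then have anti: "?A ** J + J ** ?A = 0"
    by (simp add: mat2 complex_eq_iff algebra_simps)
  have "transpose ?A ** Om ** J + transpose J ** Om ** ?A
      = transpose ?A ** (Om ** J) - transpose (transpose ?A ** (Om ** J))"
    by (simp add: mat2 algebra_simps)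
  then show ?thesis
    using anti c3 by (simp add: T_AC_def)
qed

lemma rho_closed_form:
  assumes "(J, \<alpha>) \<in> Tstar_AC"
  defines "A \<equiv> re_transpose \<alpha>"
  shows "rho (J, \<alpha>) = 1 - sqrt (1 + det A) + ln ((1 + sqrt (1 + det A)) / 2)"
proof -
  have AT: "A \<in> T_AC J" using cotangent_T_AC[OF assms(1)] by (simp add: A_def)
  then have anti: "A ** J = - (J ** A)" by (simp add: T_AC_def eq_neg_iff_add_eq_0)
  have JJ: "J ** J = - mat 1" using assms(1) by (simp add: Tstar_AC_def compatible_def)
  have tr: "trace A = 0"
  proof -
    have "A ** (J ** J) = (- (J ** A)) ** J" by (simp add: matrix_mul_assoc anti)
    moreover have "A ** (J ** J) = - A" by (simp add: JJ) (simp add: mat2)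
    moreover have "(- (J ** A)) ** J = - (J ** A ** J)" by (simp add: mat2 algebra_simps)
    ultimately have "A = J ** A ** J" by simp
    then have "trace A = trace (J ** A ** J)" by simp
    also have "\<dots> = trace (J ** J ** A)" by (simp add: mat2 algebra_simps)
    also have "\<dots> = - trace A" by (simp add: JJ) (simp add: mat2)
    finally show ?thesis by simp
  qed
  then have a22: "A $ 2 $ 2 = - A $ 1 $ 1" by (simp add: trace_def sum_2)
  have AA: "A ** A = - det A *\<^sub>R mat 1" by (simp add: mat2 a22 algebra_simps)
  have Xi: "Xi A B = det A *\<^sub>R B" for B
    unfolding Xi_def by (simp add: mat2 a22 algebra_simps; simp add: field_simps)
  have fc: "fun_calc (T_AC J) f_BG (Xi A) A = f_BG (det A) *\<^sub>R A"
    unfolding fun_calc_def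
  proof (rule the_equality)
    show "\<exists>\<Lambda> u. finite \<Lambda> \<and> (\<forall>t\<in>\<Lambda>. u t \<in> T_AC J \<and> Xi A (u t) = t *\<^sub>R u t) \<and>
        A = (\<Sum>t\<in>\<Lambda>. u t) \<and> f_BG (det A) *\<^sub>R A = (\<Sum>t\<in>\<Lambda>. f_BG t *\<^sub>R u t)"
      by (rule exI[of _ "{det A}"], rule exI[of _ "\<lambda>_. A"]) (simp add: AT Xi)
  next
    fix x
    assume "\<exists>\<Lambda> u. finite \<Lambda> \<and> (\<forall>t\<in>\<Lambda>. u t \<in> T_AC J \<and> Xi A (u t) = t *\<^sub>R u t) \<and>
        A = (\<Sum>t\<in>\<Lambda>. u t) \<and> x = (\<Sum>t\<in>\<Lambda>. f_BG t *\<^sub>R u t)"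
    then obtain \<Lambda> u where *: "\<forall>t\<in>\<Lambda>. Xi A (u t) = t *\<^sub>R u t" "A = (\<Sum>t\<in>\<Lambda>. u t)"
      "x = (\<Sum>t\<in>\<Lambda>. f_BG t *\<^sub>R u t)" by auto
    have "f_BG t *\<^sub>R u t = f_BG (det A) *\<^sub>R u t" if "t \<in> \<Lambda>" for t
      using *(1) that by (cases "u t = 0") (auto simp: Xi)
    then have "x = (\<Sum>t\<in>\<Lambda>. f_BG (det A) *\<^sub>R u t)"
      unfolding *(3) by (rule sum.cong[OF refl])
    also have "\<dots> = f_BG (det A) *\<^sub>R (\<Sum>t\<in>\<Lambda>. u t)" by (rule scaleR_sum_right[symmetric])
    finally show "x = f_BG (det A) *\<^sub>R A" by (simp only: *(2)[symmetric])
  qed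
  have "trace ((f_BG (det A) *\<^sub>R A) ** A) = - 2 * (f_BG (det A) * det A)"
    by (simp add: mat2 a22 algebra_simps)
  then have "rho (J, \<alpha>) = - (f_BG (det A) * det A)"
    by (simp add: rho_def Let_def fc flip: A_def)
  then show ?thesis by (simp add: f_BG_def)
qed

end

theory Submission
  imports Defs "HOL-Complex_Analysis.Cauchy_Integral_Formula"
begin

text \<open>Write $A = \mathrm{Re}(\alpha)^\intercal$ and $s = \sqrt{1 + \det A} = \sqrt{1 - \frac14\|\alpha\|^2}$. The differential of
  $\rho = 1 - s + \log\frac{1 + s}{2}$ depends only on $\dot\alpha$, which gives the pointwise formula
  $d^c\rho(\dot J, \dot\alpha) = \frac{1}{2(1 + s)} \mathrm{Tr}(\mathrm{Re}\,\alpha \cdot \mathrm{Im}\,\dot\alpha)$. The right-hand side is invariant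
  under conjugation, so Darboux coordinates can be replaced by arbitrary ones. For the Hamiltonian field $X$ of $h$ this
  density is a first-order expression in $X$, and in coordinates, with $\omega_0 = w\, dx \wedge dy$, it equals
  $h \cdot \mathrm{div}\, Y + \mathrm{div}\, V$, where $Y = \psi Q - \mathrm{grad} \log(1 + s)$ and $V$ is a vector field depending
  on $h$. Both are globally defined, hence $\int \mathrm{div}\, V\, \omega_0 = 0$ by the divergence theorem, and
  $\mathrm{div}\, Y = \Delta \log(1 + s) + \mathrm{div}(\psi Q)$ is the claimed density.\<close>

section \<open>Partial derivatives and classes of differentiability\<close>

text \<open>The density contains derivatives of X because \<alpha>' is a Lie derivative, but only as
  - (1 - s) tr(J dX): for \<alpha> = R + i N, both N R and R N are multiples of the transposed J.
  Removing this term costs the divergence of (s - 1) J X and leaves a covector \<kappa> evaluated at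
  X. Since X is dual to dh and Y to \<kappa> under the area form, \<kappa>(X) = - dh(Y), and a
  second integration by parts moves the derivative from h to Y. The coefficient 1 - s is D / (1 + s)
  with D = - det R = 1 - s^2. The charts are holomorphic for the fixed structure of the curve while
  J is arbitrary, so they are in general not J-holomorphic. All local formulas are therefore written
  in the real entries a, c of J and one complex entry of \<alpha>. Only the transition maps are
  holomorphic, and their second derivatives have to drop out of every global object. This matters
  because \<open>globally\<close> picks a chart at each point: continuity, integrability and the
  divergence theorem all rest on the independence of that choice.\<close>

lemma has_derivative_pd:
  "(f has_derivative f') (at z) \<Longrightarrow> pd k f z = f' (cbasis k)"
  unfolding pd_def by (metis frechet_derivative_at)

lemma cbasis_simps [simp]: "cbasis 1 = 1" "cbasis 2 = \<i>"
  by (simp_all add: cbasis_def)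

lemma complex_eq_cbasis: "v = Re v *\<^sub>R cbasis 1 + Im v *\<^sub>R cbasis 2"
  by (simp add: complex_eq_iff)

lemma has_derivative_pds:
  assumes "f differentiable (at z)"
  shows "(f has_derivative (\<lambda>v. Re v *\<^sub>R pd 1 f z + Im v *\<^sub>R pd 2 f z)) (at z)"
proof -
  have 1: "(f has_derivative frechet_derivative f (at z)) (at z)"
    using assms frechet_derivative_works by blast
  then interpret bounded_linear "frechet_derivative f (at z)"
    by (rule has_derivative_bounded_linear)
  have "frechet_derivative f (at z) = (\<lambda>v. Re v *\<^sub>R pd 1 f z + Im v *\<^sub>R pd 2 f z)"
    by (rule ext, subst complex_eq_cbasis) (simp only: pd_def add scaleR)
  with 1 show ?thesis by simp
qed

lemma pd_eqI:
  assumes "(f has_derivative (\<lambda>v. Re v *\<^sub>R f1 + Im v *\<^sub>R f2)) (at z)"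
  shows "pd 1 f z = f1" "pd 2 f z = f2"
  using has_derivative_pd[OF assms, of 1] has_derivative_pd[OF assms, of 2] by simp_all

text \<open>Functions that agree near \<open>z\<close> have the same set of derivatives there, so
  the choice inside \<open>frechet_derivative\<close> returns the same value for both, even where
  that set is empty.\<close>

lemma pd_cong:
  assumes "open S" "z \<in> S" "\<And>y. y \<in> S \<Longrightarrow> f y = g y"
  shows "pd k f z = pd k g z"
proof -
  have "(f has_derivative D) (at z) \<longleftrightarrow> (g has_derivative D) (at z)" for D
    using assms has_derivative_transform_within_open[of _ D z UNIV S] by (metis (no_types, lifting))
  then show ?thesis unfolding pd_def frechet_derivative_def by simp
qed

lemma differentiable_cong_open:
  assumes "open S" "z \<in> S" "\<And>y. y \<in> S \<Longrightarrow> f y = g y"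
  shows "f differentiable (at z) \<longleftrightarrow> g differentiable (at z)"
  using assms has_derivative_transform_within_open[of _ _ z UNIV S]
  unfolding differentiable_def by (metis (no_types, lifting))

lemma pd_const [simp]: "pd k (\<lambda>_. c) z = 0"
  by (rule has_derivative_pd[THEN trans]) (auto intro!: derivative_eq_intros)

lemma pd_add:
  assumes "f differentiable (at z)" "g differentiable (at z)"
  shows "pd k (\<lambda>y. f y + g y) z = pd k f z + pd k g z"
  using has_derivative_add[OF assms[unfolded frechet_derivative_works]]
  by (rule has_derivative_pd[THEN trans]) (simp add: pd_def)

lemma pd_diff:
  assumes "f differentiable (at z)" "g differentiable (at z)"
  shows "pd k (\<lambda>y. f y - g y) z = pd k f z - pd k g z"
  using has_derivative_diff[OF assms[unfolded frechet_derivative_works]]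
  by (rule has_derivative_pd[THEN trans]) (simp add: pd_def)

lemma pd_bounded_linear:
  assumes "bounded_linear L" "f differentiable (at z)"
  shows "pd k (\<lambda>y. L (f y)) z = L (pd k f z)"
  using bounded_linear.has_derivative[OF assms(1) assms(2)[unfolded frechet_derivative_works]]
  by (rule has_derivative_pd[THEN trans]) (simp add: pd_def)

lemma pd_minus: "f differentiable (at z) \<Longrightarrow> pd k (\<lambda>y. - f y) z = - pd k f z"
  using pd_bounded_linear[OF bounded_linear_minus[OF bounded_linear_ident], of f z k] by simp

lemma pd_bounded_bilinear:
  assumes "bounded_bilinear B" "f differentiable (at z)" "g differentiable (at z)"
  shows "pd k (\<lambda>y. B (f y) (g y)) z = B (pd k f z) (g z) + B (f z) (pd k g z)"
  using bounded_bilinear.FDERIV[OF assms(1) assms(2,3)[unfolded frechet_derivative_works]]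
  by (rule has_derivative_pd[THEN trans]) (simp add: pd_def)

lemmas pd_mult = pd_bounded_bilinear[OF bounded_bilinear_mult]
  and pd_scaleR = pd_bounded_bilinear[OF bounded_bilinear_scaleR]

lemma pd_sum:
  assumes "\<And>i. i \<in> I \<Longrightarrow> f i differentiable (at z)"
  shows "pd k (\<lambda>y. \<Sum>i\<in>I. f i y) z = (\<Sum>i\<in>I. pd k (f i) z)"
  using assms by (intro has_derivative_pd[THEN trans, OF has_derivative_sum])
    (auto simp: pd_def frechet_derivative_works)

lemma pd_inverse:
  fixes f :: "complex \<Rightarrow> real"
  assumes "f differentiable (at z)" "f z \<noteq> 0"
  shows "pd k (\<lambda>y. inverse (f y)) z = - (inverse (f z) * inverse (f z)) * pd k f z"
  using Deriv.has_derivative_inverse[OF assms(2) assms(1)[unfolded frechet_derivative_works]]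
  by (rule has_derivative_pd[THEN trans]) (simp add: pd_def mult_ac)

lemma pd_real_comp:
  fixes f :: "complex \<Rightarrow> real"
  assumes "f differentiable (at z)" "(g has_real_derivative g') (at (f z))"
  shows "pd k (\<lambda>y. g (f y)) z = g' * pd k f z"
  using has_derivative_compose[OF assms(1)[unfolded frechet_derivative_works]
      assms(2)[unfolded has_field_derivative_def]]
  by (rule has_derivative_pd[THEN trans]) (simp add: pd_def)

lemma differentiable_real_comp:
  fixes f :: "complex \<Rightarrow> real"
  assumes "f differentiable (at z)" "(g has_real_derivative g') (at (f z))"
  shows "(\<lambda>y. g (f y)) differentiable (at z)"
  using has_derivative_compose[OF assms(1)[unfolded frechet_derivative_works]
      assms(2)[unfolded has_field_derivative_def]] differentiableI by blast

lemma differentiable_bounded_bilinear: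
  assumes "bounded_bilinear B" "f differentiable (at z)" "g differentiable (at z)"
  shows "(\<lambda>y. B (f y) (g y)) differentiable (at z)"
  using bounded_bilinear.FDERIV[OF assms(1) assms(2,3)[unfolded frechet_derivative_works]]
  by (rule differentiableI)

lemma differentiable_bounded_linear:
  assumes "bounded_linear L" "f differentiable (at z)"
  shows "(\<lambda>y. L (f y)) differentiable (at z)"
  using bounded_linear.has_derivative[OF assms(1) assms(2)[unfolded frechet_derivative_works]]
  by (rule differentiableI)

primrec Ck_on :: "nat \<Rightarrow> complex set \<Rightarrow> (complex \<Rightarrow> 'b::real_normed_vector) \<Rightarrow> bool" where
  "Ck_on 0 S f \<longleftrightarrow> continuous_on S f"
| "Ck_on (Suc n) S f \<longleftrightarrow> (\<forall>z\<in>S. f differentiable (at z)) \<and> (\<forall>k. Ck_on n S (pd k f))"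

lemma Ck_on_SucD: "Ck_on (Suc n) S f \<Longrightarrow> Ck_on n S f"
proof (induction n arbitrary: f)
  case 0
  then show ?case
    by (auto intro!: continuous_at_imp_continuous_on differentiable_imp_continuous_within)
qed auto

lemma Ck_on_le: "m \<le> n \<Longrightarrow> Ck_on n S f \<Longrightarrow> Ck_on m S f"
  by (induction rule: dec_induct) (auto dest: Ck_on_SucD simp del: Ck_on.simps)

lemma Ck_on_continuous: "Ck_on n S f \<Longrightarrow> continuous_on S f"
  using Ck_on_le[of 0 n] by auto

lemma Ck_on_differentiable: "Ck_on n S f \<Longrightarrow> 0 < n \<Longrightarrow> z \<in> S \<Longrightarrow> f differentiable (at z)"
  by (cases n) auto

lemma Ck_on_pd: "Ck_on (Suc n) S f \<Longrightarrow> Ck_on n S (pd k f)"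
  by simp

lemma Ck_on_cong:
  assumes "open S" "\<And>y. y \<in> S \<Longrightarrow> f y = g y"
  shows "Ck_on n S f \<longleftrightarrow> Ck_on n S g"
  using assms(2)
proof (induction n arbitrary: f g)
  case 0
  then show ?case by (simp cong: continuous_on_cong)
next
  case (Suc n)
  have "pd k f y = pd k g y" if "y \<in> S" for k y
    using pd_cong[OF assms(1) that Suc.prems] by auto
  then have "Ck_on n S (pd k f) \<longleftrightarrow> Ck_on n S (pd k g)" for k
    by (rule Suc.IH)
  moreover have "f differentiable (at y) \<longleftrightarrow> g differentiable (at y)" if "y \<in> S" for y
    using differentiable_cong_open[OF assms(1) that] Suc.prems by blast
  ultimately show ?case by simp
qed

lemma Ck_on_subset: "Ck_on n S f \<Longrightarrow> T \<subseteq> S \<Longrightarrow> Ck_on n T f"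
  by (induction n arbitrary: f) (auto intro: continuous_on_subset)

text \<open>Glues a function given in a chart with its extension by zero, both for bump functions on
  the curve and for compactly supported integrands in the plane.\<close>

lemma Ck_on_Union:
  assumes "\<And>T. T \<in> \<T> \<Longrightarrow> open T \<and> Ck_on n T f"
  shows "Ck_on n (\<Union>\<T>) f"
  using assms
proof (induction n arbitrary: f)
  case 0
  then show ?case by (auto intro!: continuous_on_open_Union)
qed auto

lemma Ck_on_const [simp]: "Ck_on n S (\<lambda>_. c)"
  by (induction n arbitrary: c) (auto simp: pd_const[abs_def])

lemma Ck_on_bounded_linear:
  assumes L: "bounded_linear L" and S: "open S" and "Ck_on n S f"
  shows "Ck_on n S (\<lambda>y. L (f y))"
  using assms(3)
proof (induction n arbitrary: f)
  case 0
  then show ?case by (auto intro: bounded_linear.continuous_on[OF L])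
next
  case (Suc n)
  have "Ck_on n S (pd k (\<lambda>y. L (f y)))" for k
    using Ck_on_cong[OF S, of "pd k (\<lambda>y. L (f y))" "\<lambda>y. L (pd k f y)"] Suc
    by (auto simp: pd_bounded_linear[OF L])
  then show ?case using Suc.prems by (auto intro: differentiable_bounded_linear[OF L])
qed

lemma Ck_on_add:
  assumes S: "open S" and "Ck_on n S f" "Ck_on n S g"
  shows "Ck_on n S (\<lambda>y. f y + g y)"
  using assms(2,3)
proof (induction n arbitrary: f g)
  case 0
  then show ?case by (auto intro: continuous_intros)
next
  case (Suc n)
  have "Ck_on n S (pd k (\<lambda>y. f y + g y))" for k
    using Ck_on_cong[OF S, of "pd k (\<lambda>y. f y + g y)" "\<lambda>y. pd k f y + pd k g y"] Suc
    by (auto simp: pd_add)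
  then show ?case using Suc.prems by auto
qed

lemma Ck_on_bounded_bilinear:
  assumes B: "bounded_bilinear B" and S: "open S" and "Ck_on n S f" "Ck_on n S g"
  shows "Ck_on n S (\<lambda>y. B (f y) (g y))"
  using assms(3,4)
proof (induction n arbitrary: f g)
  case 0
  then show ?case by (auto intro: bounded_bilinear.continuous_on[OF B])
next
  case (Suc n)
  have "Ck_on n S (\<lambda>y. B (pd k f y) (g y) + B (f y) (pd k g y))" for k
    by (intro Ck_on_add[OF S] Suc.IH) (use Suc.prems Ck_on_SucD in \<open>blast intro: Ck_on_pd\<close>)+
  then have "Ck_on n S (pd k (\<lambda>y. B (f y) (g y)))" for k
    using Ck_on_cong[OF S, of "pd k (\<lambda>y. B (f y) (g y))"
        "\<lambda>y. B (pd k f y) (g y) + B (f y) (pd k g y)"] Suc.prems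
    by (simp add: pd_bounded_bilinear[OF B])
  then show ?case using Suc.prems by (auto intro: differentiable_bounded_bilinear[OF B])
qed

lemmas Ck_on_mult = Ck_on_bounded_bilinear[OF bounded_bilinear_mult]
  and Ck_on_scaleR = Ck_on_bounded_bilinear[OF bounded_bilinear_scaleR]

lemma Ck_on_minus: "open S \<Longrightarrow> Ck_on n S f \<Longrightarrow> Ck_on n S (\<lambda>y. - f y)"
  using Ck_on_bounded_linear[OF bounded_linear_minus[OF bounded_linear_ident]] by blast

lemma Ck_on_diff:
  "open S \<Longrightarrow> Ck_on n S f \<Longrightarrow> Ck_on n S g \<Longrightarrow> Ck_on n S (\<lambda>y. f y - g y)"
  using Ck_on_add[OF _ _ Ck_on_minus, of S n f g] by simp

lemma Ck_on_sum:
  assumes "open S" "\<And>i. i \<in> I \<Longrightarrow> Ck_on n S (f i)"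
  shows "Ck_on n S (\<lambda>y. \<Sum>i\<in>I. f i y)"
  using assms by (induction I rule: infinite_finite_induct) (auto intro: Ck_on_add)

lemma Ck_on_inverse:
  fixes f :: "complex \<Rightarrow> real"
  assumes S: "open S" and "Ck_on n S f" and nz: "\<And>y. y \<in> S \<Longrightarrow> f y \<noteq> 0"
  shows "Ck_on n S (\<lambda>y. inverse (f y))"
  using assms(2)
proof (induction n)
  case 0
  then show ?case using nz by (auto intro: continuous_intros)
next
  case (Suc n)
  have "Ck_on n S (\<lambda>y. - (inverse (f y) * inverse (f y)) * pd k f y)" for k
    by (intro Ck_on_mult[OF S] Ck_on_minus[OF S] Suc.IH)
      (use Suc.prems Ck_on_SucD in \<open>blast intro: Ck_on_pd\<close>)+
  then have "Ck_on n S (pd k (\<lambda>y. inverse (f y)))" for k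
    using Ck_on_cong[OF S, of "pd k (\<lambda>y. inverse (f y))"
        "\<lambda>y. - (inverse (f y) * inverse (f y)) * pd k f y"] Suc.prems nz
    by (simp add: pd_inverse)
  then show ?case using Suc.prems nz by auto
qed

lemma Ck_on_divide:
  fixes f g :: "complex \<Rightarrow> real"
  shows "open S \<Longrightarrow> Ck_on n S f \<Longrightarrow> Ck_on n S g \<Longrightarrow> (\<And>y. y \<in> S \<Longrightarrow> g y \<noteq> 0)
    \<Longrightarrow> Ck_on n S (\<lambda>y. f y / g y)"
  unfolding divide_inverse by (intro Ck_on_mult Ck_on_inverse)

lemma Ck_on_sqrt:
  fixes f :: "complex \<Rightarrow> real"
  assumes S: "open S" and "Ck_on n S f" and pos: "\<And>y. y \<in> S \<Longrightarrow> f y > 0"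
  shows "Ck_on n S (\<lambda>y. sqrt (f y))"
  using assms(2)
proof (induction n)
  case 0
  then show ?case by (auto intro: continuous_intros)
next
  case (Suc n)
  \<comment> \<open>The square root reappears in its own derivative, under an inverse, so the
    induction hypothesis covers it.\<close>
  have p: "pd k (\<lambda>y. sqrt (f y)) y = inverse (sqrt (f y)) / 2 * pd k f y" if "y \<in> S" for k y
    using pd_real_comp[OF Ck_on_differentiable[OF Suc.prems _ that] DERIV_real_sqrt[OF pos[OF that]]]
    by simp
  have "sqrt (f y) \<noteq> 0" if "y \<in> S" for y using pos[OF that] by simp
  then have "Ck_on n S (\<lambda>y. inverse (sqrt (f y)) / 2 * pd k f y)" for k
    by (intro Ck_on_mult[OF S] Ck_on_divide[OF S] Ck_on_inverse[OF S] Suc.IH)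
      (use Suc.prems Ck_on_SucD in \<open>auto intro: Ck_on_pd simp del: Ck_on.simps\<close>)
  then have "Ck_on n S (pd k (\<lambda>y. sqrt (f y)))" for k
    using Ck_on_cong[OF S, of "pd k (\<lambda>y. sqrt (f y))"
        "\<lambda>y. inverse (sqrt (f y)) / 2 * pd k f y"] by (simp add: p)
  moreover have "(\<lambda>y. sqrt (f y)) differentiable (at z)" if "z \<in> S" for z
    using differentiable_real_comp[OF Ck_on_differentiable[OF Suc.prems _ that]
        DERIV_real_sqrt[OF pos[OF that]]] by simp
  ultimately show ?case by auto
qed

lemma Ck_on_ln:
  fixes f :: "complex \<Rightarrow> real"
  assumes S: "open S" and "Ck_on n S f" and pos: "\<And>y. y \<in> S \<Longrightarrow> f y > 0"
  shows "Ck_on n S (\<lambda>y. ln (f y))"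
\<comment> \<open>A case distinction instead of an induction: the derivative
  \<open>inverse (f y) * pd k f y\<close> is free of the logarithm.\<close>
proof (cases n)
  case 0
  have "f y \<noteq> 0" if "y \<in> S" for y using pos[OF that] by simp
  then show ?thesis using 0 assms(2) by (auto intro!: continuous_on_ln)
next
  case (Suc m)
  have p: "pd k (\<lambda>y. ln (f y)) y = inverse (f y) * pd k f y" if "y \<in> S" for k y
    using pd_real_comp[OF Ck_on_differentiable[OF assms(2) _ that] DERIV_ln[OF pos[OF that]]] Suc
    by simp
  have nz: "f y \<noteq> 0" if "y \<in> S" for y using pos[OF that] by simp
  have "Ck_on m S (\<lambda>y. inverse (f y) * pd k f y)" for k
    by (intro Ck_on_mult[OF S] Ck_on_inverse[OF S])
      (use assms(2) Suc Ck_on_SucD nz in \<open>auto intro: Ck_on_pd simp del: Ck_on.simps\<close>)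
  then have "Ck_on m S (pd k (\<lambda>y. ln (f y)))" for k
    using Ck_on_cong[OF S, of "pd k (\<lambda>y. ln (f y))"
        "\<lambda>y. inverse (f y) * pd k f y"] by (simp add: p)
  moreover have "(\<lambda>y. ln (f y)) differentiable (at z)" if "z \<in> S" for z
    using differentiable_real_comp[OF Ck_on_differentiable[OF assms(2) _ that]
        DERIV_ln[OF pos[OF that]]] Suc by simp
  ultimately show ?thesis by (auto simp: Suc)
qed

lemma Cinf_on_Ck_on:
  assumes S: "open S" and "Cinf_on S f"
  shows "Ck_on n S f"
proof -
  obtain D where D0: "\<And>z. z \<in> S \<Longrightarrow> D 0 0 z = f z"
    and D: "\<And>i j z. z \<in> S \<Longrightarrow> (D i j has_derivative
        (\<lambda>v. Re v *\<^sub>R D (Suc i) j z + Im v *\<^sub>R D i (Suc j) z)) (at z)"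
    using assms(2) unfolding Cinf_on_def by metis
  \<comment> \<open>Proved for the whole family at once, as the partial derivatives of
    \<open>D i j\<close> are its neighbours in the family.\<close>
  have "Ck_on n S (D i j)" for i j
  proof (induction n arbitrary: i j)
    case 0
    show ?case using D[THEN has_derivative_continuous]
      by (auto intro!: continuous_at_imp_continuous_on)
  next
    case (Suc n)
    have "Ck_on n S (pd k (D i j))" for k
      using Ck_on_cong[OF S, of "pd k (D i j)" "if k = 1 then D (Suc i) j else D i (Suc j)"]
        pd_eqI[OF D] Suc exhaust_2[of k] by (cases "k = 1") auto
    then show ?case using D differentiableI by (auto; blast)
  qed
  then show ?thesis using Ck_on_cong[OF S, of "D 0 0" f] D0 by blast
qed

lemma
  assumes F: "F differentiable (at z)" and g: "g differentiable (at (F z))"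
  shows pd_compose: "pd k (\<lambda>y. g (F y)) z = (\<Sum>j\<in>UNIV. jac F z $ j $ k *\<^sub>R pd j g (F z))"
    and differentiable_compose_plane: "(\<lambda>y. g (F y)) differentiable (at z)"
proof -
  note d = has_derivative_compose[OF F[THEN has_derivative_pds] g[THEN has_derivative_pds]]
  show "(\<lambda>y. g (F y)) differentiable (at z)" using d by (rule differentiableI)
  show "pd k (\<lambda>y. g (F y)) z = (\<Sum>j\<in>UNIV. jac F z $ j $ k *\<^sub>R pd j g (F z))"
    unfolding has_derivative_pd[OF d] using exhaust_2[of k]
    by (auto simp: sum_2 jac_def)
qed

lemma bounded_linear_vec_nth2: "bounded_linear (\<lambda>A::'a::real_normed_vector^'n^'m. A $ i $ j)"
  by (intro bounded_linear_compose[OF bounded_linear_vec_nth] bounded_linear_vec_nth)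

lemma jac_nth: "jac F z $ i $ j = (if i = 1 then Re (pd j F z) else Im (pd j F z))"
  by (simp add: jac_def)

lemma Ck_on_compose:
  assumes S: "open S" and T: "open T" and FT: "F ` S \<subseteq> T"
    and "Ck_on n S F" "Ck_on n T g"
  shows "Ck_on n S (\<lambda>y. g (F y))"
  using assms(4,5)
proof (induction n arbitrary: g)
  case 0
  then show ?case using FT by (auto intro: continuous_on_compose2)
next
  case (Suc n)
  have d: "F differentiable (at z)" "g differentiable (at (F z))" if "z \<in> S" for z
    using Suc.prems FT that by auto
  have j: "Ck_on n S (\<lambda>y. jac F y $ i $ k)" for i k
    unfolding jac_nth using Suc.prems(1)
    by (cases "i = 1") (auto intro!: Ck_on_bounded_linear[OF bounded_linear_Re S]
        Ck_on_bounded_linear[OF bounded_linear_Im S])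
  have "Ck_on n S (\<lambda>y. \<Sum>j\<in>UNIV. jac F y $ j $ k *\<^sub>R pd j g (F y))" for k
    by (rule Ck_on_sum[OF S], rule Ck_on_scaleR[OF S], rule j,
        rule Suc.IH[OF Ck_on_SucD[OF Suc.prems(1)] Ck_on_pd[OF Suc.prems(2)]])
  then have "Ck_on n S (pd k (\<lambda>y. g (F y)))" for k
    using Ck_on_cong[OF S, of "pd k (\<lambda>y. g (F y))"
        "\<lambda>y. \<Sum>j\<in>UNIV. jac F y $ j $ k *\<^sub>R pd j g (F y)"] by (simp add: pd_compose d)
  then show ?case using differentiable_compose_plane[OF d] by simp
qed

section \<open>Linear algebra of a single cotangent vector\<close>

lemma matrix_inv_eqI:
  fixes A :: "'a::field^'n^'n"
  assumes "A ** B = mat 1"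
  shows "matrix_inv A = B"
proof -
  have BA: "B ** A = mat 1" using assms matrix_left_right_inverse by blast
  have "A ** matrix_inv A = mat 1 \<and> matrix_inv A ** A = mat 1"
    unfolding matrix_inv_def by (rule someI[of _ B]) (use assms BA in simp)
  then show ?thesis
    by (metis BA matrix_mul_assoc matrix_mul_lid matrix_mul_rid)
qed

lemma matrix_mul_scaleR_right: "A ** (r *\<^sub>R B) = r *\<^sub>R (A ** B)" for A B :: "real^2^2"
  by (simp add: mat2 algebra_simps)

lemma matrix_inv_2:
  fixes A :: "real^2^2"
  assumes "det A \<noteq> 0"
  shows "matrix_inv A = inverse (det A) *\<^sub>R
    vector [vector [A $ 2 $ 2, - A $ 1 $ 2], vector [- A $ 2 $ 1, A $ 1 $ 1]]"
proof (rule matrix_inv_eqI)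
  have "A ** vector [vector [A $ 2 $ 2, - A $ 1 $ 2], vector [- A $ 2 $ 1, A $ 1 $ 1]] = det A *\<^sub>R mat 1"
    by (simp add: mat2)
  then show "A ** (inverse (det A) *\<^sub>R
      vector [vector [A $ 2 $ 2, - A $ 1 $ 2], vector [- A $ 2 $ 1, A $ 1 $ 1]]) = mat 1"
    using assms by (simp add: matrix_mul_scaleR_right)
qed

lemma matrix_inv_mul:
  fixes A :: "real^2^2"
  assumes "det A \<noteq> 0"
  shows "matrix_inv A ** A = mat 1" "A ** matrix_inv A = mat 1"
proof -
  have "invertible A" using assms invertible_det_nz by blast
  then show "matrix_inv A ** A = mat 1" "A ** matrix_inv A = mat 1"
    unfolding invertible_def matrix_inv_def by (metis (mono_tags, lifting) someI)+
qed

text \<open>The upper half-plane picture: a = J11 and c = J21 > 0 are free coordinates on the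
  compatible structures. Positivity at the first basis vector gives c > 0, and then
  \<open>J ** J = - mat 1\<close> determines the other two entries; the factor \<open>x\<close>
  drops out.\<close>

lemma compatible_iff:
  assumes "x > 0"
  shows "compatible (x *\<^sub>R Om) J \<longleftrightarrow>
    J $ 2 $ 1 > 0 \<and> J $ 2 $ 2 = - J $ 1 $ 1 \<and> J $ 1 $ 2 = - (1 + (J $ 1 $ 1)\<^sup>2) / J $ 2 $ 1"
    (is "_ \<longleftrightarrow> ?R")
proof
  assume *: "compatible (x *\<^sub>R Om) J"
  then have JJ: "J ** J = - mat 1" by (simp add: compatible_def)
  have "axis 1 1 \<bullet> (((x *\<^sub>R Om) ** J) *v axis 1 1) > 0"
    using * by (auto simp: compatible_def simp del: One_nat_def) 
  then have "x * J $ 2 $ 1 > 0"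
    by (simp add: mat2 matrix_vector_mult_def inner_vec_def axis_def)
  then have c: "J $ 2 $ 1 > 0" using assms by (simp add: zero_less_mult_iff)
  moreover have "J $ 2 $ 1 * (J $ 1 $ 1 + J $ 2 $ 2) = 0"
    using JJ by (simp add: mat2 algebra_simps)
  moreover have "J $ 1 $ 1 * J $ 1 $ 1 + J $ 1 $ 2 * J $ 2 $ 1 = - 1"
    using JJ by (simp add: mat2)
  ultimately show ?R by (auto simp: eq_neg_iff_add_eq_0 add.commute) (simp add: field_simps power2_eq_square)
next
  assume R: ?R
  let ?a = "J $ 1 $ 1" and ?c = "J $ 2 $ 1"
  have "v \<bullet> (((x *\<^sub>R Om) ** J) *v v) > 0" if "v \<noteq> 0" for v
  proof -
    have "v $ 1 \<noteq> 0 \<or> v $ 2 \<noteq> 0" using that by (simp add: vec_eq_iff forall_2)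
    then have "(?c * v $ 1 - ?a * v $ 2)\<^sup>2 + (v $ 2)\<^sup>2 > 0"
      using R by (metis add_cancel_right_right diff_0_right less_numeral_extra(3) mult_zero_right mult_eq_0_iff
          sum_power2_gt_zero_iff)
    \<comment> \<open>Completing the square in x (c v1^2 - 2 a v1 v2 + (1 + a^2) v2^2 / c).\<close>
    moreover have "v \<bullet> (((x *\<^sub>R Om) ** J) *v v)
        = x / ?c * ((?c * v $ 1 - ?a * v $ 2)\<^sup>2 + (v $ 2)\<^sup>2)"
      using R by (simp add: mat2 matrix_vector_mult_def inner_vec_def field_simps power2_eq_square)
    ultimately show ?thesis using assms R by simp
  qed
  moreover have "J ** J = - mat 1"
    using R by (simp add: mat2 field_simps power2_eq_square)
  moreover have "transpose J ** (x *\<^sub>R Om) ** J = x *\<^sub>R Om"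
    using R by (simp add: mat2 field_simps power2_eq_square)
  ultimately show "compatible (x *\<^sub>R Om) J" by (simp add: compatible_def)
qed

text \<open>\<alpha> maps into the i-eigenline of the transposed J and vanishes on that same line,
  so it is determined up to a complex scalar, for which the entry \<alpha>12 serves. Explicitly,
  \<alpha> is a multiple of the column (c, -p) times the row (p, c).\<close>

lemma cotangent_iff:
  assumes "x > 0" "compatible (x *\<^sub>R Om) J"
  defines "p \<equiv> complex_of_real (J $ 1 $ 1) - \<i>" and "c \<equiv> complex_of_real (J $ 2 $ 1)"
  shows "cotangent (x *\<^sub>R Om) J \<alpha> \<longleftrightarrow> \<alpha> $ 1 $ 1 = p * \<alpha> $ 1 $ 2 / c \<and>
    \<alpha> $ 2 $ 2 = - (p * \<alpha> $ 1 $ 2 / c) \<and> \<alpha> $ 2 $ 1 = - (p\<^sup>2 * \<alpha> $ 1 $ 2 / c\<^sup>2)"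
    (is "_ \<longleftrightarrow> ?R")
proof -
  note J = assms(2)[unfolded compatible_iff[OF assms(1)]]
  have c: "c \<noteq> 0" using J by (simp add: c_def)
  have J12: "complex_of_real (J $ 1 $ 2) = - (1 + (of_real (J $ 1 $ 1))\<^sup>2) / c"
    using J by (simp add: c_def)
  show ?thesis
  proof
    assume *: "cotangent (x *\<^sub>R Om) J \<alpha>"
    then have 1: "cmat (transpose J) ** \<alpha> = mat \<i> ** \<alpha>"
      and 2: "\<alpha> ** cmat (transpose J) = mat (- \<i>) ** \<alpha>"
      by (auto simp: cotangent_def)
    have "of_real (J $ 1 $ 1) * \<alpha> $ 1 $ 1 + c * \<alpha> $ 2 $ 1 = \<i> * \<alpha> $ 1 $ 1"
      "of_real (J $ 1 $ 1) * \<alpha> $ 1 $ 2 + c * \<alpha> $ 2 $ 2 = \<i> * \<alpha> $ 1 $ 2"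
      using 1 by (simp_all add: mat2 c_def)
    moreover have "\<alpha> $ 1 $ 1 * c - \<alpha> $ 1 $ 2 * of_real (J $ 1 $ 1) = - \<i> * \<alpha> $ 1 $ 2"
      using 2 J by (simp add: mat2 c_def)
    ultimately have 1: "\<alpha> $ 1 $ 1 * c = p * \<alpha> $ 1 $ 2" and 2: "c * \<alpha> $ 2 $ 2 = - (p * \<alpha> $ 1 $ 2)"
      and 3: "c * \<alpha> $ 2 $ 1 = - (p * \<alpha> $ 1 $ 1)"
      by (simp_all add: p_def algebra_simps)
    have "c * (c * \<alpha> $ 2 $ 1) = - (p * (p * \<alpha> $ 1 $ 2))"
      unfolding 3 1[symmetric] by simp
    then show ?R
      using c 1 2 by (simp add: eq_divide_eq power2_eq_square mult_ac nonzero_neg_divide_eq_eq2 flip: minus_divide_left)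
  next
    assume R: ?R
    \<comment> \<open>The multiple in this rank-one form; in terms of it all entries are polynomials
      in p and c.\<close>
    define m where "m = \<alpha> $ 1 $ 2 / c\<^sup>2"
    have \<alpha>: "\<alpha> $ 1 $ 2 = c\<^sup>2 * m" "\<alpha> $ 1 $ 1 = p * c * m" "\<alpha> $ 2 $ 2 = - (p * c * m)"
      "\<alpha> $ 2 $ 1 = - (p\<^sup>2 * m)"
      using R c by (simp_all add: m_def power2_eq_square)
    have a: "of_real (J $ 1 $ 1) = p + \<i>" by (simp add: p_def)
    have "1 + (p + \<i>)\<^sup>2 = p * (p + 2 * \<i>)" by (simp add: power2_eq_square algebra_simps)
    then have b: "of_real (J $ 1 $ 2) = - (p * (p + 2 * \<i>) / c)" using J12 a by simp
    have d: "of_real (J $ 2 $ 2) = - (p + \<i>)" using J a by simp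
    have "cmat (transpose J) ** \<alpha> = mat \<i> ** \<alpha>" "\<alpha> ** cmat (transpose J) = mat (- \<i>) ** \<alpha>"
      using c by (simp_all add: mat2 c_def[symmetric] a b d \<alpha>)
        (use c in \<open>simp_all add: power2_eq_square field_simps\<close>)
    moreover have "transpose (transpose (re_transpose \<alpha>) ** (x *\<^sub>R Om ** J))
        = transpose (re_transpose \<alpha>) ** (x *\<^sub>R Om ** J)"
    proof -
      have re: "Re (\<alpha> $ 1 $ 1) = J $ 2 $ 1 * (J $ 1 $ 1 * Re m + Im m)"
        "Re (\<alpha> $ 2 $ 2) = - (J $ 2 $ 1 * (J $ 1 $ 1 * Re m + Im m))"
        "Re (\<alpha> $ 1 $ 2) = (J $ 2 $ 1)\<^sup>2 * Re m"
        "Re (\<alpha> $ 2 $ 1) = - (((J $ 1 $ 1)\<^sup>2 - 1) * Re m + 2 * J $ 1 $ 1 * Im m)"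
        by (simp_all add: \<alpha> p_def c_def power2_eq_square algebra_simps)
      show ?thesis using J by (simp add: mat2 re field_simps power2_eq_square)
    qed
    ultimately show "cotangent (x *\<^sub>R Om) J \<alpha>" by (simp add: cotangent_def)
  qed
qed

section \<open>Tangent vectors to the cotangent bundle of the linear complex structures, and the
  differential of rho\<close>

lemma bounded_linear_axis: "bounded_linear (axis i :: 'a::euclidean_space \<Rightarrow> 'a^'n)"
  unfolding linear_conv_bounded_linear[symmetric]
  by (auto intro!: linearI simp: axis_def vec_eq_iff)

lemma has_vector_derivative_vec:
  fixes f :: "real \<Rightarrow> 'a::euclidean_space^'n"
  assumes "\<And>i. ((\<lambda>t. f t $ i) has_vector_derivative f' $ i) F"
  shows "(f has_vector_derivative f') F"
proof -
  have e: "v = (\<Sum>i\<in>UNIV. axis i (v $ i))" for v :: "'a^'n"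
    by (simp add: vec_eq_iff axis_def)
  have "((\<lambda>t. \<Sum>i\<in>UNIV. axis i (f t $ i)) has_vector_derivative (\<Sum>i\<in>UNIV. axis i (f' $ i))) F"
    by (intro has_vector_derivative_sum bounded_linear.has_vector_derivative[OF bounded_linear_axis] assms)
  then show ?thesis unfolding e[symmetric] .
qed

text \<open>The linearisation of J^2 = -1, J^T \<alpha> = i \<alpha> and \<alpha> J^T = -i \<alpha>.
  At a point of \<open>Tstar_AC\<close> every solution is the velocity of a curve, by
  \<open>curve_Tstar_AC\<close>, and the equations themselves can be checked with the product
  rule.\<close>

definition tangent_AC :: "real^2^2 \<Rightarrow> complex^2^2 \<Rightarrow> real^2^2 \<Rightarrow> complex^2^2 \<Rightarrow> bool" where
  "tangent_AC J \<alpha> J' \<alpha>' \<longleftrightarrow> J ** J' + J' ** J = 0 \<and>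
     cmat (transpose J') ** \<alpha> + cmat (transpose J) ** \<alpha>' = mat \<i> ** \<alpha>' \<and>
     \<alpha>' ** cmat (transpose J) + \<alpha> ** cmat (transpose J') = mat (- \<i>) ** \<alpha>'"

text \<open>As J anticommutes with J', the transpose of J J' is both J'^T J^T and - J^T J'^T. The
  first form suits the equation in which it multiplies \<alpha> from the left, the second the one in
  which it multiplies from the right; each equation then becomes i times the old one.\<close>

lemma tangent_AC_I_can:
  assumes "cotangent W J \<alpha>" "tangent_AC J \<alpha> J' \<alpha>'"
  shows "tangent_AC J \<alpha> (J ** J') (mat \<i> ** \<alpha>')"
proof -
  have c: "cmat (transpose J) ** \<alpha> = mat \<i> ** \<alpha>" "\<alpha> ** cmat (transpose J) = mat (- \<i>) ** \<alpha>"
    using assms(1) by (auto simp: cotangent_def)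
  have t: "J ** J' = - (J' ** J)"
    "cmat (transpose J') ** \<alpha> + cmat (transpose J) ** \<alpha>' = mat \<i> ** \<alpha>'"
    "\<alpha>' ** cmat (transpose J) + \<alpha> ** cmat (transpose J') = mat (- \<i>) ** \<alpha>'"
    using assms(2) by (auto simp: tangent_AC_def eq_neg_iff_add_eq_0)
  have T: "cmat (transpose (J ** J')) = cmat (transpose J') ** cmat (transpose J)"
    by (simp add: mat2)
  have T': "cmat (transpose (J ** J')) = - (cmat (transpose J) ** cmat (transpose J'))"
    unfolding t by (simp add: mat2 algebra_simps)
  have k: "A ** (mat k ** B) = mat k ** (A ** B)" for A B :: "complex^2^2" and k
    by (simp add: mat2 algebra_simps)
  have "cmat (transpose (J ** J')) ** \<alpha> + cmat (transpose J) ** (mat \<i> ** \<alpha>')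
      = mat \<i> ** (cmat (transpose J') ** \<alpha> + cmat (transpose J) ** \<alpha>')"
    unfolding T by (simp add: matrix_mul_assoc[symmetric] c k matrix_add_ldistrib)
  moreover have "(mat \<i> ** \<alpha>') ** cmat (transpose J) + \<alpha> ** cmat (transpose (J ** J'))
      = mat \<i> ** (\<alpha>' ** cmat (transpose J) + \<alpha> ** cmat (transpose J'))"
  proof -
    have "\<alpha> ** cmat (transpose (J ** J')) = - ((\<alpha> ** cmat (transpose J)) ** cmat (transpose J'))"
      unfolding T' by (simp add: mat2 algebra_simps)
    also have "\<dots> = mat \<i> ** (\<alpha> ** cmat (transpose J'))"
      unfolding c by (simp add: mat2 algebra_simps)
    finally show ?thesis by (simp add: matrix_mul_assoc[symmetric] matrix_add_ldistrib)
  qed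
  moreover have "J ** (J ** J') + J ** J' ** J = 0"
    using assms(2) by (simp add: tangent_AC_def matrix_mul_assoc[symmetric] flip: matrix_add_ldistrib)
  ultimately show ?thesis
    unfolding tangent_AC_def t(2,3) k[of "mat (- \<i>)" "\<i>" \<alpha>'] by blast
qed

text \<open>The matrices of $\mathrm{Tstar\_AC}$ are parametrised by $a = J_{11}$, $c = J_{21}$ and
  $\beta = \alpha_{12}$, so that a tangent vector is the velocity of the curve along which these
  three coordinates are affine.\<close>

definition AC_J :: "real \<Rightarrow> real \<Rightarrow> real^2^2" where
  "AC_J a c = vector [vector [a, - (1 + a\<^sup>2) / c], vector [c, - a]]"

definition AC_\<alpha> :: "real \<Rightarrow> real \<Rightarrow> complex \<Rightarrow> complex^2^2" where
  "AC_\<alpha> a c \<beta> = (let p = complex_of_real a - \<i> in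
     vector [vector [p * \<beta> / of_real c, \<beta>],
             vector [- (p\<^sup>2 * \<beta> / (of_real c)\<^sup>2), - (p * \<beta> / of_real c)]])"

lemma Tstar_AC_iff:
  "(J, \<alpha>) \<in> Tstar_AC \<longleftrightarrow> J $ 2 $ 1 > 0 \<and> J = AC_J (J $ 1 $ 1) (J $ 2 $ 1) \<and>
     \<alpha> = AC_\<alpha> (J $ 1 $ 1) (J $ 2 $ 1) (\<alpha> $ 1 $ 2)"
proof -
  have "compatible Om J \<longleftrightarrow> J $ 2 $ 1 > 0 \<and> J = AC_J (J $ 1 $ 1) (J $ 2 $ 1)"
    using compatible_iff[of 1 J] by (auto simp: AC_J_def vec_eq_iff forall_2)
  moreover have "cotangent Om J \<alpha> \<longleftrightarrow> \<alpha> = AC_\<alpha> (J $ 1 $ 1) (J $ 2 $ 1) (\<alpha> $ 1 $ 2)"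
    if "compatible Om J"
    using cotangent_iff[of 1 J \<alpha>] that by (auto simp: AC_\<alpha>_def Let_def vec_eq_iff forall_2)
  ultimately show ?thesis by (auto simp: Tstar_AC_def)
qed

text \<open>\<open>diff_on\<close> is a description over curves, so it can be evaluated only once
  some curve with the given velocity is known. The curve with affine a, c and \<beta> has the right
  velocity in these three entries, and the linearised equations force the other entries to
  agree.\<close>

lemma curve_Tstar_AC:
  assumes x: "(J, \<alpha>) \<in> Tstar_AC" and v: "tangent_AC J \<alpha> J' \<alpha>'"
  obtains \<gamma> where "\<gamma> 0 = (J, \<alpha>)" "\<forall>\<^sub>F t in nhds (0::real). \<gamma> t \<in> Tstar_AC"
    "(\<gamma> has_vector_derivative (J', \<alpha>')) (at 0)"
proof
  define a c \<beta> where "a = J $ 1 $ 1" and "c = J $ 2 $ 1" and "\<beta> = \<alpha> $ 1 $ 2"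
  define a' c' \<beta>' where "a' = J' $ 1 $ 1" and "c' = J' $ 2 $ 1" and "\<beta>' = \<alpha>' $ 1 $ 2"
  have J: "J = AC_J a c" and \<alpha>: "\<alpha> = AC_\<alpha> a c \<beta>" and c: "c > 0"
    using x unfolding Tstar_AC_iff a_def c_def \<beta>_def by auto
  define \<gamma> where "\<gamma> t = (AC_J (a + t * a') (c + t * c'), AC_\<alpha> (a + t * a') (c + t * c') (\<beta> + t *\<^sub>R \<beta>'))" for t
  have p: "\<forall>\<^sub>F t in nhds 0. c + t * c' > 0"
  proof -
    have "((\<lambda>t. c + t * c') \<longlongrightarrow> c + 0 * c') (nhds 0)"
      by (intro tendsto_intros filterlim_ident)
    then show ?thesis using c order_tendstoD(1) by fastforce
  qed
  show "\<gamma> 0 = (J, \<alpha>)" by (simp add: \<gamma>_def J \<alpha>)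
  show "\<forall>\<^sub>F t in nhds (0::real). \<gamma> t \<in> Tstar_AC"
    using p by (rule eventually_mono) (simp add: \<gamma>_def Tstar_AC_iff AC_J_def AC_\<alpha>_def Let_def)
  \<comment> \<open>Solved from J J' + J' J = 0; these are the derivatives of - (1 + a^2) / c and -
    a along the affine curve.\<close>
  have J12: "J' $ 1 $ 2 = (1 + a\<^sup>2) * c' / c\<^sup>2 - 2 * a * a' / c" and J22: "J' $ 2 $ 2 = - a'"
  proof -
    have *: "J ** J' + J' ** J = 0" using v by (simp add: tangent_AC_def)
    have "c * (a' + J' $ 2 $ 2) = 0" "2 * a * a' - (1 + a\<^sup>2) / c * c' + J' $ 1 $ 2 * c = 0"
      using * unfolding J by (simp_all add: mat2 AC_J_def a'_def c'_def algebra_simps add_divide_distrib diff_divide_distrib)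
    then have "c * (a' + J' $ 2 $ 2) = 0" and "J' $ 1 $ 2 * c = (1 + a\<^sup>2) / c * c' - 2 * a * a'"
      by linarith+
    moreover from this(2) have "J' $ 1 $ 2 = ((1 + a\<^sup>2) / c * c' - 2 * a * a') / c"
      using c by (simp add: eq_divide_eq)
    ultimately show "J' $ 2 $ 2 = - a'" "J' $ 1 $ 2 = (1 + a\<^sup>2) * c' / c\<^sup>2 - 2 * a * a' / c"
      using c by (simp_all add: eq_neg_iff_add_eq_0 add.commute diff_divide_distrib power2_eq_square)
  qed
  have d: "((\<lambda>t. a + t * a') has_vector_derivative a') (at 0)" 
    "((\<lambda>t. c + t * c') has_vector_derivative c') (at 0)" 
    by (auto intro!: derivative_eq_intros simp flip: has_real_derivative_iff_has_vector_derivative)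
  have 1: "((\<lambda>t. AC_J (a + t * a') (c + t * c')) has_vector_derivative J') (at 0)"
  proof (intro has_vector_derivative_vec)
    show "((\<lambda>t. AC_J (a + t * a') (c + t * c') $ i $ j) has_vector_derivative J' $ i $ j) (at 0)" for i j
      using c exhaust_2[of i] exhaust_2[of j] unfolding has_real_derivative_iff_has_vector_derivative[symmetric]
      by (auto simp: AC_J_def J12 J22 a'_def[symmetric] c'_def[symmetric] power2_eq_square field_simps intro!: derivative_eq_intros)
  qed
  define p where "p = complex_of_real a - \<i>"
  define f where "f = p * \<beta> / of_real c"
  \<comment> \<open>The derivative of p \<beta> / c by the quotient rule. The entry \<alpha>21 = -
    (p f / c) has the same shape with f in place of \<beta>, so the rule is applied a second
    time.\<close>
  define f' where "f' = (p * \<beta>' + of_real a' * \<beta>) / of_real c - of_real c' * f / of_real c"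
  have \<alpha>12: "\<alpha> $ 1 $ 1 = f" "\<alpha> $ 1 $ 2 = \<beta>" "\<alpha> $ 2 $ 1 = - (p * f / of_real c)" "\<alpha> $ 2 $ 2 = - f"
    unfolding \<alpha> by (simp_all add: AC_\<alpha>_def Let_def f_def p_def power2_eq_square)
  have \<alpha>'11: "\<alpha>' $ 1 $ 1 = f'" and \<alpha>'22: "\<alpha>' $ 2 $ 2 = - f'"
    and \<alpha>'21: "\<alpha>' $ 2 $ 1 = - ((p * f' + of_real a' * f) / of_real c - of_real c' * (p * f / of_real c) / of_real c)"
  proof -
    have t: "cmat (transpose J') ** \<alpha> + cmat (transpose J) ** \<alpha>' = mat \<i> ** \<alpha>'"
      "\<alpha>' ** cmat (transpose J) + \<alpha> ** cmat (transpose J') = mat (- \<i>) ** \<alpha>'"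
      using v by (auto simp: tangent_AC_def)
    have ai: "of_real a = p + \<i>" by (simp add: p_def)
    have Je: "J $ 1 $ 1 = a" "J $ 2 $ 1 = c" "J $ 2 $ 2 = - a" by (simp_all add: J AC_J_def)
    note J'e = a'_def[symmetric] c'_def[symmetric] J22 \<beta>'_def[symmetric]
    have "\<alpha>' $ 1 $ 1 * of_real c - \<beta>' * of_real a + f * of_real c' - \<beta> * of_real a' = - \<i> * \<beta>'"
      using t(2) by (simp add: mat2 Je J'e \<alpha>12 algebra_simps)
    then have 1: "\<alpha>' $ 1 $ 1 * of_real c = p * \<beta>' + of_real a' * \<beta> - of_real c' * f"
      by (simp add: ai algebra_simps)
    show 11: "\<alpha>' $ 1 $ 1 = f'"
    proof -
      have "\<alpha>' $ 1 $ 1 = (p * \<beta>' + of_real a' * \<beta> - of_real c' * f) / of_real c"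
        using 1 c by (simp add: eq_divide_eq)
      then show ?thesis by (simp add: f'_def diff_divide_distrib)
    qed
    have "of_real a' * \<beta> - of_real c' * f + of_real a * \<beta>' + of_real c * \<alpha>' $ 2 $ 2 = \<i> * \<beta>'"
      using t(1) by (simp add: mat2 Je J'e \<alpha>12 algebra_simps)
    then have "of_real c * \<alpha>' $ 2 $ 2 = - (p * \<beta>' + of_real a' * \<beta> - of_real c' * f)"
      by (simp add: ai algebra_simps)
    also have "\<dots> = - (of_real c * f')" using 1 unfolding 11 by (simp add: mult.commute)
    finally have "of_real c * \<alpha>' $ 2 $ 2 = - (of_real c * f')" .
    then have "complex_of_real c * \<alpha>' $ 2 $ 2 = complex_of_real c * - f'" by simp
    then show "\<alpha>' $ 2 $ 2 = - f'" by (rule mult_left_cancel[THEN iffD1, rotated]) (use c in simp)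
    have "of_real a' * f - of_real c' * (p * f / of_real c) + of_real a * f' + of_real c * \<alpha>' $ 2 $ 1 = \<i> * f'"
      using t(1) by (simp add: mat2 Je J'e \<alpha>12 11 algebra_simps)
    then have "of_real c * \<alpha>' $ 2 $ 1 = - (p * f' + of_real a' * f - of_real c' * (p * f / of_real c))"
      by (simp add: ai algebra_simps eq_neg_iff_add_eq_0)
    then have "\<alpha>' $ 2 $ 1 = - (p * f' + of_real a' * f - of_real c' * (p * f / of_real c)) / of_real c"
      using c by (simp add: eq_divide_eq mult.commute)
    then show "\<alpha>' $ 2 $ 1 = - ((p * f' + of_real a' * f) / of_real c - of_real c' * (p * f / of_real c) / of_real c)"
      by (simp add: diff_divide_distrib minus_divide_left)
  qed
  have 2: "((\<lambda>t. AC_\<alpha> (a + t * a') (c + t * c') (\<beta> + t *\<^sub>R \<beta>')) has_vector_derivative \<alpha>') (at 0)"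
  proof (intro has_vector_derivative_vec)
    let ?u = "\<lambda>t. inverse (c + t * c')" and ?p = "\<lambda>t. complex_of_real (a + t * a') - \<i>"
    let ?f = "\<lambda>t. ?u t *\<^sub>R (?p t * (\<beta> + t *\<^sub>R \<beta>'))" and ?q = "\<lambda>t. ?u t *\<^sub>R ?p t"
    have u: "(?u has_real_derivative (- c' / c\<^sup>2)) (at 0)"
      using c by (auto intro!: derivative_eq_intros simp: power2_eq_square divide_inverse)
    have p': "(?p has_vector_derivative of_real a') (at 0)"
      using d(1) by (auto intro!: derivative_eq_intros has_vector_derivative_of_real simp: has_real_derivative_iff_has_vector_derivative)
    have b': "((\<lambda>t. \<beta> + t *\<^sub>R \<beta>') has_vector_derivative \<beta>') (at 0)"
      by (auto intro!: derivative_eq_intros)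
    have "(?f has_vector_derivative ?u 0 *\<^sub>R (?p 0 * \<beta>' + of_real a' * (\<beta> + 0 *\<^sub>R \<beta>'))
        + (- c' / c\<^sup>2) *\<^sub>R (?p 0 * (\<beta> + 0 *\<^sub>R \<beta>'))) (at 0)"
      by (intro has_vector_derivative_scaleR u has_vector_derivative_mult p' b')
    moreover have "?u 0 *\<^sub>R (?p 0 * \<beta>' + of_real a' * (\<beta> + 0 *\<^sub>R \<beta>'))
        + (- c' / c\<^sup>2) *\<^sub>R (?p 0 * (\<beta> + 0 *\<^sub>R \<beta>')) = f'"
      using c by (simp add: f'_def f_def p_def scaleR_conv_of_real field_simps power2_eq_square)
    ultimately have f: "(?f has_vector_derivative f') (at 0)" by simp
    have q: "(?q has_vector_derivative ?u 0 *\<^sub>R of_real a' + (- c' / c\<^sup>2) *\<^sub>R ?p 0) (at 0)"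
      by (intro has_vector_derivative_scaleR u p')
    have "((\<lambda>t. ?f t * ?q t) has_vector_derivative
        ?f 0 * (?u 0 *\<^sub>R of_real a' + (- c' / c\<^sup>2) *\<^sub>R ?p 0) + f' * ?q 0) (at 0)"
      by (intro has_vector_derivative_mult f q)
    moreover have "?f 0 * (?u 0 *\<^sub>R of_real a' + (- c' / c\<^sup>2) *\<^sub>R ?p 0) + f' * ?q 0
        = (p * f' + of_real a' * f) / of_real c - of_real c' * (p * f / of_real c) / of_real c"
      using c by (simp add: f_def p_def[symmetric] scaleR_conv_of_real field_simps power2_eq_square)
    ultimately have fq: "((\<lambda>t. ?f t * ?q t) has_vector_derivative
        (p * f' + of_real a' * f) / of_real c - of_real c' * (p * f / of_real c) / of_real c) (at 0)"
      by simp
    have e: "AC_\<alpha> (a + t * a') (c + t * c') (\<beta> + t *\<^sub>R \<beta>') =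
        vector [vector [?f t, \<beta> + t *\<^sub>R \<beta>'], vector [- (?f t * ?q t), - ?f t]]" for t
      by (simp add: AC_\<alpha>_def Let_def scaleR_conv_of_real divide_inverse power2_eq_square mult_ac)
    show "((\<lambda>t. AC_\<alpha> (a + t * a') (c + t * c') (\<beta> + t *\<^sub>R \<beta>') $ i $ j)
        has_vector_derivative \<alpha>' $ i $ j) (at 0)" for i j
      unfolding e using exhaust_2[of i] exhaust_2[of j] f b' 
        has_vector_derivative_minus[OF f] has_vector_derivative_minus[OF fq]
      by (auto simp: \<alpha>'11 \<alpha>'21 \<alpha>'22 \<beta>'_def[symmetric] simp del: scaleR_conv_of_real)
  qed
  show "(\<gamma> has_vector_derivative (J', \<alpha>')) (at 0)"
    unfolding \<gamma>_def using 1 2 by (rule has_vector_derivative_Pair)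
qed


text \<open>One curve witnesses existence in the description; uniqueness holds because the
  derivative is the same along every curve with this velocity.\<close>

lemma diff_on_eqI:
  assumes "\<gamma> 0 = x" "\<forall>\<^sub>F t in nhds 0. \<gamma> t \<in> N" "(\<gamma> has_vector_derivative v) (at 0)"
    and d: "\<And>\<gamma>. \<gamma> 0 = x \<Longrightarrow> \<forall>\<^sub>F t in nhds 0. \<gamma> t \<in> N \<Longrightarrow> (\<gamma> has_vector_derivative v) (at 0)
      \<Longrightarrow> ((F \<circ> \<gamma>) has_real_derivative d) (at 0)"
  shows "diff_on N F x v = d"
  unfolding diff_on_def
proof (rule the_equality)
  show "\<exists>\<gamma>. \<gamma> 0 = x \<and> (\<forall>\<^sub>F t in nhds 0. \<gamma> t \<in> N) \<and> (\<gamma> has_vector_derivative v) (at 0) \<and>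
      ((F \<circ> \<gamma>) has_real_derivative d) (at 0)"
    using assms by blast
qed (use d DERIV_unique in blast)

text \<open>By \<open>rho_closed_form\<close>, rho is a function r of det R with R = Re \<alpha>, so
  only \<alpha>' matters. The complex structure turns it into i \<alpha>', whose real part is - Im
  \<alpha>', and the derivative of det at the traceless R in direction M is - tr(R M). These two
  signs cancel, and the minus sign of r' is undone by the one in the definition of
  \<open>dc_rho\<close>.\<close>

lemma dc_rho_formula:
  assumes x: "(J, \<alpha>) \<in> Tstar_AC" and v: "tangent_AC J \<alpha> J' \<alpha>'"
    and pos: "1 + det (map_matrix Re \<alpha>) > 0"
  shows "dc_rho (J, \<alpha>) (J', \<alpha>') =
    trace (map_matrix Re \<alpha> ** map_matrix Im \<alpha>') / (2 * (1 + sqrt (1 + det (map_matrix Re \<alpha>))))"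
proof -
  define \<delta> where "\<delta> = det (map_matrix Re \<alpha>)"
  define r where "r y = 1 - sqrt (1 + y) + ln ((1 + sqrt (1 + y)) / 2)" for y :: real
  have \<alpha>22: "Re (\<alpha> $ 2 $ 2) = - Re (\<alpha> $ 1 $ 1)"
    using x unfolding Tstar_AC_iff AC_\<alpha>_def by (metis (no_types, lifting) vector_2(1) vector_2(2) uminus_complex.sel(1))
  \<comment> \<open>The factor 1/s of the inner derivative cancels, since 1 - 1/(1 + s) = s/(1 +
    s).\<close>
  have r': "(r has_real_derivative - 1 / (2 * (1 + sqrt (1 + \<delta>)))) (at \<delta>)"
  proof -
    have s: "sqrt (1 + \<delta>) > 0" using pos by (simp add: \<delta>_def)
    then have "((\<lambda>y. 1 - sqrt (1 + y) + ln ((1 + sqrt (1 + y)) / 2)) has_real_derivative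
        (- (inverse (sqrt (1 + \<delta>)) / 2) + 1 / ((1 + sqrt (1 + \<delta>)) / 2) * (inverse (sqrt (1 + \<delta>)) / 2 / 2))) (at \<delta>)"
      using pos by (auto intro!: derivative_eq_intros simp: \<delta>_def[symmetric] add_pos_pos)
    moreover have "- (inverse (sqrt (1 + \<delta>)) / 2) + 1 / ((1 + sqrt (1 + \<delta>)) / 2) * (inverse (sqrt (1 + \<delta>)) / 2 / 2)
        = - 1 / (2 * (1 + sqrt (1 + \<delta>)))"
    proof -
      have "- (inverse s / 2) + 1 / ((1 + s) / 2) * (inverse s / 2 / 2) = - 1 / (2 * (1 + s))" if "s > 0" for s :: real
        using that by (simp add: divide_simps)
      then show ?thesis using s by blast
    qed
    ultimately show ?thesis unfolding r_def by simp
  qed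
  have Iv: "tangent_AC J \<alpha> (J ** J') (mat \<i> ** \<alpha>')"
    using x v by (intro tangent_AC_I_can) (auto simp: Tstar_AC_def)
  obtain \<gamma> where \<gamma>: "\<gamma> 0 = (J, \<alpha>)" "\<forall>\<^sub>F t in nhds (0::real). \<gamma> t \<in> Tstar_AC"
    "(\<gamma> has_vector_derivative (J ** J', mat \<i> ** \<alpha>')) (at 0)"
    using curve_Tstar_AC[OF x Iv] .
  have "diff_on Tstar_AC rho (J, \<alpha>) (J ** J', mat \<i> ** \<alpha>') =
      - 1 / (2 * (1 + sqrt (1 + \<delta>))) * trace (map_matrix Re \<alpha> ** map_matrix Im \<alpha>')"
  proof (rule diff_on_eqI[OF \<gamma>])
    fix \<gamma> :: "real \<Rightarrow> (real^2^2) \<times> (complex^2^2)"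
    assume \<gamma>: "\<gamma> 0 = (J, \<alpha>)" "\<forall>\<^sub>F t in nhds (0::real). \<gamma> t \<in> Tstar_AC"
      "(\<gamma> has_vector_derivative (J ** J', mat \<i> ** \<alpha>')) (at 0)"
    define R where "R i j t = Re (snd (\<gamma> t) $ i $ j)" for i j t
    have R: "(R i j has_real_derivative Re ((mat \<i> ** \<alpha>') $ i $ j)) (at 0)" for i j
    proof -
      have "bounded_linear (\<lambda>x :: (real^2^2) \<times> (complex^2^2). Re (snd x $ i $ j))"
        by (intro bounded_linear_compose[OF bounded_linear_Re]
            bounded_linear_compose[OF bounded_linear_vec_nth2] bounded_linear_snd)
      from bounded_linear.has_vector_derivative[OF this \<gamma>(3)] show ?thesis
        unfolding R_def has_real_derivative_iff_has_vector_derivative by simp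
    qed
    have R0: "R i j 0 = Re (\<alpha> $ i $ j)" for i j by (simp add: R_def \<gamma>)
    define \<delta>t where "\<delta>t t = R 1 1 t * R 2 2 t - R 1 2 t * R 2 1 t" for t
    have "(\<delta>t has_real_derivative trace (map_matrix Re \<alpha> ** map_matrix Im \<alpha>')) (at 0)"
      unfolding \<delta>t_def
      by (auto intro!: derivative_eq_intros R simp: R0 \<alpha>22 mat2 algebra_simps)
    moreover have "\<delta>t 0 = \<delta>" by (simp add: \<delta>t_def R0 \<delta>_def mat2)
    ultimately have "((\<lambda>t. r (\<delta>t t)) has_real_derivative
        - 1 / (2 * (1 + sqrt (1 + \<delta>))) * trace (map_matrix Re \<alpha> ** map_matrix Im \<alpha>')) (at 0)"
      using DERIV_chain2[of r _ \<delta>t 0] r' by metis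
    \<comment> \<open>The closed form holds on \<open>Tstar_AC\<close>, and the curve is known to
      stay there only for t near 0.\<close>
    moreover have "\<forall>\<^sub>F t in nhds 0. (rho \<circ> \<gamma>) t = r (\<delta>t t)"
      using \<gamma>(2)
    proof (rule eventually_mono)
      fix t assume t: "\<gamma> t \<in> Tstar_AC"
      have "det (re_transpose (snd (\<gamma> t))) = \<delta>t t"
        by (simp add: \<delta>t_def R_def mat2)
      then show "(rho \<circ> \<gamma>) t = r (\<delta>t t)"
        using rho_closed_form[of "fst (\<gamma> t)" "snd (\<gamma> t)"] t by (simp add: r_def)
    qed
    ultimately show "((rho \<circ> \<gamma>) has_real_derivative
        - 1 / (2 * (1 + sqrt (1 + \<delta>))) * trace (map_matrix Re \<alpha> ** map_matrix Im \<alpha>')) (at 0)"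
      by (rule DERIV_cong_ev[OF refl _ refl, THEN iffD2, rotated])
  qed
  then show ?thesis by (simp add: dc_rho_def I_can_def \<delta>_def)
qed

section \<open>Push-forward of points and tangent vectors to Darboux coordinates\<close>

lemma matrix_add_rdistrib2: "(A + B) ** C = A ** C + B ** C" for A B :: "'a::semiring_1^2^2"
  by (simp add: mat2 algebra_simps)

lemma cmat_mult: "cmat (A ** B) = cmat A ** cmat B"
  by (simp add: mat2)

lemma map_matrix_Re_cmat: "map_matrix Re (cmat A ** \<beta> ** cmat B) = A ** map_matrix Re \<beta> ** B"
  and map_matrix_Im_cmat: "map_matrix Im (cmat A ** \<beta> ** cmat B) = A ** map_matrix Im \<beta> ** B"
  by (simp_all add: mat2)

lemma mat_mult_left_commute: "A ** (mat k ** B) = mat k ** (A ** B)" for A B :: "complex^2^2"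
  by (simp add: mat2 algebra_simps)

context
  fixes P Q :: "real^2^2" and x :: real
  assumes x: "x > 0" and P: "transpose P ** Om ** P = x *\<^sub>R Om"
  defines "Q \<equiv> matrix_inv P"
begin

lemma det_push: "det P = x"
proof -
  have "det P = (transpose P ** Om ** P) $ 1 $ 2" by (simp add: mat2 algebra_simps)
  also have "\<dots> = x" unfolding P by (simp add: mat2)
  finally show ?thesis .
qed

lemma push_inverse: "P ** Q = mat 1" "Q ** P = mat 1"
  using matrix_inv_mul[of P] x det_push by (auto simp: Q_def)

lemma push_inverse_assoc: "A ** P ** Q = A" "A ** Q ** P = A"
  by (simp_all add: push_inverse flip: matrix_mul_assoc)

lemma push_inverse_cmat: "cmat (transpose P) ** cmat (transpose Q) = mat 1" "cmat (transpose Q) ** cmat (transpose P) = mat 1"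
proof -
  have "transpose P ** transpose Q = mat 1" "transpose Q ** transpose P = mat 1"
    by (simp_all only: matrix_transpose_mul[symmetric] push_inverse transpose_mat)
  moreover have "cmat (mat 1) = mat 1" by (simp add: mat2)
  ultimately show "cmat (transpose P) ** cmat (transpose Q) = mat 1" "cmat (transpose Q) ** cmat (transpose P) = mat 1"
    by (simp_all only: cmat_mult[symmetric])
qed

lemma push_inverse_cmat_assoc: "A ** cmat (transpose P) ** cmat (transpose Q) = A" "A ** cmat (transpose Q) ** cmat (transpose P) = A"
  by (simp_all add: push_inverse_cmat flip: matrix_mul_assoc)

text \<open>P carries the area form x Om to Om, so conjugation by P turns each condition for x Om
  into the corresponding one for Om.\<close>

lemma push_Tstar_AC:
  assumes "compatible (x *\<^sub>R Om) J" "cotangent (x *\<^sub>R Om) J \<alpha>"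
  shows "push P (J, \<alpha>) \<in> Tstar_AC"
proof -
  let ?K = "P ** J ** Q" and ?\<beta> = "cmat (transpose Q) ** \<alpha> ** cmat (transpose P)"
  note c = assms[unfolded compatible_def cotangent_def]
  have O: "transpose Q ** (x *\<^sub>R Om) ** Q = Om"
    by (simp add: P[symmetric] matrix_mul_assoc[symmetric] push_inverse)
      (simp add: matrix_mul_assoc push_inverse flip: matrix_transpose_mul)
  have "?K ** ?K = P ** (J ** J) ** Q"
    by (simp add: matrix_mul_assoc push_inverse_assoc)
  also have "\<dots> = - (P ** Q)" using c by (simp add: mat2)
  finally have 1: "?K ** ?K = - mat 1" by (simp add: push_inverse)
  have "transpose ?K ** Om ** ?K = transpose Q ** (transpose J ** (transpose P ** Om ** P) ** J) ** Q"
    by (simp add: matrix_transpose_mul matrix_mul_assoc)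
  also have "\<dots> = Om" unfolding P using c O by simp
  finally have 2: "transpose ?K ** Om ** ?K = Om" .
  have 3: "v \<bullet> ((Om ** ?K) *v v) > 0" if "v \<noteq> 0" for v
  proof -
    define u where "u = Q *v v"
    have v: "v = P *v u" by (simp add: u_def matrix_vector_mul_assoc push_inverse)
    then have "u \<noteq> 0" using that by auto
    have "v \<bullet> ((Om ** ?K) *v v) = (P *v u) \<bullet> ((Om ** P ** J) *v u)"
      unfolding v by (simp add: matrix_vector_mul_assoc matrix_mul_assoc push_inverse_assoc)
    also have "\<dots> = u \<bullet> ((transpose P ** Om ** P ** J) *v u)"
      using dot_lmul_matrix[of u "transpose P" "(Om ** P ** J) *v u"]
      by (simp add: matrix_vector_mul_assoc matrix_mul_assoc)
    finally show ?thesis using c \<open>u \<noteq> 0\<close> unfolding P by simp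
  qed
  have K: "cmat (transpose ?K) = cmat (transpose Q) ** cmat (transpose J) ** cmat (transpose P)"
    by (simp add: matrix_transpose_mul cmat_mult matrix_mul_assoc)
  have "cmat (transpose ?K) ** ?\<beta> = cmat (transpose Q) ** (cmat (transpose J) ** \<alpha>) ** cmat (transpose P)"
    unfolding K by (simp add: matrix_mul_assoc push_inverse_cmat_assoc)
  also have "\<dots> = mat \<i> ** ?\<beta>"
    using c by (simp add: mat_mult_left_commute flip: matrix_mul_assoc)
  finally have 4: "cmat (transpose ?K) ** ?\<beta> = mat \<i> ** ?\<beta>" .
  have "?\<beta> ** cmat (transpose ?K) = cmat (transpose Q) ** (\<alpha> ** cmat (transpose J)) ** cmat (transpose P)"
    unfolding K by (simp add: matrix_mul_assoc push_inverse_cmat_assoc)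
  also have "\<dots> = mat (- \<i>) ** ?\<beta>"
    using c by (simp add: mat_mult_left_commute flip: matrix_mul_assoc)
  finally have 5: "?\<beta> ** cmat (transpose ?K) = mat (- \<i>) ** ?\<beta>" .
  have "transpose (re_transpose ?\<beta>) ** (Om ** ?K)
      = transpose Q ** (transpose (re_transpose \<alpha>) ** (transpose P ** Om ** P ** J)) ** Q"
    by (simp add: re_transpose_def map_matrix_Re_cmat transpose_transpose matrix_mul_assoc)
  also have "\<dots> = transpose Q ** (transpose (re_transpose \<alpha>) ** (x *\<^sub>R Om ** J)) ** Q"
    unfolding P ..
  finally have 6: "transpose (transpose (re_transpose ?\<beta>) ** (Om ** ?K)) = transpose (re_transpose ?\<beta>) ** (Om ** ?K)"
    using c by (simp add: matrix_transpose_mul matrix_mul_assoc transpose_transpose)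
  show ?thesis
    using 1 2 3 4 5 6 by (simp add: Tstar_AC_def push_def compatible_def cotangent_def Q_def)
qed

lemma push_tangent_AC:
  assumes "tangent_AC J \<alpha> J' \<alpha>'"
  shows "tangent_AC (P ** J ** Q) (cmat (transpose Q) ** \<alpha> ** cmat (transpose P))
    (P ** J' ** Q) (cmat (transpose Q) ** \<alpha>' ** cmat (transpose P))"
proof -
  note t = assms[unfolded tangent_AC_def]
  let ?q = "cmat (transpose Q)" and ?p = "cmat (transpose P)"
  have K: "cmat (transpose (P ** J ** Q)) = ?q ** cmat (transpose J) ** ?p" for J
    by (simp add: matrix_transpose_mul cmat_mult matrix_mul_assoc)
  have "P ** J ** Q ** (P ** J' ** Q) + P ** J' ** Q ** (P ** J ** Q) = P ** (J ** J' + J' ** J) ** Q"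
    by (simp add: matrix_mul_assoc push_inverse_assoc matrix_add_ldistrib matrix_add_rdistrib2)
  also have "\<dots> = 0" using t by simp
  finally have 1: "P ** J ** Q ** (P ** J' ** Q) + P ** J' ** Q ** (P ** J ** Q) = 0" .
  have "cmat (transpose (P ** J' ** Q)) ** (?q ** \<alpha> ** ?p) + cmat (transpose (P ** J ** Q)) ** (?q ** \<alpha>' ** ?p)
      = ?q ** (cmat (transpose J') ** \<alpha> + cmat (transpose J) ** \<alpha>') ** ?p"
    unfolding K by (simp add: matrix_mul_assoc push_inverse_cmat_assoc matrix_add_ldistrib matrix_add_rdistrib2)
  also have "\<dots> = mat \<i> ** (?q ** \<alpha>' ** ?p)"
    using t by (simp add: mat_mult_left_commute flip: matrix_mul_assoc)
  finally have 2: "cmat (transpose (P ** J' ** Q)) ** (?q ** \<alpha> ** ?p) + cmat (transpose (P ** J ** Q)) ** (?q ** \<alpha>' ** ?p)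
      = mat \<i> ** (?q ** \<alpha>' ** ?p)" .
  have "?q ** \<alpha>' ** ?p ** cmat (transpose (P ** J ** Q)) + ?q ** \<alpha> ** ?p ** cmat (transpose (P ** J' ** Q))
      = ?q ** (\<alpha>' ** cmat (transpose J) + \<alpha> ** cmat (transpose J')) ** ?p"
    unfolding K by (simp add: matrix_mul_assoc push_inverse_cmat_assoc matrix_add_ldistrib matrix_add_rdistrib2)
  also have "\<dots> = mat (- \<i>) ** (?q ** \<alpha>' ** ?p)"
    using t by (simp add: mat_mult_left_commute flip: matrix_mul_assoc)
  finally show ?thesis unfolding tangent_AC_def using 1 2 by blast
qed

lemma dc_rho_push:
  assumes "compatible (x *\<^sub>R Om) J" "cotangent (x *\<^sub>R Om) J \<alpha>" "tangent_AC J \<alpha> J' \<alpha>'"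
    and pos: "1 + det (map_matrix Re \<alpha>) > 0"
  shows "dc_rho (push P (J, \<alpha>)) (push P (J', \<alpha>')) =
    trace (map_matrix Re \<alpha> ** map_matrix Im \<alpha>') / (2 * (1 + sqrt (1 + det (map_matrix Re \<alpha>))))"
proof -
  have d: "det (map_matrix Re (cmat (transpose Q) ** \<alpha> ** cmat (transpose P))) = det (map_matrix Re \<alpha>)"
  proof -
    have "det Q * det P = 1" using push_inverse(2) by (metis det_I det_mul)
    then show ?thesis unfolding map_matrix_Re_cmat by (simp add: det_mul det_transpose mult_ac)
  qed
  have "trace (transpose Q ** (map_matrix Re \<alpha> ** map_matrix Im \<alpha>') ** transpose P)
      = trace (map_matrix Re \<alpha> ** map_matrix Im \<alpha>')"
  proof -
    have "trace (transpose Q ** A ** transpose P) = trace A" for A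
      using trace_mul_sym[of "transpose Q ** A" "transpose P"]
      by (simp add: matrix_mul_assoc push_inverse flip: matrix_transpose_mul) 
    then show ?thesis .
  qed
  moreover have "transpose Q ** map_matrix Re \<alpha> ** transpose P ** (transpose Q ** map_matrix Im \<alpha>' ** transpose P)
      = transpose Q ** (map_matrix Re \<alpha> ** map_matrix Im \<alpha>') ** transpose P"
  proof -
    have "A ** transpose P ** transpose Q = A" for A :: "real^2^2"
      by (simp add: push_inverse flip: matrix_mul_assoc matrix_transpose_mul)
    then show ?thesis by (simp add: matrix_mul_assoc)
  qed
  ultimately show ?thesis
    using dc_rho_formula[OF _ push_tangent_AC[OF assms(3)]] push_Tstar_AC[OF assms(1,2)] pos
    by (simp add: push_def Q_def[symmetric] d) (simp add: map_matrix_Re_cmat map_matrix_Im_cmat)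
qed

end

section \<open>Formulas in a coordinate patch\<close>

lemma bounded_bilinear_matrix_mult_real: "bounded_bilinear ((**) :: real^2^2 \<Rightarrow> real^2^2 \<Rightarrow> real^2^2)"
  unfolding bilinear_conv_bounded_bilinear[symmetric] bilinear_def
  by (auto intro!: linearI simp: mat2 algebra_simps)

lemma bounded_bilinear_matrix_mult_complex:
  "bounded_bilinear ((**) :: complex^2^2 \<Rightarrow> complex^2^2 \<Rightarrow> complex^2^2)"
  unfolding bilinear_conv_bounded_bilinear[symmetric] bilinear_def
  by (auto intro!: linearI simp: mat2 algebra_simps)

lemma bounded_linear_cmat_transpose: "bounded_linear (\<lambda>A. cmat (transpose A))"
  unfolding linear_conv_bounded_linear[symmetric]
  by (auto intro!: linearI simp: vec_eq_iff transpose_def map_matrix_def scaleR_conv_of_real[where 'a=complex])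

lemma bounded_linear_mat_mult: "bounded_linear (\<lambda>A :: complex^2^2. mat k ** A)"
  by (rule bounded_bilinear.bounded_linear_right[OF bounded_bilinear_matrix_mult_complex])

lemma pd_nth2:
  fixes f :: "complex \<Rightarrow> 'a::real_normed_vector^'n^'m"
  assumes "f differentiable (at z)"
  shows "pd k (\<lambda>y. f y $ i $ j) z = pd k f z $ i $ j"
  using pd_bounded_linear[OF bounded_linear_vec_nth2 assms] .

lemma pd_Re: "f differentiable (at z) \<Longrightarrow> pd k (\<lambda>y. Re (f y)) z = Re (pd k f z)"
  and pd_Im: "f differentiable (at z) \<Longrightarrow> pd k (\<lambda>y. Im (f y)) z = Im (pd k f z)"
  by (simp_all add: pd_bounded_linear bounded_linear_Re bounded_linear_Im)

lemma tangent_AC_add: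
  assumes "tangent_AC J \<alpha> J1 \<alpha>1" "tangent_AC J \<alpha> J2 \<alpha>2"
  shows "tangent_AC J \<alpha> (J1 + J2) (\<alpha>1 + \<alpha>2)"
proof -
  have c: "cmat (transpose (J1 + J2)) = cmat (transpose J1) + cmat (transpose J2)"
    by (simp add: mat2)
  have 1: "J ** (J1 + J2) + (J1 + J2) ** J = (J ** J1 + J1 ** J) + (J ** J2 + J2 ** J)"
    by (simp add: matrix_add_ldistrib matrix_add_rdistrib2)
  have 2: "cmat (transpose (J1 + J2)) ** \<alpha> + cmat (transpose J) ** (\<alpha>1 + \<alpha>2)
     = (cmat (transpose J1) ** \<alpha> + cmat (transpose J) ** \<alpha>1) + (cmat (transpose J2) ** \<alpha> + cmat (transpose J) ** \<alpha>2)"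
    by (simp add: c matrix_add_ldistrib matrix_add_rdistrib2)
  have 3: "(\<alpha>1 + \<alpha>2) ** cmat (transpose J) + \<alpha> ** cmat (transpose (J1 + J2))
     = (\<alpha>1 ** cmat (transpose J) + \<alpha> ** cmat (transpose J1)) + (\<alpha>2 ** cmat (transpose J) + \<alpha> ** cmat (transpose J2))"
    by (simp add: c matrix_add_ldistrib matrix_add_rdistrib2)
  show ?thesis
    using assms unfolding tangent_AC_def 1 2 3 by (simp add: matrix_add_ldistrib)
qed

lemma tangent_AC_scaleR:
  assumes "tangent_AC J \<alpha> J1 \<alpha>1"
  shows "tangent_AC J \<alpha> (r *\<^sub>R J1) (r *\<^sub>R \<alpha>1)"
proof -
  note t = assms[unfolded tangent_AC_def]
  have c: "cmat (transpose (r *\<^sub>R J1)) = r *\<^sub>R cmat (transpose J1)"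
    using bounded_linear.linear[OF bounded_linear_cmat_transpose] linear_scale by blast
  have l: "A ** (r *\<^sub>R B) = r *\<^sub>R (A ** B)" "(r *\<^sub>R B) ** A = r *\<^sub>R (B ** A)" for A B :: "complex^2^2"
    by (simp_all add: mat2 scaleR_add_right)
  have m: "A ** (r *\<^sub>R B) = r *\<^sub>R (A ** B)" "(r *\<^sub>R B) ** A = r *\<^sub>R (B ** A)" for A B :: "real^2^2"
    by (simp_all add: mat2 algebra_simps)
  show ?thesis
    unfolding tangent_AC_def c l m scaleR_add_right[symmetric] using t by simp
qed

text \<open>The velocity at t = 0 of the conjugation orbit exp(-tC) J exp(tC), with the dual action
  on \<alpha>. With C = \<open>vf_jac X z\<close> it accounts for the part of the Lie derivatives
  that contains derivatives of X.\<close>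

lemma tangent_AC_commutator:
  assumes "J ** J = - mat 1" "cmat (transpose J) ** \<alpha> = mat \<i> ** \<alpha>"
    "\<alpha> ** cmat (transpose J) = mat (- \<i>) ** \<alpha>"
  shows "tangent_AC J \<alpha> (J ** C - C ** J) (cmat (transpose C) ** \<alpha> - \<alpha> ** cmat (transpose C))"
proof -
  let ?J = "cmat (transpose J)" and ?C = "cmat (transpose C)"
  have T: "cmat (transpose (J ** C - C ** J)) = ?C ** ?J - ?J ** ?C"
    by (simp add: mat2)
  have d: "A ** (B - D) = A ** B - A ** D" "(B - D) ** A = B ** A - D ** A" for A B D :: "complex^2^2"
    by (simp_all add: mat2 algebra_simps)
  have d': "A ** (B - D) = A ** B - A ** D" "(B - D) ** A = B ** A - D ** A" for A B D :: "real^2^2"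
    by (simp_all add: mat2 algebra_simps)
  have "J ** (J ** C - C ** J) + (J ** C - C ** J) ** J = (J ** J) ** C - C ** (J ** J)"
    unfolding d' by (simp add: matrix_mul_assoc)
  also have "\<dots> = 0" unfolding assms by (simp add: mat2)
  finally have 1: "J ** (J ** C - C ** J) + (J ** C - C ** J) ** J = 0" .
  have "(?C ** ?J - ?J ** ?C) ** \<alpha> + ?J ** (?C ** \<alpha> - \<alpha> ** ?C)
      = ?C ** (?J ** \<alpha>) - (?J ** \<alpha>) ** ?C"
    unfolding d by (simp add: matrix_mul_assoc)
  also have "\<dots> = mat \<i> ** (?C ** \<alpha> - \<alpha> ** ?C)"
    unfolding assms d by (simp add: mat_mult_left_commute flip: matrix_mul_assoc)
  finally have 2: "(?C ** ?J - ?J ** ?C) ** \<alpha> + ?J ** (?C ** \<alpha> - \<alpha> ** ?C) = mat \<i> ** (?C ** \<alpha> - \<alpha> ** ?C)" .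
  have "(?C ** \<alpha> - \<alpha> ** ?C) ** ?J + \<alpha> ** (?C ** ?J - ?J ** ?C)
      = ?C ** (\<alpha> ** ?J) - (\<alpha> ** ?J) ** ?C"
    unfolding d by (simp add: matrix_mul_assoc)
  also have "\<dots> = mat (- \<i>) ** (?C ** \<alpha> - \<alpha> ** ?C)"
    unfolding assms d by (simp add: mat_mult_left_commute flip: matrix_mul_assoc)
  finally show ?thesis unfolding tangent_AC_def T using 1 2 by blast
qed

text \<open>With $R = \mathrm{Re}\,\alpha$, the function \<open>Dfun\<close> is $-\det R = \frac14 \|\alpha\|^2$, and \<open>sfun\<close> is the square root
  occurring in the theorem. The vector field \<open>ham w \<kappa>\<close> is dual to the covector $\kappa$ under the area form
  $w\, dx \wedge dy$. The field \<open>ham w (kappa w J \<alpha>)\<close> turns out to be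
  $\psi Q - \mathrm{grad} \log(1 + s)$; its coordinate expression avoids the Levi-Civita connection. By
  \<open>local_identity\<close> below, \<open>flux\<close> is the vector field whose divergence is lost on integration.\<close>

definition Dfun :: "(complex \<Rightarrow> complex^2^2) \<Rightarrow> complex \<Rightarrow> real" where
  "Dfun \<alpha> z = - det (map_matrix Re (\<alpha> z))"

definition sfun :: "(complex \<Rightarrow> complex^2^2) \<Rightarrow> complex \<Rightarrow> real" where
  "sfun \<alpha> z = sqrt (1 - Dfun \<alpha> z)"

definition theta :: "(complex \<Rightarrow> complex^2^2) \<Rightarrow> 2 \<Rightarrow> complex \<Rightarrow> real" where
  "theta \<alpha> j z = trace (map_matrix Re (\<alpha> z) ** map_matrix Im (pd j \<alpha> z))"

definition divJ :: "(complex \<Rightarrow> real) \<Rightarrow> (complex \<Rightarrow> real^2^2) \<Rightarrow> 2 \<Rightarrow> complex \<Rightarrow> real" where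
  "divJ w J j z = (\<Sum>i\<in>UNIV. pd i (\<lambda>y. w y * J y $ i $ j) z)"

text \<open>By \<open>nabla_pairing\<close> this is, up to normalisation, the imaginary part of
  g(nabla \<alpha>, conj \<alpha>), written without connection coefficients.\<close>

definition eta :: "(complex \<Rightarrow> real) \<Rightarrow> (complex \<Rightarrow> real^2^2) \<Rightarrow> (complex \<Rightarrow> complex^2^2) \<Rightarrow> 2 \<Rightarrow> complex \<Rightarrow> real" where
  "eta w J \<alpha> j z = theta \<alpha> j z + 2 * Dfun \<alpha> z / w z * divJ w J j z"

definition kappa :: "(complex \<Rightarrow> real) \<Rightarrow> (complex \<Rightarrow> real^2^2) \<Rightarrow> (complex \<Rightarrow> complex^2^2) \<Rightarrow> 2 \<Rightarrow> complex \<Rightarrow> real" where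
  "kappa w J \<alpha> m z = eta w J \<alpha> m z / (2 * (1 + sfun \<alpha> z)) - (\<Sum>l\<in>UNIV. J z $ l $ m * pd l (sfun \<alpha>) z)"

definition ham :: "(complex \<Rightarrow> real) \<Rightarrow> (2 \<Rightarrow> complex \<Rightarrow> real) \<Rightarrow> complex \<Rightarrow> real^2" where
  "ham w \<kappa> z = inverse (w z) *\<^sub>R vector [- \<kappa> 2 z, \<kappa> 1 z]"

text \<open>The Riemannian divergence for any compatible J, because \<open>w\<close> is then the
  square root of the determinant of the metric.\<close>

definition divw :: "(complex \<Rightarrow> real) \<Rightarrow> (complex \<Rightarrow> real^2) \<Rightarrow> complex \<Rightarrow> real" where
  "divw w V z = (\<Sum>i\<in>UNIV. pd i (\<lambda>y. w y * V y $ i) z) / w z"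

definition dens_dc :: "(complex \<Rightarrow> real) \<Rightarrow> (complex \<Rightarrow> complex^2^2) \<Rightarrow> (complex \<Rightarrow> real) \<Rightarrow> complex \<Rightarrow> real" where
  "dens_dc w \<alpha> h z = trace (map_matrix Re (\<alpha> z) ** map_matrix Im (lie_\<alpha> (ham w (\<lambda>k. pd k h)) \<alpha> z))
     / (2 * (1 + sfun \<alpha> z))"

definition flux :: "(complex \<Rightarrow> real) \<Rightarrow> (complex \<Rightarrow> real^2^2) \<Rightarrow> (complex \<Rightarrow> complex^2^2) \<Rightarrow> (complex \<Rightarrow> real) \<Rightarrow> complex \<Rightarrow> real^2" where
  "flux w J \<alpha> h z = (sfun \<alpha> z - 1) *\<^sub>R (J z *v ham w (\<lambda>k. pd k h) z) - h z *\<^sub>R ham w (kappa w J \<alpha>) z"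

text \<open>Kept apart from \<open>patch\<close> because the bound
  \<open>Dfun \<alpha> z < 1\<close> is derived from the hypothesis on \<open>norm2\<close>, and the
  comparison of the two quantities already uses the local formulas of this locale.\<close>

locale prepatch =
  fixes S :: "complex set" and w :: "complex \<Rightarrow> real" and J :: "complex \<Rightarrow> real^2^2"
    and \<alpha> :: "complex \<Rightarrow> complex^2^2"
  assumes S: "open S" and w: "\<And>n. Ck_on n S w" and J: "\<And>n. Ck_on n S J" and \<alpha>: "\<And>n. Ck_on n S \<alpha>"
    and w_pos: "\<And>z. z \<in> S \<Longrightarrow> w z > 0"
    and compat: "\<And>z. z \<in> S \<Longrightarrow> compatible (w z *\<^sub>R Om) (J z)"
    and cotan: "\<And>z. z \<in> S \<Longrightarrow> cotangent (w z *\<^sub>R Om) (J z) (\<alpha> z)"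
begin

lemma w_nz: "z \<in> S \<Longrightarrow> w z \<noteq> 0"
  using w_pos by force

lemma J_nth: "Ck_on n S (\<lambda>y. J y $ i $ j)"
  by (rule Ck_on_bounded_linear[OF bounded_linear_vec_nth2 S J])

lemma \<alpha>_nth: "Ck_on n S (\<lambda>y. \<alpha> y $ i $ j)"
  by (rule Ck_on_bounded_linear[OF bounded_linear_vec_nth2 S \<alpha>])

lemma Re_\<alpha>: "Ck_on n S (\<lambda>y. Re (\<alpha> y $ i $ j))" and Im_\<alpha>: "Ck_on n S (\<lambda>y. Im (\<alpha> y $ i $ j))"
  by (rule Ck_on_bounded_linear[OF _ S \<alpha>_nth], simp add: bounded_linear_Re bounded_linear_Im)+

lemma Dfun_Ck: "Ck_on n S (Dfun \<alpha>)"
proof -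
  have "Ck_on n S (\<lambda>y. - (Re (\<alpha> y $ 1 $ 1) * Re (\<alpha> y $ 2 $ 2) - Re (\<alpha> y $ 1 $ 2) * Re (\<alpha> y $ 2 $ 1)))"
    by (intro Ck_on_minus Ck_on_diff Ck_on_mult S Re_\<alpha>)
  then show ?thesis unfolding Dfun_def[abs_def] by (simp add: mat2)
qed

lemma theta_eq:
  assumes "z \<in> S"
  shows "theta \<alpha> j z = (\<Sum>i\<in>UNIV. \<Sum>k\<in>UNIV. Re (\<alpha> z $ i $ k) * pd j (\<lambda>y. Im (\<alpha> y $ k $ i)) z)"
  using Ck_on_differentiable[OF \<alpha> _ assms, of 1] Ck_on_differentiable[OF \<alpha>_nth _ assms, of 1]
  by (simp add: theta_def mat2 pd_Im pd_nth2)

lemma theta_Ck: "Ck_on n S (theta \<alpha> j)"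
proof -
  have "Ck_on n S (\<lambda>z. \<Sum>i\<in>UNIV. \<Sum>k\<in>UNIV. Re (\<alpha> z $ i $ k) * pd j (\<lambda>y. Im (\<alpha> y $ k $ i)) z)"
    by (intro Ck_on_sum Ck_on_mult S Re_\<alpha> Ck_on_pd Im_\<alpha>)
  then show ?thesis using Ck_on_cong[OF S, of "theta \<alpha> j"] theta_eq by simp
qed

lemma divJ_Ck: "Ck_on n S (divJ w J j)"
  unfolding divJ_def[abs_def] by (intro Ck_on_sum S Ck_on_pd Ck_on_mult w J_nth)

lemma eta_Ck: "Ck_on n S (eta w J \<alpha> j)"
  unfolding eta_def[abs_def]
  by (intro Ck_on_add Ck_on_mult Ck_on_divide Ck_on_const S theta_Ck Dfun_Ck divJ_Ck w w_nz)

lemma ham_nth: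
  assumes "\<And>k. Ck_on n S (\<kappa> k)"
  shows "Ck_on n S (\<lambda>y. ham w \<kappa> y $ i)"
proof -
  have "Ck_on n S (\<lambda>y. inverse (w y) * (if i = 1 then - \<kappa> 2 y else \<kappa> 1 y))"
    using assms by (cases "i = 1") (auto intro!: Ck_on_mult Ck_on_inverse Ck_on_minus S w w_nz)
  moreover have "(\<lambda>y. ham w \<kappa> y $ i) = (\<lambda>y. inverse (w y) * (if i = 1 then - \<kappa> 2 y else \<kappa> 1 y))"
    using exhaust_2[of i] by (auto simp: ham_def)
  ultimately show ?thesis by simp
qed

lemma J_sq: "z \<in> S \<Longrightarrow> J z ** J z = - mat 1"
  and J\<alpha>: "z \<in> S \<Longrightarrow> cmat (transpose (J z)) ** \<alpha> z = mat \<i> ** \<alpha> z"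
  and \<alpha>J: "z \<in> S \<Longrightarrow> \<alpha> z ** cmat (transpose (J z)) = mat (- \<i>) ** \<alpha> z"
  using compat cotan by (auto simp: compatible_def cotangent_def)

lemma tangent_pd:
  assumes z: "z \<in> S"
  shows "tangent_AC (J z) (\<alpha> z) (pd k J z) (pd k \<alpha> z)"
proof -
  have dJ: "J differentiable (at z)" and d\<alpha>: "\<alpha> differentiable (at z)"
    using Ck_on_differentiable[OF J _ z, of 1] Ck_on_differentiable[OF \<alpha> _ z, of 1] by auto
  note dc = differentiable_bounded_linear[OF bounded_linear_cmat_transpose dJ]
  note pc = pd_bounded_linear[OF bounded_linear_cmat_transpose dJ]
  have "pd k (\<lambda>y. J y ** J y) z = pd k (\<lambda>y. - mat 1) z"
    by (rule pd_cong[OF S z]) (rule J_sq)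
  then have 1: "J z ** pd k J z + pd k J z ** J z = 0"
    by (simp add: pd_bounded_bilinear[OF bounded_bilinear_matrix_mult_real] dJ add.commute)
  have "pd k (\<lambda>y. cmat (transpose (J y)) ** \<alpha> y) z = pd k (\<lambda>y. mat \<i> ** \<alpha> y) z"
    by (rule pd_cong[OF S z]) (rule J\<alpha>)
  then have 2: "cmat (transpose (pd k J z)) ** \<alpha> z + cmat (transpose (J z)) ** pd k \<alpha> z = mat \<i> ** pd k \<alpha> z"
    unfolding pd_bounded_bilinear[OF bounded_bilinear_matrix_mult_complex dc d\<alpha>] pc
      pd_bounded_linear[OF bounded_linear_mat_mult d\<alpha>] .
  have "pd k (\<lambda>y. \<alpha> y ** cmat (transpose (J y))) z = pd k (\<lambda>y. mat (- \<i>) ** \<alpha> y) z"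
    by (rule pd_cong[OF S z]) (rule \<alpha>J)
  then have 3: "pd k \<alpha> z ** cmat (transpose (J z)) + \<alpha> z ** cmat (transpose (pd k J z)) = mat (- \<i>) ** pd k \<alpha> z"
    unfolding pd_bounded_bilinear[OF bounded_bilinear_matrix_mult_complex d\<alpha> dc] pc
      pd_bounded_linear[OF bounded_linear_mat_mult d\<alpha>] .
  show ?thesis unfolding tangent_AC_def using 1 2 3 by blast
qed

lemma tangent_lie:
  assumes z: "z \<in> S"
  shows "tangent_AC (J z) (\<alpha> z) (lie_J X J z) (lie_\<alpha> X \<alpha> z)"
proof -
  have "tangent_AC (J z) (\<alpha> z)
      ((X z $ 1 *\<^sub>R pd 1 J z + X z $ 2 *\<^sub>R pd 2 J z) + (J z ** vf_jac X z - vf_jac X z ** J z))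
      ((X z $ 1 *\<^sub>R pd 1 \<alpha> z + X z $ 2 *\<^sub>R pd 2 \<alpha> z) +
        (cmat (transpose (vf_jac X z)) ** \<alpha> z - \<alpha> z ** cmat (transpose (vf_jac X z))))"
    by (intro tangent_AC_add tangent_AC_scaleR tangent_pd tangent_AC_commutator z J_sq J\<alpha> \<alpha>J)
  then show ?thesis by (simp add: lie_J_def lie_\<alpha>_def sum_2 algebra_simps)
qed

text \<open>The first two equations are the real parts of \<open>\<alpha>J\<close> and
  \<open>J\<alpha>\<close>; the third is Cayley-Hamilton for the traceless R.\<close>

lemma R_sq:
  assumes z: "z \<in> S"
  defines "R \<equiv> map_matrix Re (\<alpha> z)" and "N \<equiv> map_matrix Im (\<alpha> z)"
  shows "N = R ** transpose (J z)" "N = - (transpose (J z) ** R)" "R ** R = Dfun \<alpha> z *\<^sub>R mat 1"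
proof -
  show 1: "N = R ** transpose (J z)" and 2: "N = - (transpose (J z) ** R)"
    using J\<alpha>[OF z] \<alpha>J[OF z] by (simp_all add: R_def N_def mat2 complex_eq_iff)
  have "R $ 2 $ 2 = - R $ 1 $ 1"
    using cotan[OF z] unfolding cotangent_iff[OF w_pos[OF z] compat[OF z]] by (simp add: R_def mat2)
  then show "R ** R = Dfun \<alpha> z *\<^sub>R mat 1"
    by (simp add: Dfun_def mat2 R_def[symmetric]) (simp add: R_def mat2 algebra_simps)
qed

text \<open>Cyclicity of the trace turns the commutator terms into tr(C (N R - R N)). By
  \<open>R_sq\<close>, N R = - D K and R N = D K with K the transposed J, so among the derivatives
  of X only tr(J dX) survives.\<close>

lemma trace_lie:
  assumes z: "z \<in> S"
  shows "trace (map_matrix Re (\<alpha> z) ** map_matrix Im (lie_\<alpha> X \<alpha> z)) =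
    (\<Sum>k\<in>UNIV. X z $ k * theta \<alpha> k z) - 2 * Dfun \<alpha> z * trace (J z ** vf_jac X z)"
proof -
  define R N K C where "R = map_matrix Re (\<alpha> z)" and "N = map_matrix Im (\<alpha> z)"
    and "K = transpose (J z)" and "C = transpose (vf_jac X z)"
  have RN: "N = R ** K" "N = - (K ** R)" "R ** R = Dfun \<alpha> z *\<^sub>R mat 1"
    using R_sq[OF z] by (auto simp: R_def N_def K_def)
  have "trace (R ** map_matrix Im (lie_\<alpha> X \<alpha> z)) = (\<Sum>k\<in>UNIV. X z $ k * theta \<alpha> k z) +
      trace (R ** (C ** N - N ** C))"
    by (simp add: lie_\<alpha>_def theta_def R_def C_def N_def mat2 algebra_simps)
  also have "trace (R ** (C ** N - N ** C)) = trace (C ** (N ** R - R ** N))"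
    by (simp add: mat2 algebra_simps)
  also have "N ** R = - (K ** (R ** R))"
    unfolding RN(2) by (simp add: mat2 algebra_simps)
  also have "R ** N = (R ** R) ** K"
    unfolding RN(1) by (simp add: matrix_mul_assoc)
  also have "trace (C ** (- (K ** (R ** R)) - (R ** R) ** K)) = - 2 * Dfun \<alpha> z * trace (J z ** vf_jac X z)"
    unfolding RN(3) by (simp add: C_def K_def mat2 algebra_simps)
  finally show ?thesis by (simp add: R_def)
qed

end

locale patch = prepatch +
  assumes D_less: "\<And>z. z \<in> S \<Longrightarrow> Dfun \<alpha> z < 1"
begin

lemma sfun_Ck: "Ck_on n S (sfun \<alpha>)"
  unfolding sfun_def[abs_def] by (intro Ck_on_sqrt Ck_on_diff Ck_on_const S Dfun_Ck) (simp add: D_less)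

lemma s_pos: "z \<in> S \<Longrightarrow> sfun \<alpha> z > 0"
  by (simp add: sfun_def D_less)

lemma s_sq: "z \<in> S \<Longrightarrow> sfun \<alpha> z * sfun \<alpha> z = 1 - Dfun \<alpha> z"
  using D_less[of z] by (simp add: sfun_def)

lemma kappa_Ck: "Ck_on n S (kappa w J \<alpha> j)"
proof -
  have "2 * (1 + sfun \<alpha> z) \<noteq> 0" if "z \<in> S" for z using s_pos[OF that] by simp
  then show ?thesis
    unfolding kappa_def[abs_def]
    by (intro Ck_on_sum Ck_on_diff Ck_on_add Ck_on_mult Ck_on_divide Ck_on_const S J_nth sfun_Ck Ck_on_pd eta_Ck)
qed

lemma local_identity:
  assumes z: "z \<in> S" and h: "\<And>n. Ck_on n S h"
  shows "dens_dc w \<alpha> h z - h z * divw w (ham w (kappa w J \<alpha>)) z = divw w (flux w J \<alpha> h) z"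
proof -
  define X Y where "X = ham w (\<lambda>k. pd k h)" and "Y = ham w (kappa w J \<alpha>)"
  define s0 where "s0 = sfun \<alpha> z"
  have X: "Ck_on n S (\<lambda>y. X y $ i)" for n i unfolding X_def by (intro ham_nth Ck_on_pd h)
  have Y: "Ck_on n S (\<lambda>y. Y y $ i)" for n i unfolding Y_def by (intro ham_nth kappa_Ck)
  note df = Ck_on_differentiable[OF _ zero_less_one z]
  have d [simp]: "w differentiable (at z)" "h differentiable (at z)" "sfun \<alpha> differentiable (at z)"
    "(\<lambda>y. X y $ i) differentiable (at z)" "(\<lambda>y. Y y $ i) differentiable (at z)"
    "(\<lambda>y. J y $ i $ j) differentiable (at z)" for i j
    using df w h sfun_Ck X Y J_nth by blast+
  have wX: "w y * X y $ 1 = - pd 2 h y" "w y * X y $ 2 = pd 1 h y" if "y \<in> S" for y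
    using w_nz[OF that] by (simp_all add: X_def ham_def)
  have wY: "w y * Y y $ 1 = - kappa w J \<alpha> 2 y" "w y * Y y $ 2 = kappa w J \<alpha> 1 y" if "y \<in> S" for y
    using w_nz[OF that] by (simp_all add: Y_def ham_def)
  have sp: "1 + s0 \<noteq> 0" using s_pos[OF z] by (simp add: s0_def)
  \<comment> \<open>With this, 2 D / (2 (1 + s)) becomes 1 - s, both in front of tr(J dX) in the
    density and in front of the \<open>divJ\<close> term of \<kappa>.\<close>
  have D1s: "Dfun \<alpha> z = (1 - s0) * (1 + s0)" using s_sq[OF z] by (simp add: s0_def algebra_simps)
  have fl: "w y * flux w J \<alpha> h y $ i =
      (sfun \<alpha> y - 1) * (\<Sum>j\<in>UNIV. (w y * J y $ i $ j) * X y $ j) - h y * (w y * Y y $ i)" for y i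
    by (simp add: flux_def X_def[symmetric] Y_def[symmetric] matrix_vector_mult_def sum_2 algebra_simps)
  \<comment> \<open>The product w J stays together so that its derivatives reassemble to
    \<open>divJ\<close>.\<close>
  have pf: "pd i (\<lambda>y. w y * flux w J \<alpha> h y $ i) z =
     pd i (sfun \<alpha>) z * (\<Sum>j\<in>UNIV. (w z * J z $ i $ j) * X z $ j) +
     (s0 - 1) * (\<Sum>j\<in>UNIV. pd i (\<lambda>y. w y * J y $ i $ j) z * X z $ j + (w z * J z $ i $ j) * pd i (\<lambda>y. X y $ j) z)
     - (pd i h z * (w z * Y z $ i) + h z * pd i (\<lambda>y. w y * Y y $ i) z)" for i
  proof -
    have p: "pd i (\<lambda>y. (w y * J y $ i $ j) * X y $ j) z =
       pd i (\<lambda>y. w y * J y $ i $ j) z * X z $ j + (w z * J z $ i $ j) * pd i (\<lambda>y. X y $ j) z" for j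
      by (rule pd_mult) auto
    have q: "pd i (\<lambda>y. \<Sum>j\<in>UNIV. (w y * J y $ i $ j) * X y $ j) z =
       (\<Sum>j\<in>UNIV. pd i (\<lambda>y. w y * J y $ i $ j) z * X z $ j + (w z * J z $ i $ j) * pd i (\<lambda>y. X y $ j) z)"
      unfolding p[symmetric] by (rule pd_sum) auto
    have r: "pd i (\<lambda>y. sfun \<alpha> y - 1) z = pd i (sfun \<alpha>) z"
      by (subst pd_diff) auto
    have "pd i (\<lambda>y. (sfun \<alpha> y - 1) * (\<Sum>j\<in>UNIV. (w y * J y $ i $ j) * X y $ j) - h y * (w y * Y y $ i)) z =
      pd i (\<lambda>y. (sfun \<alpha> y - 1) * (\<Sum>j\<in>UNIV. (w y * J y $ i $ j) * X y $ j)) z - pd i (\<lambda>y. h y * (w y * Y y $ i)) z"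
      by (rule pd_diff) auto
    also have "pd i (\<lambda>y. (sfun \<alpha> y - 1) * (\<Sum>j\<in>UNIV. (w y * J y $ i $ j) * X y $ j)) z =
      pd i (\<lambda>y. sfun \<alpha> y - 1) z * (\<Sum>j\<in>UNIV. (w z * J z $ i $ j) * X z $ j) +
      (s0 - 1) * pd i (\<lambda>y. \<Sum>j\<in>UNIV. (w y * J y $ i $ j) * X y $ j) z"
      unfolding s0_def by (rule pd_mult) auto
    also have "pd i (\<lambda>y. h y * (w y * Y y $ i)) z = pd i h z * (w z * Y z $ i) + h z * pd i (\<lambda>y. w y * Y y $ i) z"
      by (rule pd_mult) auto
    finally show ?thesis unfolding fl q r .
  qed
  have vf: "vf_jac X z $ j $ i = pd i (\<lambda>y. X y $ j) z" for i j
    by (simp add: vf_jac_def)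
  have dc: "dens_dc w \<alpha> h z = (\<Sum>k\<in>UNIV. X z $ k * theta \<alpha> k z) / (2 * (1 + s0)) -
      (1 - s0) * trace (J z ** vf_jac X z)"
    unfolding dens_dc_def X_def[symmetric] trace_lie[OF z] D1s s0_def[symmetric]
    using sp by (simp add: field_simps)
  have kap: "w z * kappa w J \<alpha> m z = w z * theta \<alpha> m z / (2 * (1 + s0)) + (1 - s0) * divJ w J m z
      - w z * (\<Sum>l\<in>UNIV. J z $ l $ m * pd l (sfun \<alpha>) z)" for m
  proof -
    have "2 * ((1 - s0) * (1 + s0)) / u * d / (2 * (1 + s0)) = (1 - s0) / u * d" if "u \<noteq> 0" for u d :: real
      by (subst nonzero_divide_eq_eq) (use that sp in \<open>simp_all add: algebra_simps add_divide_distrib diff_divide_distrib\<close>)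
    note e = this[OF w_nz[OF z]]
    show ?thesis
      unfolding kappa_def eta_def D1s s0_def[symmetric] add_divide_distrib e
      using w_nz[OF z] by (simp add: algebra_simps diff_divide_distrib)
  qed
  have h: "pd 1 h z = w z * X z $ 2" "pd 2 h z = - (w z * X z $ 1)" using wX[OF z] by auto
  have "w z * dens_dc w \<alpha> h z - h z * (\<Sum>i\<in>UNIV. pd i (\<lambda>y. w y * Y y $ i) z)
      = (\<Sum>i\<in>UNIV. pd i (\<lambda>y. w y * flux w J \<alpha> h y $ i) z)"
  proof -
    \<comment> \<open>The duality \<kappa>(X) = - dh(Y), multiplied by w.\<close>
    have k: "pd 1 h z * (w z * Y z $ 1) + pd 2 h z * (w z * Y z $ 2) =
       - (X z $ 1 * (w z * kappa w J \<alpha> 1 z) + X z $ 2 * (w z * kappa w J \<alpha> 2 z))"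
      unfolding wY[OF z] h by (simp add: algebra_simps)
    show ?thesis
      unfolding sum_2[of "\<lambda>i. pd i (\<lambda>y. w y * flux w J \<alpha> h y $ i) z"] pf dc
      using k unfolding kap divJ_def by (simp add: sum_2 mat2 vf algebra_simps add_divide_distrib)
  qed
  then show ?thesis
    using w_nz[OF z] unfolding divw_def Y_def[symmetric] by (simp add: field_simps)
qed

end

section \<open>The Levi-Civita connection in terms of w and J\<close>

lemma christoffel_lowered:
  assumes "det (G z) \<noteq> 0"
  shows "(\<Sum>i\<in>UNIV. G z $ m $ i * christoffel G i j k z) =
    (pd j (\<lambda>y. G y $ k $ m) z + pd k (\<lambda>y. G y $ j $ m) z - pd m (\<lambda>y. G y $ j $ k) z) / 2"
proof -
  define e where "e l = pd j (\<lambda>y. G y $ k $ l) z + pd k (\<lambda>y. G y $ j $ l) z - pd l (\<lambda>y. G y $ j $ k) z" for l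
  \<comment> \<open>Lowering the index cancels the inverse metric in the definition of
    \<open>christoffel\<close>.\<close>
  have "(\<Sum>i\<in>UNIV. G z $ m $ i * christoffel G i j k z) = (1/2) * (\<Sum>l\<in>UNIV. (G z ** matrix_inv (G z)) $ m $ l * e l)"
    by (simp add: christoffel_def e_def[symmetric] sum_2 matrix_matrix_mult_def algebra_simps)
  also have "\<dots> = e m / 2"
    unfolding matrix_inv_mul(2)[OF assms] using exhaust_2[of m] by (auto simp: sum_2 mat_def)
  finally show ?thesis by (simp add: e_def)
qed

lemma pd_of_real: "f differentiable (at z) \<Longrightarrow> pd k (\<lambda>y. complex_of_real (f y)) z = of_real (pd k f z)"
  by (rule pd_bounded_linear[OF bounded_linear_of_real])

text \<open>The endomorphism \<open>B\<close> is symmetric for the metric. Hence the Christoffel symbols enter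
  $g(\nabla_k B\, u, u)$ only through $\Gamma_{12} - \Gamma_{21}$ with the first index lowered, which is a
  curl of the metric.\<close>

lemma nabla_pairing_algebra:
  fixes G B dB \<Gamma> :: "2 \<Rightarrow> 2 \<Rightarrow> complex" and u :: "2 \<Rightarrow> complex"
  assumes sym: "G 1 1 * B 1 2 + G 1 2 * B 2 2 = G 1 2 * B 1 1 + G 2 2 * B 2 1" and G: "G 2 1 = G 1 2"
  defines "p \<equiv> \<lambda>i. \<Sum>j\<in>UNIV. B i j * u j" and "L \<equiv> \<lambda>m l. \<Sum>i\<in>UNIV. G m i * \<Gamma> i l"
  shows "(\<Sum>i\<in>UNIV. \<Sum>j\<in>UNIV. G i j * (\<Sum>m\<in>UNIV. (dB i m + (\<Sum>l\<in>UNIV. \<Gamma> i l * B l m - \<Gamma> l m * B i l)) * u m) * u j)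
    = (\<Sum>i\<in>UNIV. \<Sum>j\<in>UNIV. G i j * (\<Sum>m\<in>UNIV. dB i m * u m) * u j) + (u 1 * p 2 - u 2 * p 1) * (L 1 2 - L 2 1)"
proof -
  define v where "v l = \<Gamma> l 1 * u 1 + \<Gamma> l 2 * u 2" for l
  \<comment> \<open>Expanding both sides leaves a multiple of the asymmetry of the bilinear form G
    B, which vanishes by \<open>sym\<close>.\<close>
  let ?E = "(u 2 * v 1 - u 1 * v 2) * (G 1 2 * B 1 1 + G 2 2 * B 2 1 - (G 1 1 * B 1 2 + G 1 2 * B 2 2))"
  have "(\<Sum>i\<in>UNIV. \<Sum>j\<in>UNIV. G i j * (\<Sum>m\<in>UNIV. (dB i m + (\<Sum>l\<in>UNIV. \<Gamma> i l * B l m - \<Gamma> l m * B i l)) * u m) * u j)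
    = (\<Sum>i\<in>UNIV. \<Sum>j\<in>UNIV. G i j * (\<Sum>m\<in>UNIV. dB i m * u m) * u j) + (u 1 * p 2 - u 2 * p 1) * (L 1 2 - L 2 1) - ?E"
    by (simp add: sum_2 p_def L_def v_def G algebra_simps)
  also have "?E = 0" unfolding sym by simp
  finally show ?thesis by simp
qed

context prepatch
begin

definition "G z = w z *\<^sub>R Om ** J z"
definition "a z = J z $ 1 $ 1"
definition "c z = J z $ 2 $ 1"
text \<open>The fibre coordinate normalised so that \<alpha> is k times the column (c, - (a - i))
  times the row (a - i, c); this keeps the entries of \<alpha> polynomial in a, c and k, hence easy
  to differentiate.\<close>

definition "k z = inverse ((c z)\<^sup>2) *\<^sub>R \<alpha> z $ 1 $ 2"

lemma c_pos: "z \<in> S \<Longrightarrow> c z > 0"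
  and J_entries: "z \<in> S \<Longrightarrow> J z $ 1 $ 1 = a z" "z \<in> S \<Longrightarrow> J z $ 2 $ 1 = c z"
    "z \<in> S \<Longrightarrow> J z $ 2 $ 2 = - a z" "z \<in> S \<Longrightarrow> J z $ 1 $ 2 = - (1 + (a z)\<^sup>2) / c z"
  using compat[of z] compatible_iff[OF w_pos[of z], of "J z"] by (auto simp: a_def c_def)

lemma \<alpha>_entries:
  assumes "z \<in> S"
  shows "\<alpha> z $ 1 $ 1 = (of_real (a z) - \<i>) * of_real (c z) * k z" "\<alpha> z $ 1 $ 2 = of_real (c z) * of_real (c z) * k z"
    "\<alpha> z $ 2 $ 1 = - ((of_real (a z) - \<i>) * (of_real (a z) - \<i>) * k z)"
    "\<alpha> z $ 2 $ 2 = - ((of_real (a z) - \<i>) * of_real (c z) * k z)"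
proof -
  have c: "complex_of_real (c z) \<noteq> 0" using c_pos[OF assms] by simp
  have b: "\<alpha> z $ 1 $ 2 = of_real (c z) * of_real (c z) * k z"
    using c by (simp add: k_def scaleR_conv_of_real power2_eq_square field_simps)
  show "\<alpha> z $ 1 $ 2 = of_real (c z) * of_real (c z) * k z" by (rule b)
  show "\<alpha> z $ 1 $ 1 = (of_real (a z) - \<i>) * of_real (c z) * k z"
    "\<alpha> z $ 2 $ 1 = - ((of_real (a z) - \<i>) * (of_real (a z) - \<i>) * k z)"
    "\<alpha> z $ 2 $ 2 = - ((of_real (a z) - \<i>) * of_real (c z) * k z)"
    using cotan[OF assms] c b unfolding cotangent_iff[OF w_pos[OF assms] compat[OF assms]]
    by (simp_all add: a_def[symmetric] c_def[symmetric] power2_eq_square)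
qed

lemma a_Ck: "Ck_on n S a" and c_Ck: "Ck_on n S c"
  unfolding a_def[abs_def] c_def[abs_def] by (rule J_nth)+

lemma k_Ck: "Ck_on n S k"
  unfolding k_def[abs_def] power2_eq_square
  by (intro Ck_on_scaleR Ck_on_inverse Ck_on_mult S c_Ck \<alpha>_nth) (use c_pos in force)

lemma G_entries:
  assumes "z \<in> S"
  shows "G z $ 1 $ 1 = w z * c z" "G z $ 1 $ 2 = - (w z * a z)" "G z $ 2 $ 1 = - (w z * a z)"
    "G z $ 2 $ 2 = w z * (1 + (a z)\<^sup>2) / c z"
  by (simp_all add: G_def mat2 J_entries[OF assms] algebra_simps add_divide_distrib diff_divide_distrib)

lemma det_G: "z \<in> S \<Longrightarrow> det (G z) = (w z)\<^sup>2"
  unfolding det_2 using c_pos[of z] by (simp add: G_entries power2_eq_square field_simps)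

lemma det_G_nz: "z \<in> S \<Longrightarrow> det (G z) \<noteq> 0"
  using det_G w_nz by simp

lemma sqrt_det_G: "z \<in> S \<Longrightarrow> sqrt (det (G z)) = w z"
  using det_G w_pos[of z] by simp

lemma G_inv:
  assumes "z \<in> S"
  shows "matrix_inv (G z) = inverse (w z) *\<^sub>R vector [vector [(1 + (a z)\<^sup>2) / c z, a z], vector [a z, c z]]"
  unfolding matrix_inv_2[OF det_G_nz[OF assms]] det_G[OF assms] 
  using w_nz[OF assms] by (simp add: vec_eq_iff forall_2 G_entries[OF assms] power2_eq_square field_simps)

lemma G_nth: "Ck_on n S (\<lambda>y. G y $ i $ j)"
proof -
  have "Ck_on n S (\<lambda>y. \<Sum>l\<in>UNIV. (w y * Om $ i $ l) * J y $ l $ j)"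
    by (intro Ck_on_sum Ck_on_mult Ck_on_const S w J_nth)
  then show ?thesis by (simp add: G_def matrix_matrix_mult_def)
qed

lemma hol_vec_entries:
  assumes "z \<in> S"
  shows "hol_vec (J z) $ 1 = (1 - \<i> * of_real (a z)) / 2" "hol_vec (J z) $ 2 = - (\<i> * of_real (c z)) / 2"
  using J_entries[OF assms] by (simp_all add: hol_vec_def axis_def)

lemma g_low: "z \<in> S \<Longrightarrow> g_low (G z) (J z) = of_real (w z * c z / 2)"
  using c_pos[of z]
  by (simp add: g_low_def cbil_def cnjv_def sum_2 G_entries hol_vec_entries complex_eq_iff power2_eq_square field_simps)

lemma g_up: "z \<in> S \<Longrightarrow> g_up (G z) (J z) = of_real (2 / (w z * c z))"
  by (simp add: g_up_def g_low)

lemma comp_bar_\<alpha>: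
  assumes z: "z \<in> S"
  shows "comp_bar (G z) (J z) (transpose (\<alpha> z)) = - 2 * \<i> * of_real (c z) * k z"
proof -
  have "cbil (G z) (transpose (\<alpha> z) *v hol_vec (J z)) (hol_vec (J z)) = - \<i> * of_real (w z * (c z)\<^sup>2) * k z"
    using c_pos[OF z]
    by (simp add: cbil_def matrix_vector_mult_def transpose_def sum_2 \<alpha>_entries[OF z] G_entries[OF z] hol_vec_entries[OF z]
        power2_eq_square complex_eq_iff field_simps)
  then show ?thesis
    using c_pos[OF z] w_pos[OF z] by (simp add: comp_bar_def g_up[OF z] power2_eq_square)
qed

lemma Dfun_eq: "z \<in> S \<Longrightarrow> Dfun \<alpha> z = c z * c z * (Re (k z) * Re (k z) + Im (k z) * Im (k z))"
  by (simp add: Dfun_def mat2 \<alpha>_entries algebra_simps)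

text \<open>The origin of the factor 1/4 in the theorem: the component of \<alpha> is - 2 i c k, and
  D = c^2 |k|^2.\<close>

lemma norm_sq_eq:
  assumes z: "z \<in> S"
  shows "Re (g_up (G z) (J z) * g_low (G z) (J z) * comp_bar (G z) (J z) (transpose (\<alpha> z)) *
    cnj (comp_bar (G z) (J z) (transpose (\<alpha> z)))) = 4 * Dfun \<alpha> z"
  unfolding comp_bar_\<alpha>[OF z] g_up[OF z] g_low[OF z] Dfun_eq[OF z]
  using c_pos[OF z] w_pos[OF z] by (simp add: field_simps)

text \<open>For u = (e - i J e) / 2 the real part of R(u, conj u) is (R(e, e) + R(Je, Je)) / 4,
  while g(u, conj u) = g(e, e) / 2. As e and Je are orthogonal of equal length, the quotient is half
  the trace, which is the normalisation of the scalar curvature.\<close>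

lemma scal_eq:
  assumes z: "z \<in> S"
  shows "Re (g_up (G z) (J z) * cbil R (hol_vec (J z)) (cnjv (hol_vec (J z)))) = trace (matrix_inv (G z) ** R) / 2"
  unfolding g_up[OF z] G_inv[OF z]
  using c_pos[OF z] w_pos[OF z] by (simp add: cbil_def cnjv_def mat2 hol_vec_entries[OF z] power2_eq_square field_simps)

text \<open>G = w Om J permutes the rows of w J up to sign, so a curl of the metric is a divergence
  of w J; the condition J22 = - J11 supplies the remaining sign.\<close>

lemma divJ_G:
  assumes z: "z \<in> S"
  shows "pd 2 (\<lambda>y. G y $ j $ 1) z - pd 1 (\<lambda>y. G y $ j $ 2) z = divJ w J j z"
proof -
  have d [simp]: "(\<lambda>y. w y * J y $ i $ j) differentiable (at z)" for i j
    by (intro Ck_on_differentiable[OF _ zero_less_one z] Ck_on_mult S w J_nth)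
  have e: "pd l (\<lambda>y. w y * J y $ 2 $ 2) z = - pd l (\<lambda>y. w y * J y $ 1 $ 1) z" for l
    unfolding pd_minus[OF d, symmetric] by (rule pd_cong[OF S z]) (simp add: J_entries)
  have G: "(\<lambda>y. G y $ 1 $ j) = (\<lambda>y. w y * J y $ 2 $ j)" "(\<lambda>y. G y $ 2 $ j) = (\<lambda>y. - (w y * J y $ 1 $ j))" for j
    by (auto simp: G_def matrix_matrix_mult_def sum_2 Om_def)
  show ?thesis
    using exhaust_2[of j] by (auto simp: divJ_def sum_2 G pd_minus e)
qed

lemma pd_\<alpha>:
  fixes j :: 2
  assumes z: "z \<in> S"
  defines "A \<equiv> complex_of_real (a z)" and "C \<equiv> complex_of_real (c z)" and "K \<equiv> k z"
    and "A' \<equiv> complex_of_real (pd j a z)" and "C' \<equiv> complex_of_real (pd j c z)" and "K' \<equiv> pd j k z"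
  shows "pd j (\<lambda>y. \<alpha> y $ 1 $ 1) z = A' * C * K + (A - \<i>) * C' * K + (A - \<i>) * C * K'"
    "pd j (\<lambda>y. \<alpha> y $ 1 $ 2) z = 2 * C * C' * K + C * C * K'"
    "pd j (\<lambda>y. \<alpha> y $ 2 $ 1) z = - (2 * (A - \<i>) * A' * K + (A - \<i>) * (A - \<i>) * K')"
    "pd j (\<lambda>y. \<alpha> y $ 2 $ 2) z = - (A' * C * K + (A - \<i>) * C' * K + (A - \<i>) * C * K')"
proof -
  note df = Ck_on_differentiable[OF _ zero_less_one z]
  have dr: "a differentiable (at z)" "c differentiable (at z)" using df a_Ck c_Ck by blast+
  have d [simp]: "(\<lambda>y. complex_of_real (a y)) differentiable (at z)" "(\<lambda>y. complex_of_real (c y)) differentiable (at z)"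
     "k differentiable (at z)" "(\<lambda>y. complex_of_real (a y) - \<i>) differentiable (at z)"
    using df[OF k_Ck] dr by (auto intro!: differentiable_diff differentiable_bounded_linear[OF bounded_linear_of_real])
  have p: "pd j (\<lambda>y. complex_of_real (a y) - \<i>) z = A'" "pd j (\<lambda>y. complex_of_real (c y)) z = C'"
    by (simp_all add: pd_diff pd_of_real dr A'_def C'_def)
  note pds = pd_mult pd_minus p
  have "pd j (\<lambda>y. \<alpha> y $ 1 $ 1) z = pd j (\<lambda>y. (of_real (a y) - \<i>) * of_real (c y) * k y) z"
    by (rule pd_cong[OF S z]) (rule \<alpha>_entries)
  then show 11: "pd j (\<lambda>y. \<alpha> y $ 1 $ 1) z = A' * C * K + (A - \<i>) * C' * K + (A - \<i>) * C * K'"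
    by (simp add: pds) (simp add: A_def C_def K_def K'_def algebra_simps)
  have "pd j (\<lambda>y. \<alpha> y $ 1 $ 2) z = pd j (\<lambda>y. of_real (c y) * of_real (c y) * k y) z"
    by (rule pd_cong[OF S z]) (rule \<alpha>_entries)
  then show "pd j (\<lambda>y. \<alpha> y $ 1 $ 2) z = 2 * C * C' * K + C * C * K'"
    by (simp add: pds) (simp add: A_def C_def K_def K'_def algebra_simps)
  have "pd j (\<lambda>y. \<alpha> y $ 2 $ 1) z = pd j (\<lambda>y. - ((of_real (a y) - \<i>) * (of_real (a y) - \<i>) * k y)) z"
    by (rule pd_cong[OF S z]) (rule \<alpha>_entries)
  then show "pd j (\<lambda>y. \<alpha> y $ 2 $ 1) z = - (2 * (A - \<i>) * A' * K + (A - \<i>) * (A - \<i>) * K')"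
    by (simp add: pds) (simp add: A_def C_def K_def K'_def algebra_simps)
  have "pd j (\<lambda>y. \<alpha> y $ 2 $ 2) z = pd j (\<lambda>y. - \<alpha> y $ 1 $ 1) z"
    by (rule pd_cong[OF S z]) (simp add: \<alpha>_entries)
  also have "\<dots> = - pd j (\<lambda>y. \<alpha> y $ 1 $ 1) z"
    by (intro pd_minus df \<alpha>_nth)
  finally show "pd j (\<lambda>y. \<alpha> y $ 2 $ 2) z = - (A' * C * K + (A - \<i>) * C' * K + (A - \<i>) * C * K')"
    unfolding 11 .
qed

lemma pd_D:
  assumes z: "z \<in> S"
  shows "pd j (Dfun \<alpha>) z = 2 * c z * pd j c z * (Re (k z) * Re (k z) + Im (k z) * Im (k z))
    + 2 * c z * c z * (Re (k z) * Re (pd j k z) + Im (k z) * Im (pd j k z))"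
proof -
  note df = Ck_on_differentiable[OF _ zero_less_one z]
  have d [simp]: "c differentiable (at z)" "k differentiable (at z)" using df c_Ck k_Ck by blast+
  have [simp]: "(\<lambda>y. Re (k y)) differentiable (at z)" "(\<lambda>y. Im (k y)) differentiable (at z)"
    by (auto intro!: differentiable_bounded_linear[OF bounded_linear_Re] differentiable_bounded_linear[OF bounded_linear_Im])
  have "pd j (Dfun \<alpha>) z = pd j (\<lambda>z. c z * c z * (Re (k z) * Re (k z) + Im (k z) * Im (k z))) z"
    by (rule pd_cong[OF S z]) (rule Dfun_eq)
  then show ?thesis by (simp add: pd_mult pd_add pd_Re pd_Im algebra_simps)
qed

text \<open>Up to the factors g^{-1} and 2 i c this is g(nabla_j \<alpha>, conj \<alpha>) = 2 (pd j
  D + i eta_j). Its real part is half the derivative of ||\<alpha>||^2 = 4 D, as for every metric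
  connection; the information about the connection sits in eta.\<close>

lemma nabla_pairing:
  assumes z: "z \<in> S"
  shows "cnj (k z) * cbil (G z) (nabla G (\<lambda>y. transpose (\<alpha> y)) j z *v hol_vec (J z)) (hol_vec (J z)) =
    of_real (w z / 2) * (of_real (eta w J \<alpha> j z) - \<i> * of_real (pd j (Dfun \<alpha>) z))"
proof -
  let ?u = "\<lambda>i. hol_vec (J z) $ i" and ?G = "\<lambda>i j. complex_of_real (G z $ i $ j)"
    and ?B = "\<lambda>i m. \<alpha> z $ m $ i" and ?\<Gamma> = "\<lambda>i l. complex_of_real (christoffel G i j l z)"
    and ?dB = "\<lambda>i m. pd j (\<lambda>y. \<alpha> y $ m $ i) z"
  have c: "complex_of_real (c z) \<noteq> 0" using c_pos[OF z] by simp
  have sym: "?G 1 1 * ?B 1 2 + ?G 1 2 * ?B 2 2 = ?G 1 2 * ?B 1 1 + ?G 2 2 * ?B 2 1"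
    using c by (simp add: G_entries[OF z] \<alpha>_entries[OF z] field_simps power2_eq_square)
  have G21: "?G 2 1 = ?G 1 2" by (simp add: G_entries[OF z])
  have "cbil (G z) (nabla G (\<lambda>y. transpose (\<alpha> y)) j z *v hol_vec (J z)) (hol_vec (J z)) =
     (\<Sum>i\<in>UNIV. \<Sum>l\<in>UNIV. ?G i l * (\<Sum>m\<in>UNIV. (?dB i m + (\<Sum>l\<in>UNIV. ?\<Gamma> i l * ?B l m - ?\<Gamma> l m * ?B i l)) * ?u m) * ?u l)"
    by (simp add: cbil_def nabla_def matrix_vector_mult_def transpose_def)
  also have "\<dots> = (\<Sum>i\<in>UNIV. \<Sum>l\<in>UNIV. ?G i l * (\<Sum>m\<in>UNIV. ?dB i m * ?u m) * ?u l)
     + (?u 1 * (\<Sum>l\<in>UNIV. ?B 2 l * ?u l) - ?u 2 * (\<Sum>l\<in>UNIV. ?B 1 l * ?u l)) *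
       ((\<Sum>i\<in>UNIV. ?G 1 i * ?\<Gamma> i 2) - (\<Sum>i\<in>UNIV. ?G 2 i * ?\<Gamma> i 1))"
    by (rule nabla_pairing_algebra[of ?G ?B, OF sym G21])
  also have "(\<Sum>i\<in>UNIV. ?G 1 i * ?\<Gamma> i 2) - (\<Sum>i\<in>UNIV. ?G 2 i * ?\<Gamma> i 1) =
      of_real ((\<Sum>i\<in>UNIV. G z $ 1 $ i * christoffel G i j 2 z) - (\<Sum>i\<in>UNIV. G z $ 2 $ i * christoffel G i j 1 z))"
    by simp
  also have "\<dots> = of_real (divJ w J j z)"
  proof -
    have "pd j (\<lambda>y. G y $ 2 $ 1) z = pd j (\<lambda>y. G y $ 1 $ 2) z"
      by (rule pd_cong[OF S z]) (simp add: G_entries)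
    then show ?thesis
      unfolding christoffel_lowered[of G, OF det_G_nz[OF z]] divJ_G[OF z, symmetric] by (simp add: field_simps)
  qed
  also have "(?u 1 * (\<Sum>l\<in>UNIV. ?B 2 l * ?u l) - ?u 2 * (\<Sum>l\<in>UNIV. ?B 1 l * ?u l)) = of_real (c z * c z) * k z"
    by (simp add: sum_2 hol_vec_entries[OF z] \<alpha>_entries[OF z] field_simps)
  also have "(\<Sum>i\<in>UNIV. \<Sum>l\<in>UNIV. ?G i l * (\<Sum>m\<in>UNIV. ?dB i m * ?u m) * ?u l) =
     - \<i> * of_real (w z * c z * c z) * pd j k z + k z * of_real (c z * w z) *
       (of_real (c z * pd j a z - a z * pd j c z) - \<i> * of_real (pd j c z))"
    unfolding pd_\<alpha>[OF z] sum_2 hol_vec_entries[OF z] G_entries[OF z]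
    using c by (simp add: field_simps power2_eq_square)
  finally have T: "cbil (G z) (nabla G (\<lambda>y. transpose (\<alpha> y)) j z *v hol_vec (J z)) (hol_vec (J z)) =
     - \<i> * of_real (w z * c z * c z) * pd j k z + k z * of_real (c z * w z) *
       (of_real (c z * pd j a z - a z * pd j c z) - \<i> * of_real (pd j c z))
     + of_real (c z * c z) * k z * of_real (divJ w J j z)" .
  have th: "theta \<alpha> j z = 2 * c z * c z * (Re (k z) * Im (pd j k z) - Im (k z) * Re (pd j k z)) +
     2 * c z * (Re (k z) * Re (k z) + Im (k z) * Im (k z)) * (c z * pd j a z - a z * pd j c z)"
  proof -
    have [simp]: "(\<lambda>y. \<alpha> y $ i $ l) differentiable (at z)" for i l
      by (rule Ck_on_differentiable[OF \<alpha>_nth zero_less_one z])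
    show ?thesis
      unfolding theta_eq[OF z] sum_2 pd_Im[OF \<open>(\<lambda>y. \<alpha> y $ _ $ _) differentiable (at z)\<close>] pd_\<alpha>[OF z] \<alpha>_entries[OF z]
      by (simp add: algebra_simps)
  qed
  show ?thesis
    unfolding T pd_D[OF z] eta_def th Dfun_eq[OF z]
    using w_nz[OF z] by (simp add: complex_eq_iff field_simps)
qed

end

lemma cbil_nabla_vec:
  "cbil G (nabla_vec M B v z *v u) u = (\<Sum>k\<in>UNIV. v $ k * cbil G (nabla M B k z *v u) u)"
proof -
  have "cbil G ((mat p ** X + mat q ** Y) *v u) u = p * cbil G (X *v u) u + q * cbil G (Y *v u) u"
    for p q and X Y :: "complex^2^2"
    by (simp add: cbil_def matrix_vector_mult_def mat2 algebra_simps)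
  then show ?thesis by (simp add: nabla_vec_def sum_2)
qed

section \<open>The field Q, the second-order terms and the scalar curvature in a patch\<close>

context patch
begin

text \<open>The metric quantities are defined for families indexed by charts. Constant families
  specialise them to one patch, with \<open>ch\<close> as a placeholder.\<close>

lemma G_eq_met: "met (\<lambda>_. w) (\<lambda>_. J) ch = G"
  by (rule ext) (simp add: met_def form_mat_def G_def)

text \<open>Invariantly, Q is half the sum of grad D and the field dual to eta: the symmetric matrix
  with entries (1 + a^2)/c, a, c is w times the inverse metric.\<close>

lemma Q_field_eq:
  fixes ch :: "'m chart"
  assumes z: "z \<in> S"
  defines "Q \<equiv> Q_field (\<lambda>_. w) (\<lambda>_. J) (\<lambda>_. \<alpha>) ch z"
  shows "w z * Q $ 1 = ((1 + (a z)\<^sup>2) / c z * pd 1 (Dfun \<alpha>) z + a z * pd 2 (Dfun \<alpha>) z - eta w J \<alpha> 2 z) / 2"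
    "w z * Q $ 2 = (a z * pd 1 (Dfun \<alpha>) z + c z * pd 2 (Dfun \<alpha>) z + eta w J \<alpha> 1 z) / 2"
proof -
  let ?u = "hol_vec (J z)" and ?B = "\<lambda>y. transpose (\<alpha> y)"
  define e1 e2 d1 d2 where "e1 = eta w J \<alpha> 1 z" and "e2 = eta w J \<alpha> 2 z"
    and "d1 = pd 1 (Dfun \<alpha>) z" and "d2 = pd 2 (Dfun \<alpha>) z"
  have cw: "complex_of_real (c z) \<noteq> 0" "complex_of_real (w z) \<noteq> 0" using c_pos[OF z] w_nz[OF z] by auto
  have "cnj (k z) * cbil (G z) (nabla_vec G ?B (cnjv ?u) z *v ?u) ?u =
     (\<Sum>j\<in>UNIV. cnjv ?u $ j * (cnj (k z) * cbil (G z) (nabla G ?B j z *v ?u) ?u))"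
    unfolding cbil_nabla_vec by (simp add: sum_2 algebra_simps)
  also have "\<dots> = of_real (w z / 4) * ((1 + \<i> * of_real (a z)) * (of_real e1 - \<i> * of_real d1)
      + \<i> * of_real (c z) * (of_real e2 - \<i> * of_real d2))"
    unfolding nabla_pairing[OF z] by (simp add: sum_2 cnjv_def hol_vec_entries[OF z] e1_def e2_def d1_def d2_def field_simps)
  finally have kT: "cnj (k z) * cbil (G z) (nabla_vec G ?B (cnjv ?u) z *v ?u) ?u = \<dots>" .
  have "grad_pairing (\<lambda>_. w) (\<lambda>_. J) (\<lambda>_. \<alpha>) ch z =
    (g_up (G z) (J z) * g_low (G z) (J z)) * g_up (G z) (J z) * g_up (G z) (J z) * (2 * \<i> * of_real (c z)) *
      (cnj (k z) * cbil (G z) (nabla_vec G ?B (cnjv ?u) z *v ?u) ?u)"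
    unfolding grad_pairing_def G_eq_met Let_def comp_bar_\<alpha>[OF z] by (simp add: comp_bar_def mult_ac)
  also have "\<dots> = 2 * \<i> / of_real (w z * c z) * ((1 + \<i> * of_real (a z)) * (of_real e1 - \<i> * of_real d1)
      + \<i> * of_real (c z) * (of_real e2 - \<i> * of_real d2))"
    unfolding kT g_up[OF z] g_low[OF z] using cw by (simp add: field_simps)
  finally have gp: "grad_pairing (\<lambda>_. w) (\<lambda>_. J) (\<lambda>_. \<alpha>) ch z = \<dots>" .
  have "w z * Q $ 1 = Re (\<i> * (1 - \<i> * of_real (a z)) * ((1 + \<i> * of_real (a z)) * (of_real e1 - \<i> * of_real d1)
      + \<i> * of_real (c z) * (of_real e2 - \<i> * of_real d2))) / (2 * c z)"
    unfolding Q_def Q_field_def vec_lambda_beta gp hol_vec_entries[OF z] 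
    using c_pos[OF z] w_nz[OF z] by (simp add: Re_divide_of_real field_simps flip: of_real_mult)
  also have "\<dots> = ((1 + (a z)\<^sup>2) / c z * d1 + a z * d2 - e2) / 2"
    using c_pos[OF z] by (simp add: field_simps power2_eq_square)
  finally show "w z * Q $ 1 = ((1 + (a z)\<^sup>2) / c z * pd 1 (Dfun \<alpha>) z + a z * pd 2 (Dfun \<alpha>) z - eta w J \<alpha> 2 z) / 2"
    by (simp add: d1_def d2_def e2_def)
  have "w z * Q $ 2 = Re ((1 + \<i> * of_real (a z)) * (of_real e1 - \<i> * of_real d1)
      + \<i> * of_real (c z) * (of_real e2 - \<i> * of_real d2)) / 2"
    unfolding Q_def Q_field_def vec_lambda_beta gp hol_vec_entries[OF z] 
    using c_pos[OF z] w_nz[OF z] by (simp add: Re_divide_of_real field_simps flip: of_real_mult)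
  also have "\<dots> = (a z * d1 + c z * d2 + e1) / 2"
    by (simp add: field_simps)
  finally show "w z * Q $ 2 = (a z * pd 1 (Dfun \<alpha>) z + c z * pd 2 (Dfun \<alpha>) z + eta w J \<alpha> 1 z) / 2"
    by (simp add: d1_def d2_def e1_def)
qed

lemma Q_field_Ck: "Ck_on n S (\<lambda>y. Q_field (\<lambda>_. w) (\<lambda>_. J) (\<lambda>_. \<alpha>) ch y $ i)"
proof -
  let ?Q = "Q_field (\<lambda>_. w) (\<lambda>_. J) (\<lambda>_. \<alpha>) ch"
  have c_nz: "c z \<noteq> 0" if "z \<in> S" for z using c_pos[OF that] by simp
  have D': "Ck_on n S (pd j (Dfun \<alpha>))" for j by (intro Ck_on_pd Dfun_Ck)
  have "Ck_on n S (\<lambda>z. ((1 + (a z)\<^sup>2) / c z * pd 1 (Dfun \<alpha>) z + a z * pd 2 (Dfun \<alpha>) z - eta w J \<alpha> 2 z) / 2 / w z)"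
    unfolding power2_eq_square
    by (intro Ck_on_divide Ck_on_diff Ck_on_add Ck_on_mult Ck_on_const S a_Ck c_Ck D' eta_Ck w w_nz c_nz) simp_all
  moreover have "?Q z $ 1 = ((1 + (a z)\<^sup>2) / c z * pd 1 (Dfun \<alpha>) z + a z * pd 2 (Dfun \<alpha>) z - eta w J \<alpha> 2 z) / 2 / w z"
    if "z \<in> S" for z
    unfolding Q_field_eq(1)[OF that, where ch = ch, symmetric] using w_nz[OF that] by simp
  ultimately have 1: "Ck_on n S (\<lambda>y. ?Q y $ 1)" using Ck_on_cong[OF S] by (metis (no_types, lifting))
  have "Ck_on n S (\<lambda>z. (a z * pd 1 (Dfun \<alpha>) z + c z * pd 2 (Dfun \<alpha>) z + eta w J \<alpha> 1 z) / 2 / w z)"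
    by (intro Ck_on_divide Ck_on_diff Ck_on_add Ck_on_mult Ck_on_const S a_Ck c_Ck D' eta_Ck w w_nz c_nz) simp_all
  moreover have "?Q z $ 2 = (a z * pd 1 (Dfun \<alpha>) z + c z * pd 2 (Dfun \<alpha>) z + eta w J \<alpha> 1 z) / 2 / w z"
    if "z \<in> S" for z
    unfolding Q_field_eq(2)[OF that, where ch = ch, symmetric] using w_nz[OF that] by simp
  ultimately have 2: "Ck_on n S (\<lambda>y. ?Q y $ 2)" using Ck_on_cong[OF S] by (metis (no_types, lifting))
  show ?thesis using 1 2 exhaust_2[of i] by auto
qed

lemma div_loc_eq:
  assumes z: "z \<in> S" and "\<And>y. y \<in> S \<Longrightarrow> V y = V' y"
  shows "div_loc G V z = divw w V' z"
proof -
  have "pd i (\<lambda>y. sqrt (det (G y)) * V y $ i) z = pd i (\<lambda>y. w y * V' y $ i) z" for i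
    by (rule pd_cong[OF S z]) (simp add: sqrt_det_G assms(2))
  then show ?thesis by (simp add: div_loc_def divw_def sqrt_det_G[OF z])
qed

text \<open>The two second-order terms of the moment map combine because
  $d \log(1 + s) + \frac{s}{1 + s}\, ds = ds$, where $s = \sqrt{1 - \frac14 \|\alpha\|^2}$.\<close>

lemma laplacian_plus_divergence:
  assumes z: "z \<in> S" and f: "\<And>y. y \<in> S \<Longrightarrow> f y = ln (1 + sfun \<alpha> y)"
    and p: "\<And>y. y \<in> S \<Longrightarrow> p y = 1 / (1 + sfun \<alpha> y)"
  shows "- div_loc G (grad_loc G f) z + div_loc G (\<lambda>y. p y *\<^sub>R Q_field (\<lambda>_. w) (\<lambda>_. J) (\<lambda>_. \<alpha>) ch y) z
    = divw w (ham w (kappa w J \<alpha>)) z"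
proof -
  let ?Q = "Q_field (\<lambda>_. w) (\<lambda>_. J) (\<lambda>_. \<alpha>) ch"
  \<comment> \<open>grad log(1 + s) with the inverse metric written out, so that differentiability
    can be read off; \<open>grad_loc G f\<close> agrees with it on \<open>S\<close>.\<close>
  define V where "V y = inverse (w y) *\<^sub>R (vector
     [(1 + (a y)\<^sup>2) / c y * pd 1 (\<lambda>y. ln (1 + sfun \<alpha> y)) y + a y * pd 2 (\<lambda>y. ln (1 + sfun \<alpha> y)) y,
      a y * pd 1 (\<lambda>y. ln (1 + sfun \<alpha> y)) y + c y * pd 2 (\<lambda>y. ln (1 + sfun \<alpha> y)) y] :: real^2)" for y
  have sp: "1 + sfun \<alpha> y > 0" if "y \<in> S" for y using s_pos[OF that] by simp
  then have sn: "1 + sfun \<alpha> y \<noteq> 0" if "y \<in> S" for y using that by force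
  have c_nz: "c z \<noteq> 0" if "z \<in> S" for z using c_pos[OF that] by simp
  have L: "Ck_on n S (\<lambda>y. ln (1 + sfun \<alpha> y))" for n
    by (intro Ck_on_ln Ck_on_add Ck_on_const S sfun_Ck sp)
  have L': "Ck_on n S (pd j (\<lambda>y. ln (1 + sfun \<alpha> y)))" for n j
    by (intro Ck_on_pd L)
  have pdL: "pd j (\<lambda>y. ln (1 + sfun \<alpha> y)) y = pd j (sfun \<alpha>) y / (1 + sfun \<alpha> y)" if "y \<in> S" for j y
  proof -
    have ds: "sfun \<alpha> differentiable (at y)" by (rule Ck_on_differentiable[OF sfun_Ck zero_less_one that])
    have "pd j (\<lambda>y. ln (1 + sfun \<alpha> y)) y = inverse (1 + sfun \<alpha> y) * pd j (\<lambda>y. 1 + sfun \<alpha> y) y"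
      using pd_real_comp[of "\<lambda>y. 1 + sfun \<alpha> y" y ln, OF _ DERIV_ln[OF sp[OF that]]] ds by simp
    also have "pd j (\<lambda>y. 1 + sfun \<alpha> y) y = pd j (sfun \<alpha>) y"
      by (subst pd_add) (use ds in auto)
    finally show ?thesis by (simp add: field_simps)
  qed
  have pdD: "pd j (Dfun \<alpha>) y = - 2 * sfun \<alpha> y * pd j (sfun \<alpha>) y" if "y \<in> S" for j y
  proof -
    have ds: "sfun \<alpha> differentiable (at y)" by (rule Ck_on_differentiable[OF sfun_Ck zero_less_one that])
    have "pd j (Dfun \<alpha>) y = pd j (\<lambda>y. 1 - sfun \<alpha> y * sfun \<alpha> y) y"
      by (rule pd_cong[OF S that]) (simp add: s_sq)
    then show ?thesis using ds by (simp add: pd_diff pd_mult)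
  qed
  have grad: "grad_loc G f y = V y" if "y \<in> S" for y
  proof -
    have "pd j f y = pd j (\<lambda>y. ln (1 + sfun \<alpha> y)) y" for j
      by (rule pd_cong[OF S that f])
    then show ?thesis
      unfolding grad_loc_def G_inv[OF that] V_def
      by (simp add: vec_eq_iff forall_2 matrix_vector_mult_def sum_2 algebra_simps)
  qed
  have 1: "div_loc G (grad_loc G f) z = divw w V z"
    by (rule div_loc_eq[OF z grad])
  have 2: "div_loc G (\<lambda>y. p y *\<^sub>R ?Q y) z = divw w (\<lambda>y. (1 / (1 + sfun \<alpha> y)) *\<^sub>R ?Q y) z"
    by (rule div_loc_eq[OF z]) (simp add: p)
  have dV: "(\<lambda>y. w y * V y $ i) differentiable (at z)" for i
  proof (rule Ck_on_differentiable[OF _ zero_less_one z])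
    have "Ck_on 1 S (\<lambda>y. w y * (inverse (w y) * (if i = 1 then (1 + (a y)\<^sup>2) / c y * pd 1 (\<lambda>y. ln (1 + sfun \<alpha> y)) y + a y * pd 2 (\<lambda>y. ln (1 + sfun \<alpha> y)) y
       else a y * pd 1 (\<lambda>y. ln (1 + sfun \<alpha> y)) y + c y * pd 2 (\<lambda>y. ln (1 + sfun \<alpha> y)) y)))"
      unfolding power2_eq_square
      by (cases "i = 1"; simp only: if_True if_False refl; 
          intro Ck_on_divide Ck_on_inverse Ck_on_add Ck_on_mult Ck_on_const S a_Ck c_Ck L' w w_nz c_nz; assumption)
    moreover have "(\<lambda>y. w y * V y $ i) = (\<lambda>y. w y * (inverse (w y) * (if i = 1 then (1 + (a y)\<^sup>2) / c y * pd 1 (\<lambda>y. ln (1 + sfun \<alpha> y)) y + a y * pd 2 (\<lambda>y. ln (1 + sfun \<alpha> y)) y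
       else a y * pd 1 (\<lambda>y. ln (1 + sfun \<alpha> y)) y + c y * pd 2 (\<lambda>y. ln (1 + sfun \<alpha> y)) y)))"
      using exhaust_2[of i] by (auto simp: V_def)
    ultimately show "Ck_on 1 S (\<lambda>y. w y * V y $ i)" by simp
  qed
  have dQ: "(\<lambda>y. w y * ((1 / (1 + sfun \<alpha> y)) *\<^sub>R ?Q y) $ i) differentiable (at z)" for i
  proof (rule Ck_on_differentiable[OF _ zero_less_one z])
    have "Ck_on 1 S (\<lambda>y. w y * ((1 / (1 + sfun \<alpha> y)) * ?Q y $ i))"
      by (intro Ck_on_divide Ck_on_add Ck_on_mult Ck_on_const S w Q_field_Ck sfun_Ck sn)
    then show "Ck_on 1 S (\<lambda>y. w y * ((1 / (1 + sfun \<alpha> y)) *\<^sub>R ?Q y) $ i)" by simp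
  qed
  have e: "w y * ham w (kappa w J \<alpha>) y $ i = w y * ((1 / (1 + sfun \<alpha> y)) *\<^sub>R ?Q y) $ i - w y * V y $ i"
    if y: "y \<in> S" for y i
  proof -
    have q: "w y * ((1 / (1 + sfun \<alpha> y)) *\<^sub>R ?Q y) $ i = (w y * ?Q y $ i) / (1 + sfun \<alpha> y)" by simp
    have r: "u * (- 2 * t * d / 2) / (1 + t) - u * (d / (1 + t)) = - (u * d)" if "1 + t \<noteq> 0" for t u d :: real
    proof -
      have "u * (- 2 * t * d / 2) / (1 + t) - u * (d / (1 + t)) = (u * (- 2 * t * d / 2) - u * d) / (1 + t)"
        by (simp add: diff_divide_distrib)
      also have "\<dots> = (- (u * d) * (1 + t)) / (1 + t)" by (simp add: algebra_simps)
      also have "\<dots> = - (u * d)" using that by simp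
      finally show ?thesis .
    qed
    have wi: "w y * (inverse (w y) * x) = x" for x using w_nz[OF y] by simp
    show ?thesis
      using exhaust_2[of i]
    proof
      assume i: "i = 1"
      have "w y * ham w (kappa w J \<alpha>) y $ 1 = - kappa w J \<alpha> 2 y" using w_nz[OF y] by (simp add: ham_def)
      also have "\<dots> = - eta w J \<alpha> 2 y / (2 * (1 + sfun \<alpha> y)) - (1 + (a y)\<^sup>2) / c y * pd 1 (sfun \<alpha>) y - a y * pd 2 (sfun \<alpha>) y"
        by (simp add: kappa_def sum_2 J_entries[OF y] add_divide_distrib diff_divide_distrib algebra_simps)
      also have "\<dots> = ((1 + (a y)\<^sup>2) / c y * (- 2 * sfun \<alpha> y * pd 1 (sfun \<alpha>) y / 2) / (1 + sfun \<alpha> y) - (1 + (a y)\<^sup>2) / c y * (pd 1 (sfun \<alpha>) y / (1 + sfun \<alpha> y)))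
         + (a y * (- 2 * sfun \<alpha> y * pd 2 (sfun \<alpha>) y / 2) / (1 + sfun \<alpha> y) - a y * (pd 2 (sfun \<alpha>) y / (1 + sfun \<alpha> y))) 
         - eta w J \<alpha> 2 y / (2 * (1 + sfun \<alpha> y))"
        unfolding r[OF sn[OF y]] by simp
      also have "\<dots> = (w y * ?Q y $ 1) / (1 + sfun \<alpha> y) - w y * V y $ 1"
        unfolding Q_field_eq[OF y] pdD[OF y] V_def pdL[OF y]
        by (simp add: wi add_divide_distrib diff_divide_distrib)
      finally show ?thesis unfolding i q[unfolded i] .
    next
      assume i: "i = 2"
      have "w y * ham w (kappa w J \<alpha>) y $ 2 = kappa w J \<alpha> 1 y" using w_nz[OF y] by (simp add: ham_def)
      also have "\<dots> = eta w J \<alpha> 1 y / (2 * (1 + sfun \<alpha> y)) - a y * pd 1 (sfun \<alpha>) y - c y * pd 2 (sfun \<alpha>) y"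
        by (simp add: kappa_def sum_2 J_entries[OF y])
      also have "\<dots> = (a y * (- 2 * sfun \<alpha> y * pd 1 (sfun \<alpha>) y / 2) / (1 + sfun \<alpha> y) - a y * (pd 1 (sfun \<alpha>) y / (1 + sfun \<alpha> y)))
         + (c y * (- 2 * sfun \<alpha> y * pd 2 (sfun \<alpha>) y / 2) / (1 + sfun \<alpha> y) - c y * (pd 2 (sfun \<alpha>) y / (1 + sfun \<alpha> y))) 
         + eta w J \<alpha> 1 y / (2 * (1 + sfun \<alpha> y))"
        unfolding r[OF sn[OF y]] by simp
      also have "\<dots> = (w y * ?Q y $ 2) / (1 + sfun \<alpha> y) - w y * V y $ 2"
        unfolding Q_field_eq[OF y] pdD[OF y] V_def pdL[OF y]
        by (simp add: wi add_divide_distrib diff_divide_distrib)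
      finally show ?thesis unfolding i q[unfolded i] .
    qed
  qed
  have "pd i (\<lambda>y. w y * ham w (kappa w J \<alpha>) y $ i) z =
     pd i (\<lambda>y. w y * ((1 / (1 + sfun \<alpha> y)) *\<^sub>R ?Q y) $ i) z - pd i (\<lambda>y. w y * V y $ i) z" for i
    unfolding pd_diff[OF dQ dV, symmetric] by (rule pd_cong[OF S z e])
  then show ?thesis
    unfolding 1 2 by (simp add: divw_def sum_2 add_divide_distrib diff_divide_distrib)
qed

lemma scal_local:
  "z \<in> S \<Longrightarrow> scal (\<lambda>_. w) (\<lambda>_. J) ch z = trace (matrix_inv (G z) ** ricci G z) / 2"
  unfolding scal_def G_eq_met by (rule scal_eq)

lemma G_inv_nth: "Ck_on n S (\<lambda>y. matrix_inv (G y) $ i $ j)"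
proof -
  define I where "I y = (vector [vector [(1 + a y * a y) / c y, a y], vector [a y, c y]] :: real^2^2)" for y
  have c_nz: "c z \<noteq> 0" if "z \<in> S" for z using c_pos[OF that] by simp
  have "Ck_on n S (\<lambda>y. I y $ i $ j)"
    using exhaust_2[of i] exhaust_2[of j]
    by (auto simp: I_def intro!: Ck_on_divide Ck_on_add Ck_on_mult Ck_on_const S a_Ck c_Ck c_nz)
  then have "Ck_on n S (\<lambda>y. inverse (w y) * I y $ i $ j)"
    by (intro Ck_on_mult Ck_on_inverse S w w_nz)
  then show ?thesis
    using Ck_on_cong[OF S, of "\<lambda>y. matrix_inv (G y) $ i $ j" "\<lambda>y. inverse (w y) * I y $ i $ j"]
    by (simp add: G_inv I_def power2_eq_square)
qed

lemma christoffel_Ck: "Ck_on n S (christoffel G i j l)"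
proof -
  have "Ck_on n S (pd i (\<lambda>y. G y $ j $ l))" for i j l by (intro Ck_on_pd G_nth)
  then show ?thesis
    unfolding christoffel_def[abs_def]
    by (intro Ck_on_mult Ck_on_const Ck_on_sum Ck_on_add Ck_on_diff S G_inv_nth)
qed

text \<open>Continuity together with compactness of the curve later makes the curvature term
  integrable, so that the integral can be split.\<close>

lemma scal_continuous: "continuous_on S (scal (\<lambda>_. w) (\<lambda>_. J) ch)"
proof -
  have 1: "Ck_on 0 S (pd i (christoffel G j l m))" for i j l m by (intro Ck_on_pd christoffel_Ck)
  have "Ck_on 0 S (\<lambda>z. ricci G z $ i $ j)" for i j
    unfolding ricci_def vec_lambda_beta
    by (intro Ck_on_mult Ck_on_sum Ck_on_add Ck_on_diff S christoffel_Ck 1)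
  then have "Ck_on 0 S (\<lambda>z. trace (matrix_inv (G z) ** ricci G z) / 2)"
    unfolding trace_def matrix_matrix_mult_def vec_lambda_beta
    by (intro Ck_on_divide Ck_on_const Ck_on_mult Ck_on_sum S G_inv_nth) auto
  then have "continuous_on S (\<lambda>z. trace (matrix_inv (G z) ** ricci G z) / 2)" by simp
  then show ?thesis by (simp add: scal_local cong: continuous_on_cong)
qed

end

section \<open>Darboux coordinates\<close>

text \<open>The x-derivative is Leibniz' rule, the y-derivative the fundamental theorem of calculus,
  and continuity of the latter makes the two partial derivatives a total one. The hypotheses include
  the edge Im = yl because the integral starts there.\<close>

lemma has_derivative_integral_Im:
  fixes d d1 d2 :: "complex \<Rightarrow> real"
  assumes d: "\<And>\<zeta>. Re \<zeta> \<in> {xl<..<xu} \<Longrightarrow> Im \<zeta> \<in> {yl..yu} \<Longrightarrow>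
      (d has_derivative (\<lambda>v. Re v *\<^sub>R d1 \<zeta> + Im v *\<^sub>R d2 \<zeta>)) (at \<zeta>)"
    and d1: "continuous_on {\<zeta>. Re \<zeta> \<in> {xl<..<xu} \<and> Im \<zeta> \<in> {yl..yu}} d1"
    and \<zeta>: "Re \<zeta> \<in> {xl<..<xu}" "Im \<zeta> \<in> {yl<..<yu}"
  shows "((\<lambda>\<zeta>. integral {yl..Im \<zeta>} (\<lambda>t. d (Complex (Re \<zeta>) t))) has_derivative
     (\<lambda>v. Re v *\<^sub>R integral {yl..Im \<zeta>} (\<lambda>t. d1 (Complex (Re \<zeta>) t)) + Im v *\<^sub>R d \<zeta>)) (at \<zeta>)"
proof -
  let ?R = "{\<zeta>. Re \<zeta> \<in> {xl<..<xu} \<and> Im \<zeta> \<in> {yl..yu}}"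
  let ?X = "{xl<..<xu}" and ?Y = "{yl<..<yu}"
  define f where "f x y = integral {yl..y} (\<lambda>t. d (Complex x t))" for x y
  have dc: "continuous_on ?R d"
    using d has_derivative_continuous by (intro continuous_at_imp_continuous_on) blast
  have C: "continuous_on A (\<lambda>p. Complex (fst p) (snd p))" for A
    unfolding Complex_eq by (intro continuous_intros)
  have C': "continuous_on A (\<lambda>t. Complex x t)" for A x
    unfolding Complex_eq by (intro continuous_intros)
  have dx: "((\<lambda>x. d (Complex x t)) has_real_derivative d1 (Complex x t)) (at x within ?X)"
    if "x \<in> ?X" "t \<in> {yl..yu}" for x t
  proof -
    have "((\<lambda>x. Complex x t) has_derivative (\<lambda>v. of_real v)) (at x within ?X)"
      unfolding Complex_eq by (auto intro!: derivative_eq_intros)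
    from has_derivative_compose[OF this d[of "Complex x t"]] that show ?thesis
      by (simp add: has_field_derivative_def mult.commute[of _ "d1 _"])
  qed
  have "((\<lambda>x. integral (cbox yl (Im \<zeta>)) (\<lambda>t. d (Complex x t))) has_field_derivative
      integral (cbox yl (Im \<zeta>)) (\<lambda>t. d1 (Complex (Re \<zeta>) t))) (at (Re \<zeta>) within ?X)"
  proof (rule leibniz_rule_field_derivative)
    show "(\<lambda>t. d (Complex x t)) integrable_on cbox yl (Im \<zeta>)" if "x \<in> ?X" for x
      using that \<zeta> by (intro integrable_continuous continuous_on_compose2[OF dc C']) auto
    show "continuous_on (?X \<times> cbox yl (Im \<zeta>)) (\<lambda>(x, t). d1 (Complex x t))"
      unfolding split_beta using \<zeta> by (intro continuous_on_compose2[OF d1 C]) auto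
  qed (use \<zeta> dx in auto)
  then have fx: "((\<lambda>x. f x (Im \<zeta>)) has_derivative (\<lambda>v. v * integral {yl..Im \<zeta>} (\<lambda>t. d1 (Complex (Re \<zeta>) t))))
      (at (Re \<zeta>) within ?X)"
    by (simp add: f_def has_field_derivative_def mult.commute[of _ "integral _ _"])
  have fy: "(f x has_derivative blinfun_apply (blinfun_mult_left (d (Complex x y)))) (at y within ?Y)"
    if "x \<in> ?X" "y \<in> ?Y" for x y
  proof -
    have "continuous_on {yl..yu} (\<lambda>t. d (Complex x t))"
      using that by (intro continuous_on_compose2[OF dc C']) auto
    from integral_has_real_derivative[OF this, of y] that
    have "((\<lambda>y. integral {yl..y} (\<lambda>t. d (Complex x t))) has_real_derivative d (Complex x y)) (at y within ?Y)"
      by (auto intro: DERIV_subset)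
    then show ?thesis by (simp add: f_def[abs_def] has_field_derivative_def mult_commute_abs)
  qed
  have "((\<lambda>(x, y). f x y) has_derivative
     (\<lambda>(tx, ty). tx * integral {yl..Im \<zeta>} (\<lambda>t. d1 (Complex (Re \<zeta>) t)) + blinfun_apply (blinfun_mult_left (d (Complex (Re \<zeta>) (Im \<zeta>)))) ty))
     (at (Re \<zeta>, Im \<zeta>) within ?X \<times> ?Y)"
  proof (rule has_derivative_partialsI[OF fx fy])
    have "continuous_on (?X \<times> ?Y) (\<lambda>p. blinfun_mult_left (d (Complex (fst p) (snd p))))"
      by (intro bounded_linear.continuous_on[OF bounded_linear_blinfun_mult_left] continuous_on_compose2[OF dc C]) auto
    then show "continuous (at (Re \<zeta>, Im \<zeta>) within ?X \<times> ?Y) (\<lambda>(x, y). blinfun_mult_left (d (Complex x y)))"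
      using \<zeta> by (simp add: continuous_on_eq_continuous_within split_beta')
  qed (use \<zeta> in auto)
  moreover have "at (Re \<zeta>, Im \<zeta>) within ?X \<times> ?Y = at (Re \<zeta>, Im \<zeta>)"
    using \<zeta> by (intro at_within_open open_Times) auto
  ultimately have 1: "((\<lambda>(x, y). f x y) has_derivative
     (\<lambda>(tx, ty). tx * integral {yl..Im \<zeta>} (\<lambda>t. d1 (Complex (Re \<zeta>) t)) + ty * d \<zeta>)) (at (Re \<zeta>, Im \<zeta>))"
    by simp
  have 2: "((\<lambda>\<zeta>. (Re \<zeta>, Im \<zeta>)) has_derivative (\<lambda>v. (Re v, Im v))) (at \<zeta>)"
    by (auto intro!: derivative_eq_intros)
  from has_derivative_compose[OF 2 1] show ?thesis by (simp add: f_def)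
qed

lemma jac_entries:
  assumes "(F has_derivative (\<lambda>v. Re v *\<^sub>R F1 + Im v *\<^sub>R F2)) (at z)"
  shows "jac F z $ 1 $ 1 = Re F1" "jac F z $ 2 $ 1 = Im F1" "jac F z $ 1 $ 2 = Re F2" "jac F z $ 2 $ 2 = Im F2"
  using pd_eqI[OF assms] by (simp_all add: jac_nth)

text \<open>The coordinates are $x$ and $\int w\, dy$.\<close>

lemma darboux_exists:
  assumes S: "open S" and z: "z \<in> S" and w: "Cinf_on S w" and pos: "\<And>y. y \<in> S \<Longrightarrow> w y > 0"
  shows "\<exists>F. darboux_coord w z F"
proof -
  obtain D where D0: "\<And>z. z \<in> S \<Longrightarrow> D 0 0 z = w z"
    and D: "\<And>i j z. z \<in> S \<Longrightarrow> (D i j has_derivative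
        (\<lambda>v. Re v *\<^sub>R D (Suc i) j z + Im v *\<^sub>R D i (Suc j) z)) (at z)"
    using w unfolding Cinf_on_def by metis
  obtain e where e: "e > 0" "ball z e \<subseteq> S" using S z openE by blast
  \<comment> \<open>A quarter of the radius: a point of the box is at most r + r < e away from
    z.\<close>
  define r where "r = e / 4"
  define xl xu yl yu where "xl = Re z - r" and "xu = Re z + r" and "yl = Im z - r" and "yu = Im z + r"
  have r: "r > 0" using e by (simp add: r_def)
  have box: "\<zeta> \<in> S" if "Re \<zeta> \<in> {xl<..<xu}" "Im \<zeta> \<in> {yl..yu}" for \<zeta>
  proof -
    have "cmod (\<zeta> - z) \<le> \<bar>Re (\<zeta> - z)\<bar> + \<bar>Im (\<zeta> - z)\<bar>" by (rule cmod_le)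
    also have "\<dots> \<le> r + r" using that by (intro add_mono) (auto simp: xl_def xu_def yl_def yu_def)
    also have "\<dots> < e" using e by (simp add: r_def)
    finally show ?thesis using e(2) by (auto simp: dist_norm norm_minus_commute)
  qed
  define T where "T = {\<zeta>. Re \<zeta> \<in> {xl<..<xu} \<and> Im \<zeta> \<in> {yl<..<yu}}"
  have T: "open T"
    unfolding T_def greaterThanLessThan_iff by (intro open_Collect_conj open_Collect_less continuous_intros)
  have zT: "z \<in> T" using r by (simp add: T_def xl_def xu_def yl_def yu_def)
  have TS: "\<zeta> \<in> S" if "\<zeta> \<in> T" for \<zeta> using that by (intro box) (auto simp: T_def)
  \<comment> \<open>All partial derivatives of the integral of w over y: x-derivatives pass under
    the integral, and the first y-derivative removes it, whence the index j - 1.\<close>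
  define E where "E i j \<zeta> = (if j = 0 then integral {yl..Im \<zeta>} (\<lambda>t. D i 0 (Complex (Re \<zeta>) t)) else D i (j - 1) \<zeta>)" for i j \<zeta>
  have E: "(E i j has_derivative (\<lambda>v. Re v *\<^sub>R E (Suc i) j \<zeta> + Im v *\<^sub>R E i (Suc j) \<zeta>)) (at \<zeta>)" if "\<zeta> \<in> T" for i j \<zeta>
  proof (cases j)
    case 0
    have "continuous_on {\<zeta>. Re \<zeta> \<in> {xl<..<xu} \<and> Im \<zeta> \<in> {yl..yu}} (D (Suc i) 0)"
      using D[THEN has_derivative_continuous] box by (intro continuous_at_imp_continuous_on) blast
    from has_derivative_integral_Im[of xl xu yl yu "D i 0", OF D[OF box] this] that
    show ?thesis by (simp add: 0 E_def[abs_def] T_def)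
  next
    case (Suc m)
    then show ?thesis using D[OF TS[OF that], of i m] by (simp add: E_def[abs_def])
  qed
  define R :: "nat \<Rightarrow> nat \<Rightarrow> complex \<Rightarrow> real" where
    "R i j \<zeta> = (if j = 0 then if i = 0 then Re \<zeta> else if i = 1 then 1 else 0 else 0)" for i j \<zeta>
  have R: "(R i j has_derivative (\<lambda>v. Re v *\<^sub>R R (Suc i) j \<zeta> + Im v *\<^sub>R R i (Suc j) \<zeta>)) (at \<zeta>)" for i j \<zeta>
    unfolding R_def[abs_def] by (auto intro!: derivative_eq_intros)
  define DF where "DF i j \<zeta> = of_real (R i j \<zeta>) + \<i> * of_real (E i j \<zeta>)" for i j \<zeta>
  have DF: "(DF i j has_derivative (\<lambda>v. Re v *\<^sub>R DF (Suc i) j \<zeta> + Im v *\<^sub>R DF i (Suc j) \<zeta>)) (at \<zeta>)" if "\<zeta> \<in> T" for i j \<zeta>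
  proof -
    have "((\<lambda>\<zeta>. of_real (R i j \<zeta>) + \<i> * of_real (E i j \<zeta>)) has_derivative
       (\<lambda>v. of_real (Re v *\<^sub>R R (Suc i) j \<zeta> + Im v *\<^sub>R R i (Suc j) \<zeta>) + \<i> * of_real (Re v *\<^sub>R E (Suc i) j \<zeta> + Im v *\<^sub>R E i (Suc j) \<zeta>))) (at \<zeta>)"
      by (intro has_derivative_add has_derivative_mult_right bounded_linear.has_derivative[OF bounded_linear_of_real] R E[OF that])
    then show ?thesis by (simp add: DF_def[abs_def] scaleR_conv_of_real algebra_simps)
  qed
  define F where "F = DF 0 0"
  have "Cinf_on T F"
    unfolding Cinf_on_def F_def using DF by (intro exI[of _ DF]) auto
  moreover have "transpose (jac F y) ** Om ** jac F y = w y *\<^sub>R Om" if "y \<in> T" for y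
    using jac_entries[OF DF[OF that, of 0 0]] D0[OF TS[OF that]]
    by (simp add: F_def mat2 DF_def R_def E_def)
  \<comment> \<open>The first coordinate is x, and on vertical segments the second one increases
    strictly because w > 0.\<close>
  moreover have "inj_on F T"
  proof (rule inj_onI)
    fix \<zeta> \<xi> assume T': "\<zeta> \<in> T" "\<xi> \<in> T" and "F \<zeta> = F \<xi>"
    then have re: "Re \<zeta> = Re \<xi>" and im: "E 0 0 \<zeta> = E 0 0 \<xi>"
      by (simp_all add: F_def DF_def R_def complex_eq_iff)
    have mono: "E 0 0 (Complex (Re \<zeta>) s) < E 0 0 (Complex (Re \<zeta>) t)" if "yl < s" "s < t" "t < yu" for s t
    proof (rule DERIV_pos_imp_increasing[OF that(2)])
      fix x assume x: "s \<le> x" "x \<le> t"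
      have xT: "Complex (Re \<zeta>) x \<in> T" using x that T'(1) by (simp add: T_def)
      have "((\<lambda>t. Complex (Re \<zeta>) t) has_derivative (\<lambda>v. \<i> * of_real v)) (at x)"
        unfolding Complex_eq by (auto intro!: derivative_eq_intros)
      from has_derivative_compose[OF this E[OF xT, of 0 0]]
      have "((\<lambda>t. E 0 0 (Complex (Re \<zeta>) t)) has_real_derivative D 0 0 (Complex (Re \<zeta>) x)) (at x)"
        by (simp add: has_field_derivative_def E_def mult_commute_abs)
      then show "\<exists>y. ((\<lambda>t. E 0 0 (Complex (Re \<zeta>) t)) has_real_derivative y) (at x) \<and> y > 0"
        using D0[OF TS[OF xT]] pos[OF TS[OF xT]] by auto
    qed
    have "\<not> Im \<zeta> < Im \<xi>" "\<not> Im \<xi> < Im \<zeta>"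
      using mono[of "Im \<zeta>" "Im \<xi>"] mono[of "Im \<xi>" "Im \<zeta>"] im re T' by (auto simp: T_def complex_eq_iff)
         (metis complex.collapse less_irrefl re)+
    then show "\<zeta> = \<xi>" using re by (simp add: complex_eq_iff)
  qed
  ultimately show ?thesis unfolding darboux_coord_def using T zT by blast
qed

lemma lie_\<alpha>_cong:
  assumes "open S" "z \<in> S" "\<And>y. y \<in> S \<Longrightarrow> X y = X' y"
  shows "lie_\<alpha> X \<alpha> z = lie_\<alpha> X' \<alpha> z"
proof -
  have "vf_jac X z = vf_jac X' z"
    unfolding vf_jac_def using pd_cong[OF assms(1,2), of "\<lambda>y. X y $ _" "\<lambda>y. X' y $ _"] assms(3) by simp
  then show ?thesis using assms(2,3) by (simp add: lie_\<alpha>_def)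
qed

lemma ham_vf_eq:
  assumes "W c z > 0"
  shows "ham_vf W h c z = ham (W c) (\<lambda>k. pd k (h \<circ> pt c)) z"
  unfolding ham_vf_def
proof (rule the_equality)
  have e: "(X :: real^2) \<bullet> (form_mat W c z *v axis k 1) = (if k = 1 then - (X $ 2 * W c z) else X $ 1 * W c z)" for X k
    using exhaust_2[of k] by (auto simp: form_mat_def Om_def inner_vec_def matrix_vector_mult_def sum_2 axis_def)
  show "\<forall>k. pd k (h \<circ> pt c) z = - (ham (W c) (\<lambda>k. pd k (h \<circ> pt c)) z \<bullet> (form_mat W c z *v axis k 1))"
    using assms unfolding e forall_2 by (simp add: ham_def)
  fix X :: "real^2" assume "\<forall>k. pd k (h \<circ> pt c) z = - (X \<bullet> (form_mat W c z *v axis k 1))"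
  then have "pd 1 (h \<circ> pt c) z = X $ 2 * W c z" "pd 2 (h \<circ> pt c) z = - (X $ 1 * W c z)"
    unfolding e forall_2 by auto
  then show "X = ham (W c) (\<lambda>k. pd k (h \<circ> pt c)) z"
    using assms by (simp add: ham_def vec_eq_iff forall_2)
qed

text \<open>\<open>darboux_exists\<close> guarantees that the \<open>SOME\<close> in
  \<open>dc_rho_at\<close> denotes Darboux coordinates. Only the relation satisfied by their
  Jacobian at \<open>z\<close> is used, so the choice leaves no trace in the result.\<close>

lemma dc_rho_at_eq:
  assumes p: "patch S (W c) (J c) (A c)" and W: "Cinf_on S (W c)" and z: "z \<in> S"
  shows "dc_rho_at W J A h c z = dens_dc (W c) (A c) (h \<circ> pt c) z"
proof -
  interpret patch S "W c" "J c" "A c" by (rule p)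
  define F where "F = (SOME F. darboux_coord (W c) z F)"
  have "darboux_coord (W c) z F"
    unfolding F_def using someI_ex[OF darboux_exists[OF S z W w_pos]] .
  then have P: "transpose (jac F z) ** Om ** jac F z = W c z *\<^sub>R Om"
    unfolding darboux_coord_def by blast
  have l: "lie_\<alpha> (ham_vf W h c) (A c) z = lie_\<alpha> (ham (W c) (\<lambda>k. pd k (h \<circ> pt c))) (A c) z"
    by (rule lie_\<alpha>_cong[OF S z]) (rule ham_vf_eq[of W c, OF w_pos])
  have "dc_rho (push (jac F z) (J c z, A c z)) (push (jac F z) (lie_J (ham_vf W h c) (J c) z, lie_\<alpha> (ham_vf W h c) (A c) z))
     = trace (map_matrix Re (A c z) ** map_matrix Im (lie_\<alpha> (ham_vf W h c) (A c) z)) /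
        (2 * (1 + sqrt (1 + det (map_matrix Re (A c z)))))"
    by (rule dc_rho_push[OF w_pos[OF z] P compat[OF z] cotan[OF z] tangent_lie[OF z]])
      (use D_less[OF z] in \<open>simp add: Dfun_def\<close>)
  then show ?thesis
    unfolding dc_rho_at_def Let_def F_def[symmetric] l by (simp add: dens_dc_def sfun_def Dfun_def)
qed

section \<open>Holomorphic changes of coordinates\<close>

text \<open>The matrix of multiplication by \<open>\<zeta>\<close>: Jacobians of holomorphic maps have this form.\<close>

definition conf :: "complex \<Rightarrow> real^2^2" where
  "conf \<zeta> = vector [vector [Re \<zeta>, - Im \<zeta>], vector [Im \<zeta>, Re \<zeta>]]"

lemma conf_nth [simp]: "conf \<zeta> $ 1 $ 1 = Re \<zeta>" "conf \<zeta> $ 1 $ 2 = - Im \<zeta>"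
    "conf \<zeta> $ 2 $ 1 = Im \<zeta>" "conf \<zeta> $ 2 $ 2 = Re \<zeta>"
  by (simp_all add: conf_def)

lemma bounded_linear_conf: "bounded_linear conf"
  unfolding linear_conv_bounded_linear[symmetric]
  by (auto intro!: linearI simp: vec_eq_iff forall_2)

lemma holomorphic_pd:
  assumes "open S" "f holomorphic_on S" "z \<in> S"
  shows "f differentiable (at z)" "pd k f z = cbasis k * deriv f z"
proof -
  have "(f has_field_derivative deriv f z) (at z)"
    using assms holomorphic_derivI by blast
  then have d: "(f has_derivative (*) (deriv f z)) (at z)" by (simp add: has_field_derivative_def)
  show "f differentiable (at z)" using d by (rule differentiableI)
  show "pd k f z = cbasis k * deriv f z" using has_derivative_pd[OF d] by (simp add: mult.commute)
qed

lemma holomorphic_Ck_on: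
  assumes "open S" "f holomorphic_on S"
  shows "Ck_on n S f"
  using assms(2)
proof (induction n arbitrary: f)
  case 0
  then show ?case by (simp add: holomorphic_on_imp_continuous_on)
next
  case (Suc n)
  have "Ck_on n S (\<lambda>z. cbasis k * deriv f z)" for k
    by (rule Suc.IH) (intro holomorphic_intros holomorphic_deriv Suc.prems assms(1))
  then have "Ck_on n S (pd k f)" for k
    using Ck_on_cong[OF assms(1), of "pd k f" "\<lambda>z. cbasis k * deriv f z"] holomorphic_pd[OF assms(1) Suc.prems] by simp
  then show ?case using holomorphic_pd[OF assms(1) Suc.prems] by simp
qed

lemma patch_subset: "patch S w J \<alpha> \<Longrightarrow> open T \<Longrightarrow> T \<subseteq> S \<Longrightarrow> patch T w J \<alpha>"
  unfolding patch_def prepatch_def patch_axioms_def using Ck_on_subset by (metis subsetD)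

lemma cmod_sq: "(cmod \<zeta>)\<^sup>2 = Re \<zeta> * Re \<zeta> + Im \<zeta> * Im \<zeta>"
  by (simp only: cmod_power2 power2_eq_square[of "Re \<zeta>"] power2_eq_square[of "Im \<zeta>"])

lemma matrix_mul_scaleR_left: "(r *\<^sub>R A) ** B = r *\<^sub>R (A ** B)" for A B :: "real^2^2"
  by (simp add: mat2 algebra_simps)

lemma conf_Om: "transpose (conf \<zeta>) ** Om ** conf \<zeta> = (cmod \<zeta>)\<^sup>2 *\<^sub>R Om"
  by (simp add: mat2 cmod_sq algebra_simps)

lemma conf_transpose_mult: "transpose (conf \<zeta>) ** conf \<zeta> = (cmod \<zeta>)\<^sup>2 *\<^sub>R mat 1" "conf \<zeta> ** transpose (conf \<zeta>) = (cmod \<zeta>)\<^sup>2 *\<^sub>R mat 1"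
  by (simp_all add: mat2 cmod_sq algebra_simps)

lemma matrix_left_cancel:
  fixes A X Y :: "real^2^2"
  assumes "det A \<noteq> 0" "A ** X = A ** Y"
  shows "X = Y"
proof -
  have "matrix_inv A ** (A ** X) = matrix_inv A ** (A ** Y)" using assms(2) by simp
  then show ?thesis by (simp add: matrix_mul_assoc matrix_inv_mul(1)[OF assms(1)])
qed

text \<open>\<open>Gam G j\<close> is the connection matrix along $\partial_j$, and \<open>Rie G\<close> the curvature matrix $R_{12}$, which
  in dimension two determines the Ricci tensor. A change of coordinates acts on the connection matrices as a
  gauge transformation, so the curvature matrix is merely conjugated.\<close>

definition Gam :: "(complex \<Rightarrow> real^2^2) \<Rightarrow> 2 \<Rightarrow> complex \<Rightarrow> real^2^2" where
  "Gam G j z = (\<chi> i k. christoffel G i j k z)"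

definition Rie :: "(complex \<Rightarrow> real^2^2) \<Rightarrow> complex \<Rightarrow> real^2^2" where
  "Rie G z = pd 1 (Gam G 2) z - pd 2 (Gam G 1) z + Gam G 1 z ** Gam G 2 z - Gam G 2 z ** Gam G 1 z"

lemma differentiable_vec:
  fixes f :: "complex \<Rightarrow> 'a::euclidean_space^'n"
  assumes "\<And>i. (\<lambda>y. f y $ i) differentiable (at z)"
  shows "f differentiable (at z)"
proof -
  have "f = (\<lambda>y. \<Sum>i\<in>UNIV. axis i (f y $ i))" by (simp add: vec_eq_iff axis_def fun_eq_iff)
  moreover have "(\<lambda>y. \<Sum>i\<in>UNIV. axis i (f y $ i)) differentiable (at z)"
    by (rule differentiable_sum) (auto intro: differentiable_bounded_linear[OF bounded_linear_axis assms])
  ultimately show ?thesis by simp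
qed

lemma differentiable_Gam:
  assumes "\<And>i k. christoffel G i j k differentiable (at z)"
  shows "Gam G j differentiable (at z)"
  by (intro differentiable_vec) (simp add: Gam_def assms)

lemma ricci_eq_Rie:
  assumes "\<And>i j k. christoffel G i j k differentiable (at z)"
  shows "ricci G z = transpose (Rie G z) ** Om"
proof -
  have "pd l (christoffel G i j k) z = pd l (Gam G j) z $ i $ k" for l i j k
    using pd_nth2[OF differentiable_Gam[OF assms], of l j i k] by (simp add: Gam_def)
  then show ?thesis
    by (simp add: vec_eq_iff forall_2 ricci_def Rie_def sum_2 matrix_matrix_mult_def transpose_def Om_def Gam_def algebra_simps)
qed

locale transition_patch = p: patch S w J \<alpha> + q: patch S' w' J' \<alpha>'
  for S w J \<alpha> S' w' J' \<alpha>' +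
  fixes F :: "complex \<Rightarrow> complex"
  assumes hol: "F holomorphic_on S" and FS: "F ` S \<subseteq> S'"
    and w_law: "\<And>z. z \<in> S \<Longrightarrow> w z = w' (F z) * det (jac F z)"
    and J_law: "\<And>z. z \<in> S \<Longrightarrow> J' (F z) ** jac F z = jac F z ** J z"
    and \<alpha>_law: "\<And>z. z \<in> S \<Longrightarrow> cmat (transpose (jac F z)) ** \<alpha>' (F z) = \<alpha> z ** cmat (transpose (jac F z))"
begin

abbreviation "f' \<equiv> deriv F"
abbreviation "f'' \<equiv> deriv (deriv F)"
abbreviation "P z \<equiv> conf (deriv F z)"
definition "\<delta> z = (cmod (f' z))\<^sup>2"

lemma hol': "f' holomorphic_on S" and hol'': "f'' holomorphic_on S"
  by (intro holomorphic_deriv hol p.S)+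

lemma FS': "z \<in> S \<Longrightarrow> F z \<in> S'"
  using FS by blast

lemma F_diff: "z \<in> S \<Longrightarrow> F differentiable (at z)"
  by (rule holomorphic_pd[OF p.S hol])

lemma jac_F: "z \<in> S \<Longrightarrow> jac F z = P z"
  using holomorphic_pd(2)[OF p.S hol] by (simp add: vec_eq_iff forall_2 jac_nth)

lemma det_P: "det (P z) = \<delta> z"
  by (simp add: \<delta>_def cmod_sq det_2)

lemma w_eq: "z \<in> S \<Longrightarrow> w z = w' (F z) * \<delta> z"
  using w_law[of z] by (simp add: jac_F det_P)

lemma \<delta>_pos: "z \<in> S \<Longrightarrow> \<delta> z > 0"
  using w_eq[of z] p.w_pos[of z] q.w_pos[OF FS', of z] by (metis zero_less_mult_pos)

lemma Pinv:
  assumes "z \<in> S"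
  defines "Q \<equiv> inverse (\<delta> z) *\<^sub>R transpose (P z)"
  shows "P z ** Q = mat 1" "Q ** P z = mat 1"
  using \<delta>_pos[OF assms(1)] by (simp_all add: Q_def matrix_mul_scaleR_right matrix_mul_scaleR_left
      conf_transpose_mult \<delta>_def[symmetric])

lemma J_P: "z \<in> S \<Longrightarrow> J' (F z) ** P z = P z ** J z"
  using J_law by (simp add: jac_F)

lemma R_P: "z \<in> S \<Longrightarrow> transpose (P z) ** map_matrix Re (\<alpha>' (F z)) = map_matrix Re (\<alpha> z) ** transpose (P z)"
  and N_P: "z \<in> S \<Longrightarrow> transpose (P z) ** map_matrix Im (\<alpha>' (F z)) = map_matrix Im (\<alpha> z) ** transpose (P z)"
  using \<alpha>_law[of z] by (simp_all add: jac_F mat2 complex_eq_iff)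

lemma D_law: "z \<in> S \<Longrightarrow> Dfun \<alpha> z = Dfun \<alpha>' (F z)"
proof -
  assume z: "z \<in> S"
  have "det (transpose (P z) ** map_matrix Re (\<alpha>' (F z))) = det (map_matrix Re (\<alpha> z) ** transpose (P z))"
    by (simp add: R_P[OF z])
  then show ?thesis using \<delta>_pos[OF z] by (simp add: det_mul det_transpose det_P Dfun_def)
qed

lemma s_law: "z \<in> S \<Longrightarrow> sfun \<alpha> z = sfun \<alpha>' (F z)"
  by (simp add: sfun_def D_law)

section \<open>Transformation of covectors, vector fields and divergences\<close>

lemma pd_law:
  assumes z: "z \<in> S" and g: "g' differentiable (at (F z))" and "\<And>y. y \<in> S \<Longrightarrow> g y = g' (F y)"
  shows "pd j g z = (\<Sum>b\<in>UNIV. P z $ b $ j *\<^sub>R pd b g' (F z))"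
  using pd_compose[OF F_diff[OF z] g] pd_cong[OF p.S z assms(3)] by (simp add: jac_F[OF z])

text \<open>For a conformal matrix P, rotating a covector pulled back by P and then applying P gives
  |F'|^2 times the rotated covector; the law for the area densities absorbs this factor.\<close>

lemma ham_law:
  assumes z: "z \<in> S" and "\<And>j. \<kappa> j z = (\<Sum>b\<in>UNIV. P z $ b $ j * \<kappa>' b (F z))"
  shows "P z *v ham w \<kappa> z = ham w' \<kappa>' (F z)"
proof -
  have "P z *v vector [- \<kappa> 2 z, \<kappa> 1 z] = \<delta> z *\<^sub>R vector [- \<kappa>' 2 (F z), \<kappa>' 1 (F z)]"
    unfolding assms(2) by (simp add: vec_eq_iff forall_2 matrix_vector_mult_def sum_2 \<delta>_def cmod_sq algebra_simps)
  then show ?thesis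
    using \<delta>_pos[OF z] by (simp add: ham_def w_eq[OF z] matrix_vector_mult_scaleR)
qed

lemma pd_P:
  assumes "z \<in> S"
  shows "pd k (\<lambda>z. P z $ i $ j) z = conf (cbasis k * f'' z) $ i $ j"
    and "(\<lambda>z. P z $ i $ j) differentiable (at z)"
proof -
  have l: "bounded_linear (\<lambda>\<zeta>. conf \<zeta> $ i $ j)"
    by (rule bounded_linear_compose[OF bounded_linear_vec_nth2 bounded_linear_conf])
  show "pd k (\<lambda>z. P z $ i $ j) z = conf (cbasis k * f'' z) $ i $ j"
    using pd_bounded_linear[OF l, of f' z k] holomorphic_pd[OF p.S hol' assms] by simp
  show "(\<lambda>z. P z $ i $ j) differentiable (at z)"
    by (rule differentiable_bounded_linear[OF l holomorphic_pd(1)[OF p.S hol' assms]])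
qed

lemma comp_diff: "z \<in> S \<Longrightarrow> g differentiable (at (F z)) \<Longrightarrow> (\<lambda>y. g (F y)) differentiable (at z)"
  by (rule differentiable_compose_plane[OF F_diff])

lemma pd_comp: "z \<in> S \<Longrightarrow> g differentiable (at (F z)) \<Longrightarrow>
    pd j (\<lambda>y. g (F y)) z = (\<Sum>b\<in>UNIV. P z $ b $ j *\<^sub>R pd b g (F z))"
  by (rule pd_law) auto

text \<open>w V is the transposed P applied to w' V'. In its divergence the second derivatives of F
  enter as the sum of conf(cbasis i * F'') in column i, the Laplacian of the components of F, which
  vanishes. The first-order terms combine through P P^T = |F'|^2.\<close>

lemma div_law:
  assumes z: "z \<in> S" and V: "\<And>y. y \<in> S \<Longrightarrow> P y *v V y = V' (F y)"
    and V': "\<And>i. (\<lambda>y. V' y $ i) differentiable (at (F z))"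
  shows "divw w V z = divw w' V' (F z)"
proof -
  define W where "W i y = w' y * V' y $ i" for i y
  have W: "W i differentiable (at (F z))" for i
    unfolding W_def using Ck_on_differentiable[OF q.w zero_less_one FS'[OF z]] V' by (intro differentiable_mult)
  note d = comp_diff[OF z W] pd_P(2)[OF z]
  have e: "w y * V y $ i = (\<Sum>a\<in>UNIV. P y $ a $ i * W a (F y))" if y: "y \<in> S" for y i
  proof -
    have "\<delta> y * V y $ i = (\<Sum>a\<in>UNIV. P y $ a $ i * (P y *v V y) $ a)"
      using exhaust_2[of i] by (auto simp: sum_2 matrix_vector_mult_def \<delta>_def cmod_sq algebra_simps)
    moreover have "w y * V y $ i = w' (F y) * (\<delta> y * V y $ i)" by (simp add: w_eq[OF y])
    ultimately show ?thesis
      unfolding V[OF y] W_def by (simp add: sum_2 algebra_simps)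
  qed
  have "pd i (\<lambda>y. w y * V y $ i) z = (\<Sum>a\<in>UNIV. conf (cbasis i * f'' z) $ a $ i * W a (F z)
     + P z $ a $ i * (\<Sum>b\<in>UNIV. P z $ b $ i * pd b (W a) (F z)))" for i
  proof -
    have "pd i (\<lambda>y. w y * V y $ i) z = pd i (\<lambda>y. \<Sum>a\<in>UNIV. P y $ a $ i * W a (F y)) z"
      by (rule pd_cong[OF p.S z e])
    also have "\<dots> = (\<Sum>a\<in>UNIV. pd i (\<lambda>y. P y $ a $ i * W a (F y)) z)"
      by (rule pd_sum) (intro differentiable_mult d)
    also have "\<dots> = (\<Sum>a\<in>UNIV. pd i (\<lambda>y. P y $ a $ i) z * W a (F z) + P z $ a $ i * pd i (\<lambda>y. W a (F y)) z)"
      by (rule sum.cong[OF refl], rule pd_mult) (intro d)+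
    finally show ?thesis by (simp add: pd_P(1)[OF z] pd_comp[OF z W])
  qed
  then have "(\<Sum>i\<in>UNIV. pd i (\<lambda>y. w y * V y $ i) z) = \<delta> z * (\<Sum>i\<in>UNIV. pd i (W i) (F z))"
    by (simp add: sum_2 \<delta>_def cmod_sq algebra_simps)
  then show ?thesis
    unfolding divw_def w_eq[OF z] W_def[abs_def] using \<delta>_pos[OF z] by simp
qed

text \<open>The product rule for a pulled-back bilinear form P^T K P. Both the metric and w J
  transform in this way, the latter because |F'|^2 J = P^T J' P.\<close>

lemma pd_pullback:
  fixes K :: "2 \<Rightarrow> 2 \<Rightarrow> complex \<Rightarrow> real"
  assumes z: "z \<in> S" and K: "\<And>a b. K a b differentiable (at (F z))"
    and e: "\<And>y. y \<in> S \<Longrightarrow> g y = (\<Sum>a\<in>UNIV. \<Sum>b\<in>UNIV. P y $ a $ m * P y $ b $ j * K a b (F y))"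
  shows "pd i g z = (\<Sum>a\<in>UNIV. \<Sum>b\<in>UNIV.
      (conf (cbasis i * f'' z) $ a $ m * P z $ b $ j + P z $ a $ m * conf (cbasis i * f'' z) $ b $ j) * K a b (F z)
     + P z $ a $ m * P z $ b $ j * (\<Sum>c\<in>UNIV. P z $ c $ i * pd c (K a b) (F z)))"
proof -
  note d = comp_diff[OF z K] pd_P(2)[OF z]
  have d1: "(\<lambda>y. P y $ a $ m * P y $ b $ j * K a b (F y)) differentiable (at z)" for a b
    by (intro differentiable_mult d)
  have d2: "(\<lambda>y. \<Sum>b\<in>UNIV. P y $ a $ m * P y $ b $ j * K a b (F y)) differentiable (at z)" for a
    by (rule differentiable_sum) (use d1 in auto)
  have "pd i g z = pd i (\<lambda>y. \<Sum>a\<in>UNIV. \<Sum>b\<in>UNIV. P y $ a $ m * P y $ b $ j * K a b (F y)) z"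
    by (rule pd_cong[OF p.S z e])
  also have "\<dots> = (\<Sum>a\<in>UNIV. \<Sum>b\<in>UNIV. pd i (\<lambda>y. P y $ a $ m * P y $ b $ j * K a b (F y)) z)"
    unfolding pd_sum[OF d2] by (rule sum.cong[OF refl], rule pd_sum[OF d1])
  also have "\<dots> = (\<Sum>a\<in>UNIV. \<Sum>b\<in>UNIV. pd i (\<lambda>y. P y $ a $ m * P y $ b $ j) z * K a b (F z) + P z $ a $ m * P z $ b $ j * pd i (\<lambda>y. K a b (F y)) z)"
    by (rule sum.cong[OF refl], rule sum.cong[OF refl], rule pd_mult) (intro differentiable_mult d)+
  also have "\<dots> = (\<Sum>a\<in>UNIV. \<Sum>b\<in>UNIV. (pd i (\<lambda>y. P y $ a $ m) z * P z $ b $ j + P z $ a $ m * pd i (\<lambda>y. P y $ b $ j) z) * K a b (F z)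
      + P z $ a $ m * P z $ b $ j * pd i (\<lambda>y. K a b (F y)) z)"
    by (simp only: pd_mult[OF d(2) d(2)])
  finally show ?thesis by (simp add: pd_P(1)[OF z] pd_comp[OF z K])
qed

text \<open>Second derivatives of F acting on the index of the divergence cancel because F is
  harmonic. Those acting on the free index remain and form the trace, after exchanging the two
  directions of differentiation.\<close>

lemma divJ_law:
  assumes z: "z \<in> S"
  shows "divJ w J j z = \<delta> z * (\<Sum>b\<in>UNIV. P z $ b $ j * divJ w' J' b (F z))
    + trace (conf (cbasis j * f'' z) ** transpose (P z) ** (w' (F z) *\<^sub>R J' (F z)))"
proof -
  define K where "K a b y = w' y * J' y $ a $ b" for a b y
  have K: "K a b differentiable (at (F z))" for a b
    unfolding K_def by (intro differentiable_mult Ck_on_differentiable[OF _ zero_less_one FS'[OF z]] q.w q.J_nth)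
  have e: "w y * J y $ i $ j = (\<Sum>a\<in>UNIV. \<Sum>b\<in>UNIV. P y $ a $ i * P y $ b $ j * K a b (F y))" if y: "y \<in> S" for y i
  proof -
    have "\<delta> y *\<^sub>R J y = transpose (P y) ** (P y ** J y)"
      by (simp add: matrix_mul_assoc conf_transpose_mult \<delta>_def) (simp add: mat2)
    also have "\<dots> = transpose (P y) ** J' (F y) ** P y"
      by (simp add: J_P[OF y, symmetric] matrix_mul_assoc)
    finally have "(\<delta> y *\<^sub>R J y) $ i $ j = (transpose (P y) ** J' (F y) ** P y) $ i $ j" by simp
    then have "\<delta> y * J y $ i $ j = (\<Sum>a\<in>UNIV. \<Sum>b\<in>UNIV. P y $ a $ i * P y $ b $ j * J' (F y) $ a $ b)"
      by (simp add: matrix_matrix_mult_def transpose_def sum_2 algebra_simps)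
    moreover have "w y * J y $ i $ j = w' (F y) * (\<delta> y * J y $ i $ j)" by (simp add: w_eq[OF y])
    ultimately show ?thesis unfolding K_def by (simp add: sum_2 algebra_simps)
  qed
  have pdK: "pd i (\<lambda>y. w y * J y $ i $ j) z = (\<Sum>a\<in>UNIV. \<Sum>b\<in>UNIV.
      (conf (cbasis i * f'' z) $ a $ i * P z $ b $ j + P z $ a $ i * conf (cbasis i * f'' z) $ b $ j) * K a b (F z)
     + P z $ a $ i * P z $ b $ j * (\<Sum>c\<in>UNIV. P z $ c $ i * pd c (K a b) (F z)))" for i
    by (rule pd_pullback[OF z K], rule e)
  have "divJ w J j z = \<delta> z * (\<Sum>b\<in>UNIV. P z $ b $ j * (\<Sum>a\<in>UNIV. pd a (K a b) (F z)))
    + trace (conf (cbasis j * f'' z) ** transpose (P z) ** (w' (F z) *\<^sub>R J' (F z)))"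
    unfolding divJ_def pdK
    using exhaust_2[of j] by (auto simp: sum_2 \<delta>_def cmod_sq mat2 K_def algebra_simps)
  then show ?thesis by (simp add: divJ_def K_def[abs_def])
qed

text \<open>Differentiating the transformation law of Im \<alpha> produces two terms with the
  derivative of P^T. Under the trace with R they involve N R and R N, both multiples of J^T by
  \<open>R_sq\<close>, and give a multiple of the same trace that occurs in
  \<open>divJ_law\<close>.\<close>

lemma theta_law:
  assumes z: "z \<in> S"
  shows "theta \<alpha> j z = (\<Sum>b\<in>UNIV. P z $ b $ j * theta \<alpha>' b (F z))
    - 2 * Dfun \<alpha> z / w z * trace (conf (cbasis j * f'' z) ** transpose (P z) ** (w' (F z) *\<^sub>R J' (F z)))"
proof -
  define R N R' N' Q where "R = map_matrix Re (\<alpha> z)" and "N = map_matrix Im (\<alpha> z)"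
    and "R' = map_matrix Re (\<alpha>' (F z))" and "N' = map_matrix Im (\<alpha>' (F z))"
    and "Q = inverse (\<delta> z) *\<^sub>R P z"
  define PT PT' M M' where "PT = transpose (P z)" and "PT' = transpose (conf (cbasis j * f'' z))"
    and "M = map_matrix Im (pd j \<alpha> z)" and "M' = (\<Sum>b\<in>UNIV. P z $ b $ j *\<^sub>R map_matrix Im (pd b \<alpha>' (F z)))"
  have bIm: "bounded_linear (map_matrix Im :: complex^2^2 \<Rightarrow> real^2^2)"
    unfolding linear_conv_bounded_linear[symmetric] by (auto intro!: linearI simp: vec_eq_iff)
  have bT: "bounded_linear (\<lambda>\<zeta>. transpose (conf \<zeta>))"
    unfolding linear_conv_bounded_linear[symmetric] by (auto intro!: linearI simp: vec_eq_iff transpose_def forall_2)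
  have d\<alpha>: "\<alpha> differentiable (at z)" "\<alpha>' differentiable (at (F z))"
    by (rule Ck_on_differentiable[OF p.\<alpha> zero_less_one z], rule Ck_on_differentiable[OF q.\<alpha> zero_less_one FS'[OF z]])
  note dN = differentiable_bounded_linear[OF bIm d\<alpha>(1)] differentiable_bounded_linear[OF bIm d\<alpha>(2)]
  note df = holomorphic_pd[OF p.S hol' z]
  note dP = differentiable_bounded_linear[OF bT df(1)]
  have "pd j (\<lambda>y. transpose (P y) ** map_matrix Im (\<alpha>' (F y))) z = pd j (\<lambda>y. map_matrix Im (\<alpha> y) ** transpose (P y)) z"
    by (rule pd_cong[OF p.S z]) (rule N_P)
  moreover have "pd j (\<lambda>y. map_matrix Im (\<alpha>' (F y))) z = M'"
    unfolding pd_comp[OF z dN(2)] by (simp add: M'_def pd_bounded_linear[OF bIm d\<alpha>(2)])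
  moreover have "pd j (\<lambda>y. transpose (P y)) z = PT'"
    by (simp add: pd_bounded_linear[OF bT df(1)] df(2) PT'_def)
  ultimately have rel: "PT' ** N' + PT ** M' = M ** PT + N ** PT'"
    unfolding pd_bounded_bilinear[OF bounded_bilinear_matrix_mult_real dP comp_diff[OF z dN(2)]]
      pd_bounded_bilinear[OF bounded_bilinear_matrix_mult_real dN(1) dP] pd_bounded_linear[OF bIm d\<alpha>(1)]
    by (simp add: PT_def N'_def N_def M_def)
  have PQ: "PT ** Q = mat 1" "Q ** PT = mat 1"
    using \<delta>_pos[OF z] conf_transpose_mult[of "f' z"]
    by (simp_all add: PT_def Q_def matrix_mul_scaleR_right matrix_mul_scaleR_left \<delta>_def[symmetric])
  have RP: "PT ** R' = R ** PT" "PT ** N' = N ** PT"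
    using R_P[OF z] N_P[OF z] by (simp_all add: PT_def R'_def R_def N'_def N_def)
  have R'e: "R' = Q ** R ** PT" "N' = Q ** N ** PT"
    using RP PQ by (metis matrix_mul_assoc matrix_mul_lid)+
  have M: "M = (PT' ** N' + PT ** M' - N ** PT') ** Q"
  proof -
    have "M = (M ** PT) ** Q" by (simp add: PQ flip: matrix_mul_assoc)
    also have "M ** PT = PT' ** N' + PT ** M' - N ** PT'" unfolding rel by simp
    finally show ?thesis .
  qed
  have "trace (R ** M) = trace (R ** PT' ** N' ** Q) + trace (R ** PT ** M' ** Q) - trace (R ** N ** PT' ** Q)"
    unfolding M by (simp add: mat2 algebra_simps)
  also have "trace (R ** PT' ** N' ** Q) = trace (N ** R ** PT' ** Q)"
  proof -
    have "R ** PT' ** N' ** Q = R ** PT' ** Q ** N ** (PT ** Q)" unfolding R'e by (simp add: matrix_mul_assoc)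
    then show ?thesis using trace_mul_sym[of "R ** PT' ** Q" N] by (simp add: PQ matrix_mul_assoc)
  qed
  also have "trace (R ** PT ** M' ** Q) = trace (R' ** M')"
    using trace_mul_sym[of "R ** PT ** M'" Q] by (simp add: R'e(1) matrix_mul_assoc)
  also have "trace (R' ** M') = (\<Sum>b\<in>UNIV. P z $ b $ j * theta \<alpha>' b (F z))"
    by (simp add: theta_def R'_def M'_def mat2 algebra_simps)
  finally have 1: "theta \<alpha> j z = (\<Sum>b\<in>UNIV. P z $ b $ j * theta \<alpha>' b (F z)) + (trace (N ** R ** PT' ** Q) - trace (R ** N ** PT' ** Q))"
    by (simp add: theta_def R_def M_def)
  have NR: "N ** R = - (Dfun \<alpha> z *\<^sub>R transpose (J z))"
  proof -
    have "N ** R = - (transpose (J z) ** (R ** R))"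
      using p.R_sq(2)[OF z] by (simp add: R_def N_def matrix_mul_assoc) (simp add: mat2 algebra_simps)
    then show ?thesis using p.R_sq(3)[OF z] by (simp add: R_def) (simp add: mat2)
  qed
  have RN: "R ** N = Dfun \<alpha> z *\<^sub>R transpose (J z)"
  proof -
    have "R ** N = R ** R ** transpose (J z)"
      using p.R_sq(1)[OF z] by (simp add: R_def N_def matrix_mul_assoc)
    then show ?thesis using p.R_sq(3)[OF z] by (simp add: R_def) (simp add: mat2)
  qed
  have 2: "trace (N ** R ** PT' ** Q) - trace (R ** N ** PT' ** Q) = - 2 * Dfun \<alpha> z * trace (transpose (J z) ** PT' ** Q)"
    unfolding NR RN by (simp add: mat2 algebra_simps)
  have "trace (transpose (J z) ** PT' ** Q) = trace (transpose Q ** transpose PT' ** J z)"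
    by (simp add: mat2 algebra_simps)
  also have "\<dots> = trace (transpose PT' ** J z ** transpose Q)"
    using trace_mul_sym[of "transpose Q" "transpose PT' ** J z"] by (simp add: matrix_mul_assoc)
  also have "J z ** transpose Q = transpose Q ** J' (F z)"
  proof -
    have "J z ** transpose Q = transpose Q ** P z ** J z ** transpose Q"
      using Pinv(2)[OF z] by (simp add: Q_def) (simp add: mat2)
    also have "\<dots> = transpose Q ** J' (F z) ** (P z ** transpose Q)"
      using J_P[OF z] by (metis matrix_mul_assoc)
    also have "P z ** transpose Q = mat 1"
      using Pinv(1)[OF z] by (simp add: Q_def) (simp add: mat2)
    finally show ?thesis by simp
  qed
  then have "transpose PT' ** J z ** transpose Q = transpose PT' ** (transpose Q ** J' (F z))"
    by (metis matrix_mul_assoc)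
  also have "trace (transpose PT' ** (transpose Q ** J' (F z))) =
     trace (conf (cbasis j * f'' z) ** transpose (P z) ** (w' (F z) *\<^sub>R J' (F z))) / w z"
    unfolding w_eq[OF z] using q.w_nz[OF FS'[OF z]] \<delta>_pos[OF z]
    by (simp add: Q_def PT'_def mat2 field_simps)
  finally have 3: "trace (transpose (J z) ** PT' ** Q) =
     trace (conf (cbasis j * f'' z) ** transpose (P z) ** (w' (F z) *\<^sub>R J' (F z))) / w z" .
  show ?thesis unfolding 1 2 3 by simp
qed

text \<open>Neither \<open>theta\<close> nor \<open>divJ\<close> is a covector; the terms with second derivatives of \<open>F\<close> cancel in \<open>eta\<close>.\<close>

lemma eta_law:
  assumes z: "z \<in> S"
  shows "eta w J \<alpha> j z = (\<Sum>b\<in>UNIV. P z $ b $ j * eta w' J' \<alpha>' b (F z))"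
proof -
  have w: "2 * Dfun \<alpha> z / w z * (\<delta> z * x) = 2 * Dfun \<alpha> z / w' (F z) * x" for x
    unfolding w_eq[OF z] using \<delta>_pos[OF z] by simp
  show ?thesis
    unfolding eta_def theta_law[OF z] divJ_law[OF z] distrib_left w D_law[OF z, symmetric]
    by (simp add: sum_2 algebra_simps)
qed

lemma kappa_law:
  assumes z: "z \<in> S"
  shows "kappa w J \<alpha> j z = (\<Sum>b\<in>UNIV. P z $ b $ j * kappa w' J' \<alpha>' b (F z))"
proof -
  have ps: "pd l (sfun \<alpha>) z = (\<Sum>b\<in>UNIV. P z $ b $ l * pd b (sfun \<alpha>') (F z))" for l
    using pd_law[OF z Ck_on_differentiable[OF q.sfun_Ck zero_less_one FS'[OF z]] s_law] by simp
  have "(\<Sum>l\<in>UNIV. J z $ l $ j * (\<Sum>b\<in>UNIV. P z $ b $ l * x b)) = (\<Sum>b\<in>UNIV. (P z ** J z) $ b $ j * x b)" for x :: "2 \<Rightarrow> real"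
    by (simp add: sum_2 matrix_matrix_mult_def algebra_simps)
  also have "(\<Sum>b\<in>UNIV. (P z ** J z) $ b $ j * x b) = (\<Sum>b\<in>UNIV. P z $ b $ j * (\<Sum>l\<in>UNIV. J' (F z) $ l $ b * x l))" for x :: "2 \<Rightarrow> real"
    unfolding J_P[OF z, symmetric] by (simp add: sum_2 matrix_matrix_mult_def algebra_simps)
  finally have e: "(\<Sum>l\<in>UNIV. J z $ l $ j * (\<Sum>b\<in>UNIV. P z $ b $ l * x b)) =
      (\<Sum>b\<in>UNIV. P z $ b $ j * (\<Sum>l\<in>UNIV. J' (F z) $ l $ b * x l))" for x :: "2 \<Rightarrow> real" .
  show ?thesis
    unfolding kappa_def eta_law[OF z] ps e s_law[OF z] by (simp add: sum_2 add_divide_distrib algebra_simps)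
qed

lemma Y_law: "z \<in> S \<Longrightarrow> P z *v ham w (kappa w J \<alpha>) z = ham w' (kappa w' J' \<alpha>') (F z)"
  by (rule ham_law[of z "kappa w J \<alpha>" "kappa w' J' \<alpha>'", OF _ kappa_law])

lemma X_law:
  assumes z: "z \<in> S" and h: "\<And>y. y \<in> S \<Longrightarrow> h y = h' (F y)" and h': "Ck_on 1 S' h'"
  shows "P z *v ham w (\<lambda>k. pd k h) z = ham w' (\<lambda>k. pd k h') (F z)"
  by (rule ham_law[OF z])
    (use pd_law[OF z Ck_on_differentiable[OF h' zero_less_one FS'[OF z]] h] in simp)

lemma flux_law:
  assumes z: "z \<in> S" and h: "\<And>y. y \<in> S \<Longrightarrow> h y = h' (F y)" and h': "Ck_on 1 S' h'"
  shows "P z *v flux w J \<alpha> h z = flux w' J' \<alpha>' h' (F z)"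
proof -
  have "P z *v flux w J \<alpha> h z = (sfun \<alpha> z - 1) *\<^sub>R ((P z ** J z) *v ham w (\<lambda>k. pd k h) z)
      - h z *\<^sub>R (P z *v ham w (kappa w J \<alpha>) z)"
    by (simp add: flux_def matrix_vector_mult_diff_distrib matrix_vector_mult_scaleR matrix_vector_mul_assoc)
  also have "\<dots> = flux w' J' \<alpha>' h' (F z)"
    using X_law[OF z h h'] Y_law[OF z]
    by (simp add: J_P[OF z, symmetric] flux_def s_law[OF z] h[OF z] flip: matrix_vector_mul_assoc)
  finally show ?thesis .
qed

section \<open>Transformation of the metric, the connection and the scalar curvature\<close>

lemma G_law:
  assumes z: "z \<in> S"
  shows "p.G z = transpose (P z) ** q.G (F z) ** P z"
proof -
  have "transpose (P z) ** q.G (F z) ** P z = transpose (P z) ** (w' (F z) *\<^sub>R Om) ** (P z ** J z)"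
    unfolding q.G_def J_P[OF z, symmetric] by (simp add: matrix_mul_assoc)
  also have "\<dots> = w' (F z) *\<^sub>R (transpose (P z) ** Om ** P z) ** J z"
    by (simp add: matrix_mul_assoc matrix_mul_scaleR_right matrix_mul_scaleR_left)
  finally show ?thesis
    unfolding conf_Om p.G_def w_eq[OF z] by (simp add: \<delta>_def matrix_mul_scaleR_left)
qed

lemma q_G_sym: "q.G y $ 2 $ 1 = q.G y $ 1 $ 2" if "y \<in> S'"
  using q.G_entries[OF that] by simp

text \<open>Both sides are compared after multiplication by the invertible P^T G', which lowers the
  index: then \<open>christoffel_lowered\<close> and \<open>pd_pullback\<close> reduce everything to
  first derivatives of the target metric.\<close>

lemma Christoffel_law:
  assumes z: "z \<in> S"
  shows "P z ** Gam p.G j z = (\<Sum>b\<in>UNIV. P z $ b $ j *\<^sub>R Gam q.G b (F z)) ** P z + conf (cbasis j * f'' z)"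
    (is "?X = ?Y")
proof -
  define g where "g a b y = q.G y $ a $ b" for a b y
  note z' = FS'[OF z]
  have g: "g a b differentiable (at (F z))" for a b
    unfolding g_def by (rule Ck_on_differentiable[OF q.G_nth zero_less_one z'])
  have e: "p.G y $ m $ k = (\<Sum>a\<in>UNIV. \<Sum>b\<in>UNIV. P y $ a $ m * P y $ b $ k * g a b (F y))" if "y \<in> S" for y m k
    unfolding G_law[OF that] g_def by (simp add: matrix_matrix_mult_def transpose_def sum_2 algebra_simps)
  have pG: "pd i (\<lambda>y. p.G y $ m $ k) z = (\<Sum>a\<in>UNIV. \<Sum>b\<in>UNIV.
      (conf (cbasis i * f'' z) $ a $ m * P z $ b $ k + P z $ a $ m * conf (cbasis i * f'' z) $ b $ k) * g a b (F z)
     + P z $ a $ m * P z $ b $ k * (\<Sum>c\<in>UNIV. P z $ c $ i * pd c (g a b) (F z)))" for i m k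
    by (rule pd_pullback[OF z g], rule e)
  have g21: "g 2 1 (F z) = g 1 2 (F z)" "pd c (g 2 1) (F z) = pd c (g 1 2) (F z)" for c
    using z' by (auto simp: g_def q_G_sym intro!: pd_cong[OF q.S])
  have low: "(G z ** Gam G j z) $ m $ k = (pd j (\<lambda>y. G y $ k $ m) z + pd k (\<lambda>y. G y $ j $ m) z - pd m (\<lambda>y. G y $ j $ k) z) / 2"
    if "det (G z) \<noteq> 0" for G :: "complex \<Rightarrow> real^2^2" and j m k z
    using christoffel_lowered[where G = G and z = z and m = m and j = j and k = k, OF that] by (simp add: matrix_matrix_mult_def Gam_def)
  let ?A = "transpose (P z) ** q.G (F z)"
  have "?A ** ?X = p.G z ** Gam p.G j z"
    unfolding G_law[OF z] by (simp add: matrix_mul_assoc)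
  also have "\<dots> = transpose (P z) ** (\<Sum>b\<in>UNIV. P z $ b $ j *\<^sub>R (q.G (F z) ** Gam q.G b (F z))) ** P z
      + transpose (P z) ** q.G (F z) ** conf (cbasis j * f'' z)" (is "?L = ?R")
  proof -
    have "?L $ m $ k = ?R $ m $ k" for m k
    proof -
      have "?R $ m $ k = (\<Sum>a\<in>UNIV. P z $ a $ m * ((\<Sum>b\<in>UNIV. \<Sum>c\<in>UNIV. P z $ b $ j * P z $ c $ k *
           (q.G (F z) ** Gam q.G b (F z)) $ a $ c) + (\<Sum>b\<in>UNIV. g a b (F z) * conf (cbasis j * f'' z) $ b $ k)))"
        by (simp add: matrix_matrix_mult_def transpose_def g_def sum_2 algebra_simps)
      then show ?thesis
        unfolding low[of p.G, OF p.det_G_nz[OF z]] low[of q.G, OF q.det_G_nz[OF z']] pG g_def[symmetric]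
        using exhaust_2[of m] exhaust_2[of k] exhaust_2[of j]
        by (auto simp: sum_2 g21 field_simps)
    qed
    then show ?thesis by (simp add: vec_eq_iff)
  qed
  also have "\<dots> = ?A ** ?Y"
    by (simp add: sum_2 matrix_add_ldistrib matrix_add_rdistrib2 matrix_mul_scaleR_right matrix_mul_scaleR_left matrix_mul_assoc)
  finally have XY: "?A ** ?X = ?A ** ?Y" .
  have "det ?A \<noteq> 0" using \<delta>_pos[OF z] q.det_G_nz[OF z'] by (simp add: det_mul det_transpose det_P)
  from matrix_left_cancel[OF this XY] show ?thesis .
qed

lemma Rie_law:
  assumes z: "z \<in> S"
  shows "P z ** Rie p.G z = \<delta> z *\<^sub>R (Rie q.G (F z) ** P z)"
proof -
  note z' = FS'[OF z]
  define A where "A j y = (\<Sum>b\<in>UNIV. P y $ b $ j *\<^sub>R Gam q.G b (F y))" for j y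
  define \<Gamma> \<Gamma>' where "\<Gamma> = Gam p.G" and "\<Gamma>' = Gam q.G"
  have d: "\<Gamma> j differentiable (at z)" "\<Gamma>' j differentiable (at (F z))" for j
    unfolding \<Gamma>_def \<Gamma>'_def
    by (intro differentiable_Gam Ck_on_differentiable[OF p.christoffel_Ck zero_less_one z] 
        Ck_on_differentiable[OF q.christoffel_Ck zero_less_one z'])+
  note dP = differentiable_bounded_linear[OF bounded_linear_conf holomorphic_pd(1)[OF p.S hol' z]]
  have pP: "pd i P z = conf (cbasis i * f'' z)" for i
    using pd_bounded_linear[OF bounded_linear_conf holomorphic_pd(1)[OF p.S hol' z]] holomorphic_pd(2)[OF p.S hol' z] by simp
  have l: "bounded_linear (\<lambda>\<zeta>. conf (cbasis j * \<zeta>))" for j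
    by (intro bounded_linear_compose[OF bounded_linear_conf] bounded_linear_mult_right)
  note dc = differentiable_bounded_linear[OF l holomorphic_pd(1)[OF p.S hol'' z]]
  have pc: "pd i (\<lambda>y. conf (cbasis j * f'' y)) z = conf (cbasis j * (cbasis i * deriv f'' z))" for i j
    using pd_bounded_linear[OF l holomorphic_pd(1)[OF p.S hol'' z]] holomorphic_pd(2)[OF p.S hol'' z] by simp
  note dT = comp_diff[OF z d(2)]
  have dA1: "(\<lambda>y. P y $ b $ j *\<^sub>R \<Gamma>' b (F y)) differentiable (at z)" for b j
    by (rule differentiable_bounded_bilinear[OF bounded_bilinear_scaleR pd_P(2)[OF z] dT])
  have dA: "A j differentiable (at z)" for j
    unfolding A_def[abs_def] \<Gamma>'_def[symmetric] by (rule differentiable_sum) (use dA1 in auto)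
  have pA: "pd i (A j) z = (\<Sum>b\<in>UNIV. conf (cbasis i * f'' z) $ b $ j *\<^sub>R \<Gamma>' b (F z) +
      P z $ b $ j *\<^sub>R (\<Sum>c\<in>UNIV. P z $ c $ i *\<^sub>R pd c (\<Gamma>' b) (F z)))" for i j
    unfolding A_def[abs_def] \<Gamma>'_def[symmetric] pd_sum[OF dA1] pd_scaleR[OF pd_P(2)[OF z] dT] pd_P(1)[OF z] pd_comp[OF z d(2)] ..
  have rel: "P y ** \<Gamma> j y = A j y ** P y + conf (cbasis j * f'' y)" if "y \<in> S" for y j
    unfolding \<Gamma>_def A_def by (rule Christoffel_law[OF that])
  have E: "conf (cbasis i * f'' z) ** \<Gamma> j z + P z ** pd i (\<Gamma> j) z =
     pd i (A j) z ** P z + A j z ** conf (cbasis i * f'' z) + conf (cbasis j * (cbasis i * deriv f'' z))" for i j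
  proof -
    have "pd i (\<lambda>y. P y ** \<Gamma> j y) z = pd i (\<lambda>y. A j y ** P y + conf (cbasis j * f'' y)) z"
      by (rule pd_cong[OF p.S z]) (rule rel)
    then show ?thesis
      unfolding pd_bounded_bilinear[OF bounded_bilinear_matrix_mult_real dP d(1)]
        pd_add[OF differentiable_bounded_bilinear[OF bounded_bilinear_matrix_mult_real dA dP] dc]
        pd_bounded_bilinear[OF bounded_bilinear_matrix_mult_real dA dP] pP pc .
  qed
  let ?c = "\<lambda>i. conf (cbasis i * f'' z)" and ?P = "P z"
  have sub: "X ** (Y - Z) = X ** Y - X ** Z" "(Y - Z) ** X = Y ** X - Z ** X" for X Y Z :: "real^2^2"
    by (simp_all add: mat2 algebra_simps)
  \<comment> \<open>In E12 and E21 the third derivative of F occurs with the same coefficient, the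
    product of the two basis vectors, so it cancels in the curvature.\<close>
  have E12: "?P ** pd 1 (\<Gamma> 2) z = pd 1 (A 2) z ** ?P + A 2 z ** ?c 1 + conf (\<i> * deriv f'' z) - ?c 1 ** \<Gamma> 2 z"
    using E[of 1 2] by (simp add: algebra_simps)
  have E21: "?P ** pd 2 (\<Gamma> 1) z = pd 2 (A 1) z ** ?P + A 1 z ** ?c 2 + conf (\<i> * deriv f'' z) - ?c 2 ** \<Gamma> 1 z"
    using E[of 2 1] by (simp add: algebra_simps)
  have FF: "?P ** (\<Gamma> i z ** \<Gamma> j z) = A i z ** (A j z ** ?P) + A i z ** ?c j + ?c i ** \<Gamma> j z" for i j
  proof -
    have "?P ** (\<Gamma> i z ** \<Gamma> j z) = A i z ** (?P ** \<Gamma> j z) + ?c i ** \<Gamma> j z"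
      unfolding matrix_mul_assoc rel[OF z, of i] matrix_add_rdistrib2 ..
    then show ?thesis unfolding rel[OF z] matrix_add_ldistrib .
  qed
  have "?P ** Rie p.G z = (pd 1 (A 2) z - pd 2 (A 1) z + A 1 z ** A 2 z - A 2 z ** A 1 z) ** ?P"
    unfolding Rie_def \<Gamma>_def[symmetric]
    by (simp only: sub matrix_add_ldistrib matrix_add_rdistrib2 E12 E21 FF) (simp add: matrix_mul_assoc)
  \<comment> \<open>The terms with \<open>f''\<close> are symmetric in the two directions and
    cancel. What remains is the pull-back of a 2-form, hence the factor det P.\<close>
  also have "pd 1 (A 2) z - pd 2 (A 1) z = \<delta> z *\<^sub>R (pd 1 (\<Gamma>' 2) (F z) - pd 2 (\<Gamma>' 1) (F z))"
    unfolding pA by (simp add: sum_2 \<delta>_def cmod_sq algebra_simps)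
  also have "A 1 z ** A 2 z = (Re (f' z) * - Im (f' z)) *\<^sub>R (\<Gamma>' 1 (F z) ** \<Gamma>' 1 (F z)) + (Re (f' z) * Re (f' z)) *\<^sub>R (\<Gamma>' 1 (F z) ** \<Gamma>' 2 (F z))
     + (Im (f' z) * - Im (f' z)) *\<^sub>R (\<Gamma>' 2 (F z) ** \<Gamma>' 1 (F z)) + (Im (f' z) * Re (f' z)) *\<^sub>R (\<Gamma>' 2 (F z) ** \<Gamma>' 2 (F z))"
    unfolding A_def \<Gamma>'_def[symmetric] by (simp add: sum_2 mat2 algebra_simps)
  also have "A 2 z ** A 1 z = (Re (f' z) * - Im (f' z)) *\<^sub>R (\<Gamma>' 1 (F z) ** \<Gamma>' 1 (F z)) + (Re (f' z) * Re (f' z)) *\<^sub>R (\<Gamma>' 2 (F z) ** \<Gamma>' 1 (F z))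
     + (Im (f' z) * - Im (f' z)) *\<^sub>R (\<Gamma>' 1 (F z) ** \<Gamma>' 2 (F z)) + (Im (f' z) * Re (f' z)) *\<^sub>R (\<Gamma>' 2 (F z) ** \<Gamma>' 2 (F z))"
    unfolding A_def \<Gamma>'_def[symmetric] by (simp add: sum_2 mat2 algebra_simps)
  finally have "?P ** Rie p.G z = (\<delta> z *\<^sub>R Rie q.G (F z)) ** ?P"
    by (rule trans) (rule arg_cong[where f = "\<lambda>X. X ** ?P"], simp add: Rie_def \<Gamma>'_def[symmetric] \<delta>_def cmod_sq algebra_simps)
  then show ?thesis by (simp only: matrix_mul_scaleR_left)
qed

lemma scal_law:
  assumes z: "z \<in> S"
  shows "scal (\<lambda>_. w) (\<lambda>_. J) ch z = scal (\<lambda>_. w') (\<lambda>_. J') ch' (F z)"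
proof -
  note z' = FS'[OF z]
  define Q where "Q = inverse (\<delta> z) *\<^sub>R transpose (P z)"
  note PQ = Pinv[OF z, folded Q_def]
  have PQT: "transpose (P z) ** transpose Q = mat 1" "transpose Q ** transpose (P z) = mat 1"
    by (simp_all only: matrix_transpose_mul[symmetric] PQ transpose_mat)
  have ric: "ricci p.G z = transpose (P z) ** ricci q.G (F z) ** P z"
  proof -
    have "transpose (Rie p.G z) ** transpose (P z) = \<delta> z *\<^sub>R (transpose (P z) ** transpose (Rie q.G (F z)))"
      using arg_cong[OF Rie_law[OF z], of transpose] by (simp add: matrix_transpose_mul transpose_scalar)
    then have "transpose (Rie p.G z) ** (transpose (P z) ** Om ** P z) = \<delta> z *\<^sub>R (transpose (P z) ** (transpose (Rie q.G (F z)) ** Om) ** P z)"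
      by (simp add: matrix_mul_assoc matrix_mul_scaleR_left)
    then have "transpose (Rie p.G z) ** Om = transpose (P z) ** (transpose (Rie q.G (F z)) ** Om) ** P z"
      using \<delta>_pos[OF z] by (simp add: conf_Om \<delta>_def[symmetric] matrix_mul_scaleR_right)
    then show ?thesis
      by (subst (1 2) ricci_eq_Rie; (intro Ck_on_differentiable[OF p.christoffel_Ck zero_less_one z] 
        Ck_on_differentiable[OF q.christoffel_Ck zero_less_one z'])?)
  qed
  have inv: "matrix_inv (p.G z) = Q ** matrix_inv (q.G (F z)) ** transpose Q"
  proof (rule matrix_inv_eqI)
    have "p.G z ** (Q ** matrix_inv (q.G (F z)) ** transpose Q)
      = transpose (P z) ** (q.G (F z) ** (P z ** Q) ** matrix_inv (q.G (F z))) ** transpose Q"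
      unfolding G_law[OF z] by (simp add: matrix_mul_assoc)
    also have "\<dots> = mat 1" by (simp add: PQ PQT matrix_inv_mul(2)[OF q.det_G_nz[OF z']])
    finally show "p.G z ** (Q ** matrix_inv (q.G (F z)) ** transpose Q) = mat 1" .
  qed
  have "matrix_inv (p.G z) ** ricci p.G z = Q ** matrix_inv (q.G (F z)) ** (transpose Q ** transpose (P z)) ** ricci q.G (F z) ** P z"
    unfolding ric inv by (simp add: matrix_mul_assoc)
  also have "\<dots> = Q ** (matrix_inv (q.G (F z)) ** ricci q.G (F z) ** P z)"
    by (simp add: PQT matrix_mul_assoc)
  also have "trace \<dots> = trace (matrix_inv (q.G (F z)) ** ricci q.G (F z) ** P z ** Q)"
    by (rule trace_mul_sym)
  also have "\<dots> = trace (matrix_inv (q.G (F z)) ** ricci q.G (F z))"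
    by (simp add: PQ flip: matrix_mul_assoc)
  finally show ?thesis
    by (simp add: p.scal_local[OF z] q.scal_local[OF z'])
qed

end

section \<open>Change of variables in the complex plane\<close>

text \<open>\<open>has_measure_differentiable_image\<close> speaks of vectors
  \<open>real^'n\<close>, so areas in the complex plane are carried to \<open>real^2\<close> and
  back by this isometry.\<close>

definition to_vec :: "complex \<Rightarrow> real^2" where "to_vec z = vector [Re z, Im z]"
definition of_vec :: "real^2 \<Rightarrow> complex" where "of_vec x = Complex (x $ 1) (x $ 2)"

lemma of_to_vec [simp]: "of_vec (to_vec z) = z" "to_vec (of_vec x) = x"
  by (simp_all add: to_vec_def of_vec_def vec_eq_iff forall_2)

lemma bounded_linear_to_vec: "bounded_linear to_vec" and bounded_linear_of_vec: "bounded_linear of_vec"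
  unfolding linear_conv_bounded_linear[symmetric]
  by (auto intro!: linearI simp: to_vec_def of_vec_def vec_eq_iff forall_2 complex_eq_iff)

lemma continuous_to_vec: "continuous_on S to_vec" and continuous_of_vec: "continuous_on T of_vec"
  using linear_continuous_on[OF bounded_linear_to_vec] linear_continuous_on[OF bounded_linear_of_vec] by auto

lemma borel_to_vec [measurable]: "to_vec \<in> borel_measurable borel" and borel_of_vec [measurable]: "of_vec \<in> borel_measurable borel"
  by (intro borel_measurable_continuous_onI continuous_to_vec continuous_of_vec)+

lemma lborel_to_vec: "distr lborel borel to_vec = lborel"
proof (rule lborel_eqI[symmetric])
  have basis: "(Basis :: (real^2) set) = {axis 1 1, axis 2 1}" 
    by (auto simp: Basis_vec_def) (metis exhaust_2)
  fix l u :: "real^2" assume lu: "\<And>b. b \<in> Basis \<Longrightarrow> l \<bullet> b \<le> u \<bullet> b"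
  have lu': "l $ 1 \<le> u $ 1" "l $ 2 \<le> u $ 2"
    using lu[of "axis 1 1"] lu[of "axis 2 1"] by (simp_all add: inner_axis basis)
  have ax: "axis 1 (1::real) \<noteq> (axis 2 1 :: real^2)" by (simp add: axis_eq_axis)
  have "to_vec -` box l u = box (of_vec l) (of_vec u)"
    by (auto simp: box_def basis inner_axis to_vec_def of_vec_def Basis_complex_def)
  then have "emeasure (distr lborel borel to_vec) (box l u) = emeasure lborel (box (of_vec l) (of_vec u))"
    by (simp add: emeasure_distr)
  also have "\<dots> = (\<Prod>b\<in>Basis. (of_vec u - of_vec l) \<bullet> b)"
    by (rule emeasure_lborel_box) (use lu' in \<open>auto simp: Basis_complex_def of_vec_def\<close>)
  also have "\<dots> = (\<Prod>b\<in>Basis. (u - l) \<bullet> b)"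
    using ax by (simp add: basis inner_axis Basis_complex_def of_vec_def)
  finally show "emeasure (distr lborel borel to_vec) (box l u) = (\<Prod>b\<in>Basis. (u - l) \<bullet> b)" .
qed simp

lemma emeasure_holomorphic_image:
  assumes U: "open U" and hol: "F holomorphic_on U" and inj: "inj_on F U"
    and E: "E \<in> sets borel" "E \<subseteq> U" and FE: "F ` E \<in> sets borel"
  shows "emeasure lborel (F ` E) = (\<integral>\<^sup>+ z. ennreal ((cmod (deriv F z))\<^sup>2) * indicator E z \<partial>lborel)"
proof -
  define f where "f x = to_vec (F (of_vec x))" for x
  define f' where "f' x v = to_vec (deriv F (of_vec x) * of_vec v)" for x v
  define g where "g x = (cmod (deriv F (of_vec x)))\<^sup>2 * indicator (to_vec ` E) x" for x
  have img: "to_vec ` X = of_vec -` X" for X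
    by (auto simp: image_iff) (metis of_to_vec(2))
  have tE: "to_vec ` E \<in> sets borel" "to_vec ` F ` E \<in> sets borel"
    unfolding img using measurable_sets_borel[OF borel_of_vec] E FE by auto
  have der: "(f has_derivative f' x) (at x within to_vec ` E)" if "x \<in> to_vec ` E" for x
  proof -
    have "of_vec x \<in> U" using that E by auto
    then have "(F has_derivative (*) (deriv F (of_vec x))) (at (of_vec x))"
      using hol U holomorphic_derivI by (auto simp: has_field_derivative_def[symmetric])
    from has_derivative_compose[OF bounded_linear.has_derivative[OF bounded_linear_of_vec has_derivative_ident] this]
    have "((\<lambda>x. F (of_vec x)) has_derivative (\<lambda>v. deriv F (of_vec x) * of_vec v)) (at x within to_vec ` E)" by simp
    from bounded_linear.has_derivative[OF bounded_linear_to_vec this] show ?thesis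
      by (simp add: f_def[abs_def] f'_def[abs_def])
  qed
  have det: "\<bar>det (matrix (f' x))\<bar> = (cmod (deriv F (of_vec x)))\<^sup>2" for x
  proof -
    have "det (matrix (f' x)) = Re (deriv F (of_vec x)) * Re (deriv F (of_vec x)) + Im (deriv F (of_vec x)) * Im (deriv F (of_vec x))"
      by (simp add: det_2 matrix_def f'_def to_vec_def of_vec_def axis_def)
    then show ?thesis unfolding cmod_sq[symmetric] by simp
  qed
  have injf: "inj_on f (to_vec ` E)"
    using inj E(2) by (auto simp: inj_on_def f_def) (metis of_to_vec(1) subsetD)
  have fE: "f ` to_vec ` E = to_vec ` F ` E" by (auto simp: f_def image_image)
  have em: "emeasure lborel (to_vec ` F ` E) = emeasure lborel (F ` E)"
    unfolding lborel_to_vec[symmetric]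
    by (subst emeasure_distr) (use tE in \<open>auto simp: img vimage_def\<close>)
  have cont: "continuous_on U (deriv F)"
    by (intro holomorphic_on_imp_continuous_on holomorphic_deriv hol U)
  have meas: "(\<lambda>z. (cmod (deriv F z))\<^sup>2 * indicator E z) \<in> borel_measurable borel"
  proof -
    have "continuous_on E (\<lambda>z. (cmod (deriv F z))\<^sup>2)"
      by (intro continuous_intros continuous_on_subset[OF cont E(2)])
    from borel_measurable_continuous_on_indicator[OF E(1) this] show ?thesis by (simp add: mult.commute)
  qed
  have gE: "g x = (cmod (deriv F (of_vec x)))\<^sup>2 * indicator E (of_vec x)" for x
    by (simp add: g_def img indicator_def)
  have gm: "g \<in> borel_measurable borel"
    unfolding gE[abs_def] using measurable_compose[OF borel_of_vec meas] by simp
  have nn: "(\<integral>\<^sup>+ x. ennreal (g x) \<partial>lborel) = (\<integral>\<^sup>+ z. ennreal ((cmod (deriv F z))\<^sup>2) * indicator E z \<partial>lborel)"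
  proof -
    have "(\<integral>\<^sup>+ x. ennreal (g x) \<partial>lborel) = (\<integral>\<^sup>+ z. ennreal (g (to_vec z)) \<partial>lborel)"
      unfolding lborel_to_vec[symmetric] by (subst nn_integral_distr) (use gm in auto)
    also have "\<dots> = (\<integral>\<^sup>+ z. ennreal ((cmod (deriv F z))\<^sup>2) * indicator E z \<partial>lborel)"
      by (intro nn_integral_cong) (auto simp: gE indicator_def)
    finally show ?thesis .
  qed
  have hi: "((\<lambda>x. \<bar>det (matrix (f' x))\<bar>) has_integral m) (to_vec ` E) \<longleftrightarrow> (\<integral>\<^sup>+ x. ennreal (g x) \<partial>lborel) = ennreal m" if "m \<ge> 0" for m
  proof -
    have "((\<lambda>x. \<bar>det (matrix (f' x))\<bar>) has_integral m) (to_vec ` E) \<longleftrightarrow> (g has_integral m) UNIV"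
      unfolding det g_def has_integral_restrict_UNIV[symmetric, of _ _ "to_vec ` E"]
      by (rule arg_cong[where f = "\<lambda>h. (h has_integral m) UNIV"]) (auto simp: indicator_def)
    also have "\<dots> \<longleftrightarrow> (\<integral>\<^sup>+ x. ennreal (g x) \<partial>lebesgue) = ennreal m"
      using gm that by (subst has_integral_iff_nn_integral_lebesgue) (auto simp: g_def measurable_completion)
    finally show ?thesis by (simp add: nn_integral_completion)
  qed
  note hm = has_measure_differentiable_image[of "to_vec ` E" f f', OF _ der injf, unfolded fE]
  have tEl: "to_vec ` E \<in> sets lebesgue" using tE by (simp add: sets_completionI_sets)
  have tFl: "to_vec ` F ` E \<in> sets lebesgue" using tE by (simp add: sets_completionI_sets)
  show ?thesis
  \<comment> \<open>The change of variables theorem relates finite measures to existing integrals.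
    If the integral is infinite, it shows that the image cannot have finite measure.\<close>
  proof (cases "(\<integral>\<^sup>+ x. ennreal (g x) \<partial>lborel) = \<infinity>")
    case True
    have "to_vec ` F ` E \<notin> lmeasurable"
    proof
      assume "to_vec ` F ` E \<in> lmeasurable"
      then have "((\<lambda>x. \<bar>det (matrix (f' x))\<bar>) has_integral measure lebesgue (to_vec ` F ` E)) (to_vec ` E)"
        using hm[OF tEl] by blast
      then show False using hi[of "measure lebesgue (to_vec ` F ` E)"] True by simp
    qed
    then have "emeasure lebesgue (to_vec ` F ` E) = \<infinity>"
      using tFl by (simp add: fmeasurable_def flip: less_top)
    then show ?thesis using True em nn tE by simp
  next
    case False
    then obtain m where m: "m \<ge> 0" "(\<integral>\<^sup>+ x. ennreal (g x) \<partial>lborel) = ennreal m"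
      by (metis ennreal_cases infinity_ennreal_def)
    then have "to_vec ` F ` E \<in> lmeasurable" "measure lebesgue (to_vec ` F ` E) = m"
      using hm[OF tEl] hi by blast+
    then have "emeasure lebesgue (to_vec ` F ` E) = ennreal m"
      using emeasure_eq_measure2 by metis
    then show ?thesis using m em nn tE by simp
  qed
qed

text \<open>Applied to all Borel parts of E, the area formula says that the push-forward of the
  density |F'|^2 on E is Lebesgue measure restricted to F(E). Integrating \<open>g\<close> against
  these two equal measures gives the claim.\<close>

lemma nn_integral_holomorphic_image:
  assumes U: "open U" and hol: "F holomorphic_on U" and inj: "inj_on F U"
    and meas: "\<And>E. E \<in> sets borel \<Longrightarrow> E \<subseteq> U \<Longrightarrow> F ` E \<in> sets borel"
    and E: "E \<in> sets borel" "E \<subseteq> U" and g: "g \<in> borel_measurable borel"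
  shows "(\<integral>\<^sup>+ y. g y * indicator (F ` E) y \<partial>lborel) =
    (\<integral>\<^sup>+ z. g (F z) * ennreal ((cmod (deriv F z))\<^sup>2) * indicator E z \<partial>lborel)"
proof -
  \<comment> \<open>The extension by 0 is Borel measurable on the whole plane; the density vanishes
    where it differs from F.\<close>
  define F' where "F' z = (if z \<in> U then F z else 0)" for z
  define \<delta> where "\<delta> z = ennreal ((cmod (deriv F z))\<^sup>2) * indicator E z" for z
  have "continuous_on U F" using hol by (rule holomorphic_on_imp_continuous_on)
  then have F' [measurable]: "F' \<in> borel_measurable borel"
    unfolding F'_def using U by (intro borel_measurable_continuous_on_if) auto
  have \<delta>: "\<delta> \<in> borel_measurable borel"
  proof -
    have "continuous_on E (\<lambda>z. (cmod (deriv F z))\<^sup>2)"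
      by (intro continuous_intros continuous_on_subset[OF _ E(2)] holomorphic_on_imp_continuous_on holomorphic_deriv hol U)
    from borel_measurable_continuous_on_indicator[OF E(1) this]
    have "(\<lambda>z. ennreal (indicator E z * (cmod (deriv F z))\<^sup>2)) \<in> borel_measurable borel" by simp
    moreover have "(\<lambda>z. ennreal (indicator E z * (cmod (deriv F z))\<^sup>2)) = \<delta>"
      by (auto simp: \<delta>_def indicator_def)
    ultimately show ?thesis by simp
  qed
  have "distr (density lborel \<delta>) borel F' = density lborel (indicator (F ` E))"
  proof (rule measure_eqI)
    fix X assume "X \<in> sets (distr (density lborel \<delta>) borel F')"
    then have X: "X \<in> sets borel" by simp
    have EX: "E \<inter> F' -` X \<in> sets borel" using E(1) measurable_sets_borel[OF F' X] by blast
    have im: "F ` (E \<inter> F' -` X) = F ` E \<inter> X" using E(2) by (auto simp: F'_def)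
    have "emeasure (distr (density lborel \<delta>) borel F') X = (\<integral>\<^sup>+ z. \<delta> z * indicator (F' -` X) z \<partial>lborel)"
      using X \<delta> measurable_sets_borel[OF F' X] by (simp add: emeasure_distr emeasure_density)
    also have "\<dots> = (\<integral>\<^sup>+ z. ennreal ((cmod (deriv F z))\<^sup>2) * indicator (E \<inter> F' -` X) z \<partial>lborel)"
      by (intro nn_integral_cong) (auto simp: \<delta>_def indicator_def)
    also have "\<dots> = emeasure lborel (F ` (E \<inter> F' -` X))"
      by (rule emeasure_holomorphic_image[OF U hol inj, symmetric]) (use EX E(2) meas in auto)
    also have "\<dots> = emeasure (density lborel (indicator (F ` E))) X"
      using X meas[OF E] by (subst emeasure_density) (auto simp: im indicator_inter_arith[symmetric])
    finally show "emeasure (distr (density lborel \<delta>) borel F') X = emeasure (density lborel (indicator (F ` E))) X" .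
  qed simp
  then have "(\<integral>\<^sup>+ y. g y \<partial>distr (density lborel \<delta>) borel F') = (\<integral>\<^sup>+ y. g y \<partial>density lborel (indicator (F ` E)))" by simp
  moreover have "(\<integral>\<^sup>+ y. g y \<partial>density lborel (indicator (F ` E))) = (\<integral>\<^sup>+ y. g y * indicator (F ` E) y \<partial>lborel)"
    using g meas[OF E] by (subst nn_integral_density) (auto simp: mult.commute)
  moreover have "(\<integral>\<^sup>+ y. g y \<partial>distr (density lborel \<delta>) borel F') = (\<integral>\<^sup>+ z. \<delta> z * g (F' z) \<partial>lborel)"
    using g \<delta> by (subst nn_integral_distr) (auto simp: nn_integral_density)
  moreover have "\<dots> = (\<integral>\<^sup>+ z. g (F z) * ennreal ((cmod (deriv F z))\<^sup>2) * indicator E z \<partial>lborel)"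
    using E(2) by (intro nn_integral_cong) (auto simp: \<delta>_def F'_def indicator_def mult_ac)
  ultimately show ?thesis by simp
qed

section \<open>The area measure of a compact curve\<close>

locale curve =
  fixes \<A> :: "('m::t2_space) chart set" and w :: "'m chart \<Rightarrow> complex \<Rightarrow> real"
  assumes curve: "compact_complex_curve \<A>" and kaehler: "kaehler_form \<A> w"
begin

lemma compact_M: "compact (UNIV :: 'm set)" and cover: "(\<Union>c\<in>\<A>. dom_ch c) = UNIV"
  using curve by (auto simp: compact_complex_curve_def)

lemma chart_exists: "\<exists>c\<in>\<A>. p \<in> dom_ch c"
  using cover by blast

context
  fixes c assumes c: "c \<in> \<A>"
begin

lemma dom_open: "open (dom_ch c)" and ran_open: "open (ran_ch c)"
  and homeo: "homeomorphism (dom_ch c) (ran_ch c) (snd c) (pt c)"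
  using curve c by (auto simp: compact_complex_curve_def)

lemma pt_snd: "p \<in> dom_ch c \<Longrightarrow> pt c (snd c p) = p"
  and snd_pt: "z \<in> ran_ch c \<Longrightarrow> snd c (pt c z) = z"
  and pt_dom: "z \<in> ran_ch c \<Longrightarrow> pt c z \<in> dom_ch c"
  and continuous_snd: "continuous_on (dom_ch c) (snd c)"
  and continuous_pt: "continuous_on (ran_ch c) (pt c)"
  using homeo by (auto simp: homeomorphism_def)

lemma w_Ck: "Ck_on n (ran_ch c) (w c)" and w_pos: "z \<in> ran_ch c \<Longrightarrow> w c z > 0"
  using kaehler c Cinf_on_Ck_on[OF ran_open] by (auto simp: kaehler_form_def)

lemma open_pt_vimage: "open X \<Longrightarrow> open {z \<in> ran_ch c. pt c z \<in> X}"
proof -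
  assume "open X"
  moreover have "{z \<in> ran_ch c. pt c z \<in> X} = ran_ch c \<inter> pt c -` X" by auto
  ultimately show ?thesis using continuous_open_preimage[OF continuous_pt ran_open] by simp
qed

lemma open_snd_vimage: "open X \<Longrightarrow> open {p \<in> dom_ch c. snd c p \<in> X}"
proof -
  assume "open X"
  moreover have "{p \<in> dom_ch c. snd c p \<in> X} = dom_ch c \<inter> snd c -` X" by auto
  ultimately show ?thesis using continuous_open_preimage[OF continuous_snd dom_open] by simp
qed

lemma snd_image: "B \<subseteq> dom_ch c \<Longrightarrow> snd c ` B = {z \<in> ran_ch c. pt c z \<in> B}"
  using pt_snd snd_pt by (auto simp: image_iff)

text \<open>A push-forward takes a total measurable map, so the inverse of the chart is extended by
  a constant; the density \<open>wm\<close> vanishes where the extension is artificial.\<close>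

definition "ptm z = (if z \<in> ran_ch c then pt c z else undefined)"

lemma ptm [measurable]: "ptm \<in> borel_measurable borel"
  unfolding ptm_def by (intro borel_measurable_continuous_on_if continuous_pt continuous_on_const) (simp add: ran_open)

lemma snd_borel:
  assumes "B \<in> sets borel" "B \<subseteq> dom_ch c"
  shows "snd c ` B \<in> sets borel"
proof -
  have "snd c ` B = ran_ch c \<inter> ptm -` B"
    unfolding snd_image[OF assms(2)] by (auto simp: ptm_def)
  then show ?thesis using measurable_sets_borel[OF ptm assms(1)] ran_open by simp
qed

definition "wm z = ennreal (w c z) * indicator (ran_ch c) z"

lemma wm [measurable]: "wm \<in> borel_measurable borel"
proof -
  have "(\<lambda>z. if z \<in> ran_ch c then w c z else 0) \<in> borel_measurable borel"
    by (intro borel_measurable_continuous_on_if Ck_on_continuous[OF w_Ck] continuous_on_const) (simp add: ran_open)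
  then have "(\<lambda>z. ennreal (if z \<in> ran_ch c then w c z else 0)) \<in> borel_measurable borel" by simp
  moreover have "(\<lambda>z. ennreal (if z \<in> ran_ch c then w c z else 0)) = wm"
    by (auto simp: wm_def)
  ultimately show ?thesis by simp
qed

definition "chart_measure = distr (density lborel wm) borel ptm"

lemma sets_chart_measure [simp]: "sets chart_measure = sets borel" "space chart_measure = UNIV"
  by (simp_all add: chart_measure_def)

lemma emeasure_chart_measure:
  assumes "B \<in> sets borel" "B \<subseteq> dom_ch c"
  shows "emeasure chart_measure B = (\<integral>\<^sup>+ z. ennreal (w c z) * indicator (snd c ` B) z \<partial>lborel)"
proof -
  have "emeasure chart_measure B = (\<integral>\<^sup>+ z. wm z * indicator (ptm -` B) z \<partial>lborel)"
    unfolding chart_measure_def using assms measurable_sets_borel[OF ptm assms(1)]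
    by (simp add: emeasure_distr emeasure_density)
  also have "\<dots> = (\<integral>\<^sup>+ z. ennreal (w c z) * indicator (snd c ` B) z \<partial>lborel)"
    by (intro nn_integral_cong) (auto simp: wm_def snd_image[OF assms(2)] ptm_def indicator_def)
  finally show ?thesis .
qed

end

definition "overlap c d = snd c ` (dom_ch c \<inter> dom_ch d)"

lemma overlap_iff: "c \<in> \<A> \<Longrightarrow> z \<in> overlap c d \<longleftrightarrow> z \<in> ran_ch c \<and> pt c z \<in> dom_ch d"
  unfolding overlap_def using snd_image[of c "dom_ch c \<inter> dom_ch d"] pt_dom by blast

context
  fixes c d assumes c: "c \<in> \<A>" and d: "d \<in> \<A>"
begin

lemma overlap_open: "open (overlap c d)"
  using open_pt_vimage[OF c dom_open[OF d]] overlap_iff[OF c] by (metis (no_types, lifting) Collect_cong Collect_mem_eq)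

lemma overlap_sub: "overlap c d \<subseteq> ran_ch c"
  using overlap_iff[OF c] by blast

lemma transition_holomorphic: "transition c d holomorphic_on overlap c d"
  using curve c d by (auto simp: compact_complex_curve_def overlap_def)

lemma transition_inj: "inj_on (transition c d) (overlap c d)"
proof (rule inj_onI)
  fix y z assume *: "y \<in> overlap c d" "z \<in> overlap c d" "transition c d y = transition c d z"
  then have "pt d (snd d (pt c y)) = pt d (snd d (pt c z))" by (simp add: transition_def)
  then have "pt c y = pt c z" using * overlap_iff[OF c] pt_snd[OF d] by metis
  then show "y = z" using * overlap_iff[OF c] snd_pt[OF c] by metis
qed

lemma pt_transition: "z \<in> overlap c d \<Longrightarrow> pt d (transition c d z) = pt c z"
  using overlap_iff[OF c] pt_snd[OF d] by (simp add: transition_def)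

lemma transition_ran: "z \<in> overlap c d \<Longrightarrow> transition c d z \<in> ran_ch d"
  using overlap_iff[OF c] by (simp add: transition_def)

lemma jac_transition: "z \<in> overlap c d \<Longrightarrow> jac (transition c d) z = conf (deriv (transition c d) z)"
  using holomorphic_pd(2)[OF overlap_open transition_holomorphic] by (simp add: vec_eq_iff forall_2 jac_nth)

lemma w_transition:
  assumes "z \<in> overlap c d"
  shows "w c z = w d (transition c d z) * (cmod (deriv (transition c d) z))\<^sup>2"
proof -
  have "w c z = w d (transition c d z) * det (jac (transition c d) z)"
    using kaehler c d assms unfolding kaehler_form_def overlap_def by blast
  then show ?thesis by (simp add: jac_transition[OF assms] det_2 cmod_sq)
qed

lemma snd_transition: "B \<subseteq> dom_ch c \<inter> dom_ch d \<Longrightarrow> transition c d ` snd c ` B = snd d ` B"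
  using pt_snd[OF c] by (force simp: transition_def image_iff)

text \<open>The change of variables by the transition map, whose factor |F'|^2 is exactly the one in
  the transformation law of w.\<close>

lemma chart_measure_overlap:
  assumes B: "B \<in> sets borel" "B \<subseteq> dom_ch c" "B \<subseteq> dom_ch d"
  shows "emeasure (chart_measure c) B = emeasure (chart_measure d) B"
proof -
  have sub: "snd c ` B \<subseteq> overlap c d" using B by (auto simp: overlap_def)
  \<comment> \<open>A Borel set E in the overlap is the image under \<open>snd c\<close> of a Borel
    set B of the curve, and the transition map sends it to the image of B under
    \<open>snd d\<close>.\<close>
  have bor: "transition c d ` E \<in> sets borel" if E: "E \<in> sets borel" "E \<subseteq> overlap c d" for E
  proof -
    define B where "B = {p \<in> dom_ch c. snd c p \<in> E} \<inter> dom_ch d"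
    have sm: "(\<lambda>p. if p \<in> dom_ch c then snd c p else 0) \<in> borel_measurable borel"
      by (intro borel_measurable_continuous_on_if continuous_snd[OF c] continuous_on_const) (simp add: dom_open[OF c])
    have "B = (\<lambda>p. if p \<in> dom_ch c then snd c p else 0) -` E \<inter> (dom_ch c \<inter> dom_ch d)" by (auto simp: B_def)
    then have Bb: "B \<in> sets borel"
      using measurable_sets_borel[OF sm E(1)] dom_open[OF c] dom_open[OF d] by simp
    have "E = snd c ` B"
    proof
      show "E \<subseteq> snd c ` B"
      proof
        fix z assume "z \<in> E"
        then have "z \<in> overlap c d" using E by blast
        then obtain p where "p \<in> dom_ch c" "p \<in> dom_ch d" "z = snd c p" by (auto simp: overlap_def)
        then show "z \<in> snd c ` B" using \<open>z \<in> E\<close> by (auto simp: B_def)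
      qed
    qed (auto simp: B_def)
    then have "transition c d ` E = snd d ` B" using snd_transition[of B] by (auto simp: B_def)
    then show ?thesis using snd_borel[OF d Bb] by (auto simp: B_def)
  qed
  have "emeasure (chart_measure d) B = (\<integral>\<^sup>+ y. wm d y * indicator (snd d ` B) y \<partial>lborel)"
    unfolding emeasure_chart_measure[OF d B(1,3)]
    using B(3) by (intro nn_integral_cong) (auto simp: wm_def[OF d] indicator_def)
  also have "\<dots> = (\<integral>\<^sup>+ z. wm d (transition c d z) * ennreal ((cmod (deriv (transition c d) z))\<^sup>2) * indicator (snd c ` B) z \<partial>lborel)"
    using nn_integral_holomorphic_image[OF overlap_open transition_holomorphic transition_inj bor snd_borel[OF c B(1,2)] sub wm[OF d]]
      snd_transition[of B] B by simp
  also have "\<dots> = (\<integral>\<^sup>+ z. ennreal (w c z) * indicator (snd c ` B) z \<partial>lborel)"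
  proof (intro nn_integral_cong)
    fix z
    show "wm d (transition c d z) * ennreal ((cmod (deriv (transition c d) z))\<^sup>2) * indicator (snd c ` B) z
      = ennreal (w c z) * indicator (snd c ` B) z"
    proof (cases "z \<in> snd c ` B")
      case True
      then have z: "z \<in> overlap c d" using sub by blast
      show ?thesis
        using True transition_ran[OF z] w_pos[OF d transition_ran[OF z]]
        by (simp add: wm_def[OF d] w_transition[OF z] ennreal_mult)
    qed simp
  qed
  finally show ?thesis by (simp add: emeasure_chart_measure[OF c B(1,2)])
qed

end

section \<open>Existence and uniqueness of the area measure\<close>

definition is_area_measure :: "'m measure \<Rightarrow> bool" where
  "is_area_measure \<mu> \<longleftrightarrow> sets \<mu> = sets borel \<and>
     (\<forall>c\<in>\<A>. \<forall>B\<in>sets borel. B \<subseteq> dom_ch c \<longrightarrow>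
        emeasure \<mu> B = (\<integral>\<^sup>+ z. ennreal (w c z) * indicator (snd c ` B) z \<partial>lborel))"

lemma finite_chart_cover: "\<exists>(n::nat) e. (\<forall>i<n. e i \<in> \<A>) \<and> (\<Union>i<n. dom_ch (e i)) = (UNIV :: 'm set)"
proof -
  have "\<exists>C\<subseteq>\<A>. finite C \<and> UNIV \<subseteq> (\<Union>c\<in>C. dom_ch c)"
    using compactE_image[OF compact_M, of \<A> dom_ch] dom_open cover by (metis order_refl)
  then obtain C where C: "C \<subseteq> \<A>" "finite C" "UNIV \<subseteq> (\<Union>c\<in>C. dom_ch c)" by blast
  obtain n e where "C = e ` {i::nat. i < n}" using finite_imp_nat_seg_image_inj_on[OF C(2)] by blast
  then show ?thesis using C by (intro exI[of _ n] exI[of _ e]) (auto simp: lessThan_def)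
qed

text \<open>By compactness the curve is a finite disjoint union of Borel pieces P i, each inside one
  chart, and a measure is determined by its restrictions to them. The sum of the chart measures on
  the pieces satisfies the condition in every chart because chart measures agree on
  overlaps.\<close>

lemma area_measure_unique_exists: "\<exists>!\<mu>. is_area_measure \<mu>"
proof -
  obtain n :: nat and e where e: "\<And>i. i < n \<Longrightarrow> e i \<in> \<A>" "(\<Union>i<n. dom_ch (e i)) = (UNIV :: 'm set)"
    using finite_chart_cover by blast
  define P where "P i = dom_ch (e i) - (\<Union>j<i. dom_ch (e j))" for i
  have Pd: "P i \<subseteq> dom_ch (e i)" for i by (auto simp: P_def)
  have Pb: "P i \<in> sets borel" if "i < n" for i
    unfolding P_def using that e(1) dom_open by (intro sets.Diff borel_open open_UN) auto
  have Pdis: "disjoint_family_on P {..<n}"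
    unfolding disjoint_family_on_def P_def by (auto simp: neq_iff)
  have Pcov: "(\<Union>i<n. P i) = UNIV"
  proof -
    have "\<exists>i<n. p \<in> P i" for p
    proof -
      have ex: "\<exists>i. i < n \<and> p \<in> dom_ch (e i)" using e(2) by blast
      define i where "i = (LEAST i. i < n \<and> p \<in> dom_ch (e i))"
      have i: "i < n" "p \<in> dom_ch (e i)" using LeastI_ex[OF ex] by (auto simp: i_def)
      have "p \<notin> dom_ch (e j)" if "j < i" for j
        using not_less_Least[of j "\<lambda>i. i < n \<and> p \<in> dom_ch (e i)"] that i by (auto simp: i_def)
      then show ?thesis using i by (auto simp: P_def)
    qed
    then show ?thesis by blast
  qed
  define m where "m B = (\<Sum>i<n. emeasure (chart_measure (e i)) (B \<inter> P i))" for B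
  define \<mu> where "\<mu> = measure_of UNIV (sets borel) m"
  have s\<mu>: "sets \<mu> = sets borel" unfolding \<mu>_def using sets.sigma_sets_eq[of borel] by simp
  have em: "emeasure \<mu> B = m B" if "B \<in> sets borel" for B
  proof (rule emeasure_measure_of[OF \<mu>_def])
    show "countably_additive (sets \<mu>) m"
      unfolding countably_additive_def s\<mu>
    proof safe
      fix F :: "nat \<Rightarrow> 'm set" assume F: "range F \<subseteq> sets borel" "disjoint_family F"
      have "(\<Sum>j. m (F j)) = (\<Sum>i<n. \<Sum>j. emeasure (chart_measure (e i)) (F j \<inter> P i))"
        unfolding m_def by (rule suminf_sum) simp
      also have "\<dots> = (\<Sum>i<n. emeasure (chart_measure (e i)) (\<Union>j. F j \<inter> P i))"
      proof (rule sum.cong[OF refl])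
        fix i assume i: "i \<in> {..<n}"
        show "(\<Sum>j. emeasure (chart_measure (e i)) (F j \<inter> P i)) = emeasure (chart_measure (e i)) (\<Union>j. F j \<inter> P i)"
          by (rule suminf_emeasure) (use F Pb i e(1) in \<open>auto simp: disjoint_family_on_def\<close>)
      qed
      also have "\<dots> = m (\<Union> (range F))" unfolding m_def by (intro sum.cong refl) (auto intro!: arg_cong2[where f = emeasure])
      finally show "(\<Sum>j. m (F j)) = m (\<Union> (range F))" .
    qed
  qed (use that s\<mu> in \<open>auto simp: positive_def m_def\<close>)
  have "is_area_measure \<mu>"
    unfolding is_area_measure_def
  proof (intro conjI s\<mu> ballI impI)
    fix c B assume c: "c \<in> \<A>" and B: "B \<in> sets borel" "B \<subseteq> dom_ch c"
    have "emeasure \<mu> B = (\<Sum>i<n. emeasure (chart_measure c) (B \<inter> P i))"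
      unfolding em[OF B(1)] m_def
      by (intro sum.cong refl chart_measure_overlap) (use B Pd Pb e(1) c in auto)
    also have "\<dots> = emeasure (chart_measure c) B"
      by (rule sum_emeasure_cover[symmetric]) (use B Pb Pdis Pcov c in auto)
    finally show "emeasure \<mu> B = (\<integral>\<^sup>+ z. ennreal (w c z) * indicator (snd c ` B) z \<partial>lborel)"
      by (simp add: emeasure_chart_measure[OF c B])
  qed
  moreover have "\<nu> = \<mu>" if "is_area_measure \<nu>" for \<nu>
  proof (rule measure_eqI)
    show "sets \<nu> = sets \<mu>" using that by (simp add: is_area_measure_def s\<mu>)
    fix B assume "B \<in> sets \<nu>"
    then have B: "B \<in> sets borel" using that by (simp add: is_area_measure_def)
    have "emeasure \<nu> B = (\<Sum>i<n. emeasure \<nu> (B \<inter> P i))"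
      by (rule sum_emeasure_cover) (use B Pb Pdis Pcov that in \<open>auto simp: is_area_measure_def\<close>)
    also have "\<dots> = (\<Sum>i<n. emeasure (chart_measure (e i)) (B \<inter> P i))"
    proof (intro sum.cong refl)
      fix i assume i: "i \<in> {..<n}"
      have *: "B \<inter> P i \<in> sets borel" "B \<inter> P i \<subseteq> dom_ch (e i)" "e i \<in> \<A>" using B Pb Pd i e(1) by auto
      show "emeasure \<nu> (B \<inter> P i) = emeasure (chart_measure (e i)) (B \<inter> P i)"
        using that * unfolding is_area_measure_def by (simp add: emeasure_chart_measure)
    qed
    finally show "emeasure \<nu> B = emeasure \<mu> B" by (simp add: em[OF B] m_def)
  qed
  ultimately show ?thesis by blast
qed

section \<open>Integration with respect to the area measure\<close>

definition "\<mu> = area_measure \<A> w"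

lemma \<mu>: "is_area_measure \<mu>"
  using theI'[OF area_measure_unique_exists] by (simp add: \<mu>_def area_measure_def is_area_measure_def)

lemma sets_\<mu> [simp, measurable_cong]: "sets \<mu> = sets borel"
  using \<mu> by (simp add: is_area_measure_def)

lemma space_\<mu> [simp]: "space \<mu> = UNIV"
  using sets_eq_imp_space_eq[OF sets_\<mu>] by simp

lemma borel_\<mu>: "f \<in> borel_measurable borel \<Longrightarrow> f \<in> borel_measurable \<mu>"
  by simp

text \<open>Reduces the integral of a function supported in one chart to an integral in the plane.
  The chart measure has no mass outside the chart, so Borel sets that leave the chart cause no
  discrepancy.\<close>

lemma density_\<mu>:
  assumes c: "c \<in> \<A>"
  shows "density \<mu> (indicator (dom_ch c)) = chart_measure c"
proof (rule measure_eqI)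
  fix B assume "B \<in> sets (density \<mu> (indicator (dom_ch c)))"
  then have B: "B \<in> sets borel" by simp
  have D: "dom_ch c \<in> sets borel" using dom_open[OF c] by simp
  have "emeasure (density \<mu> (indicator (dom_ch c))) B = emeasure \<mu> (dom_ch c \<inter> B)"
    using B D by (subst emeasure_density) (auto simp: indicator_inter_arith[symmetric])
  also have "\<dots> = emeasure (chart_measure c) (dom_ch c \<inter> B)"
    using \<mu> c B D emeasure_chart_measure[OF c, of "dom_ch c \<inter> B"] by (simp add: is_area_measure_def)
  also have "\<dots> = emeasure (chart_measure c) B"
  proof -
    have "emeasure (chart_measure c) (B - dom_ch c) = 0"
    proof -
      have "emeasure (chart_measure c) (B - dom_ch c) = (\<integral>\<^sup>+ z. wm c z * indicator (ptm c -` (B - dom_ch c)) z \<partial>lborel)"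
        unfolding chart_measure_def[OF c] using B D measurable_sets_borel[OF ptm[OF c], of "B - dom_ch c"] wm[OF c] ptm[OF c]
        by (simp add: emeasure_distr emeasure_density)
      also have "\<dots> = (\<integral>\<^sup>+ (z::complex). 0 \<partial>lborel)"
        by (intro nn_integral_cong) (use pt_dom[OF c] in \<open>auto simp: wm_def[OF c] ptm_def[OF c] indicator_def\<close>)
      finally show ?thesis by simp
    qed
    moreover have "emeasure (chart_measure c) B = emeasure (chart_measure c) (dom_ch c \<inter> B) + emeasure (chart_measure c) (B - dom_ch c)"
      using B D c by (subst plus_emeasure) (auto intro!: arg_cong2[where f = emeasure])
    ultimately show ?thesis by simp
  qed
  finally show "emeasure (density \<mu> (indicator (dom_ch c))) B = emeasure (chart_measure c) B" .
qed (simp add: c)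

lemma integral_chart:
  fixes f :: "'m \<Rightarrow> real"
  assumes c: "c \<in> \<A>" and f: "f \<in> borel_measurable borel" and z: "\<And>p. p \<notin> dom_ch c \<Longrightarrow> f p = 0"
  shows "(\<integral>p. f p \<partial>\<mu>) = (\<integral>z. (if z \<in> ran_ch c then w c z * f (pt c z) else 0) \<partial>lborel)"
proof -
  have D: "dom_ch c \<in> sets borel" using dom_open[OF c] by simp
  have "(\<integral>p. f p \<partial>\<mu>) = (\<integral>p. indicator (dom_ch c) p *\<^sub>R f p \<partial>\<mu>)"
    by (intro Bochner_Integration.integral_cong refl) (use z in \<open>auto simp: indicator_def\<close>)
  also have "\<dots> = (\<integral>p. f p \<partial>density \<mu> (\<lambda>p. ennreal (indicator (dom_ch c) p)))"
    by (subst integral_density) (use f D in auto)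
  also have "(\<lambda>p. ennreal (indicator (dom_ch c) p)) = indicator (dom_ch c)"
    by (auto simp: indicator_def)
  also have "(\<integral>p. f p \<partial>density \<mu> (indicator (dom_ch c))) = (\<integral>z. f (ptm c z) \<partial>density lborel (wm c))"
    unfolding density_\<mu>[OF c] chart_measure_def[OF c]
    by (rule integral_distr) (use f ptm[OF c] in auto)
  also have "wm c = (\<lambda>z. ennreal (if z \<in> ran_ch c then w c z else 0))"
    by (auto simp: wm_def[OF c])
  also have "(\<integral>z. f (ptm c z) \<partial>density lborel (\<lambda>z. ennreal (if z \<in> ran_ch c then w c z else 0)))
     = (\<integral>z. (if z \<in> ran_ch c then w c z else 0) *\<^sub>R f (ptm c z) \<partial>lborel)"
  proof (rule integral_density)
    show "(\<lambda>z. f (ptm c z)) \<in> borel_measurable lborel" using measurable_compose[OF ptm[OF c] f] by simp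
    show "(\<lambda>z. if z \<in> ran_ch c then w c z else 0) \<in> borel_measurable lborel"
      using borel_measurable_continuous_on_if[of "ran_ch c" "w c" "\<lambda>_. 0"] Ck_on_continuous[OF w_Ck[OF c]] ran_open[OF c] by simp
    show "AE z in lborel. 0 \<le> (if z \<in> ran_ch c then w c z else 0)"
      using w_pos[OF c] by (intro AE_I2) (simp add: less_imp_le)
  qed
  also have "\<dots> = (\<integral>z. (if z \<in> ran_ch c then w c z * f (pt c z) else 0) \<partial>lborel)"
    by (intro Bochner_Integration.integral_cong refl) (auto simp: ptm_def[OF c])
  finally show ?thesis .
qed

text \<open>The density w may be unbounded on a chart, so the finite cover consists of coordinate
  discs whose closures lie in the range of a chart.\<close>

lemma finite_measure_\<mu>: "finite_measure \<mu>"
proof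
  have "\<exists>U. open U \<and> p \<in> U \<and> emeasure \<mu> U < \<infinity>" for p
  proof -
    obtain c where c: "c \<in> \<A>" "p \<in> dom_ch c" using chart_exists by blast
    obtain r where r: "r > 0" "cball (snd c p) r \<subseteq> ran_ch c"
      using open_contains_cball ran_open[OF c(1)] c(2) by (metis imageI)
    define U where "U = {q \<in> dom_ch c. snd c q \<in> ball (snd c p) r}"
    have U: "open U" "p \<in> U" "U \<subseteq> dom_ch c"
      unfolding U_def using open_snd_vimage[OF c(1) open_ball] c(2) r(1) by auto
    have "bounded (w c ` cball (snd c p) r)"
      by (intro compact_imp_bounded compact_continuous_image continuous_on_subset[OF Ck_on_continuous[OF w_Ck[OF c(1)]] r(2)]) simp
    then obtain B where B: "\<And>z. z \<in> cball (snd c p) r \<Longrightarrow> w c z \<le> B"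
      unfolding bounded_iff by (metis imageI abs_le_D1 real_norm_def)
    have "emeasure \<mu> U = (\<integral>\<^sup>+ z. ennreal (w c z) * indicator (snd c ` U) z \<partial>lborel)"
      using \<mu> c U by (simp add: is_area_measure_def)
    also have "\<dots> \<le> (\<integral>\<^sup>+ z. ennreal B * indicator (cball (snd c p) r) z \<partial>lborel)"
      by (intro nn_integral_mono) (use B in \<open>auto simp: U_def indicator_def intro!: ennreal_leI\<close>)
    also have "\<dots> = ennreal B * emeasure lborel (cball (snd c p) r)"
      by (simp add: nn_integral_cmult_indicator)
    also have "\<dots> < \<infinity>"
      using emeasure_bounded_finite[of "cball (snd c p) r"] by (simp add: ennreal_mult_less_top)
    finally show ?thesis using U by blast
  qed
  then obtain U where U: "\<And>p. open (U p)" "\<And>p. p \<in> U p" "\<And>p. emeasure \<mu> (U p) < \<infinity>" by metis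
  obtain I where I: "finite I" "UNIV \<subseteq> (\<Union>p\<in>I. U p)"
    using compactE_image[OF compact_M, of UNIV U] U by (metis UNIV_I UN_I subsetI)
  have "emeasure \<mu> UNIV \<le> emeasure \<mu> (\<Union>p\<in>I. U p)"
    using I U by (intro emeasure_mono) auto
  also have "\<dots> \<le> (\<Sum>p\<in>I. emeasure \<mu> (U p))"
    using I U by (intro emeasure_subadditive_finite) auto
  also have "\<dots> < \<infinity>" using I U by simp
  finally show "emeasure \<mu> (space \<mu>) \<noteq> \<infinity>" by simp
qed

lemma integrable_continuous:
  fixes f :: "'m \<Rightarrow> real"
  assumes "continuous_on UNIV f"
  shows "integrable \<mu> f"
proof -
  interpret finite_measure \<mu> by (rule finite_measure_\<mu>)
  obtain B where "\<And>p. norm (f p) \<le> B"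
    using compact_imp_bounded[OF compact_continuous_image[OF assms compact_M]] unfolding bounded_iff by auto
  then show ?thesis
    using assms by (intro integrable_const_bound[of _ B] borel_\<mu> borel_measurable_continuous_onI) auto
qed

section \<open>Scalar functions given by invariant coordinate expressions\<close>

definition invariant :: "('m chart \<Rightarrow> complex \<Rightarrow> 'b) \<Rightarrow> bool" where
  "invariant T \<longleftrightarrow> (\<forall>c\<in>\<A>. \<forall>d\<in>\<A>. \<forall>z\<in>overlap c d. T c z = T d (transition c d z))"

lemma chart_at: "chart_at \<A> p \<in> \<A>" "p \<in> dom_ch (chart_at \<A> p)"
proof -
  have "\<exists>c. c \<in> \<A> \<and> p \<in> dom_ch c" using chart_exists by blast
  from someI_ex[OF this] show "chart_at \<A> p \<in> \<A>" "p \<in> dom_ch (chart_at \<A> p)"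
    unfolding chart_at_def by blast+
qed

lemma globally_eq:
  assumes T: "invariant T" and c: "c \<in> \<A>" and z: "z \<in> ran_ch c"
  shows "globally \<A> T (pt c z) = T c z"
proof -
  define d where "d = chart_at \<A> (pt c z)"
  have d: "d \<in> \<A>" "pt c z \<in> dom_ch d" using chart_at by (auto simp: d_def)
  then have "z \<in> overlap c d" using overlap_iff[OF c] z by blast
  then have "T c z = T d (transition c d z)" using T c d unfolding invariant_def by blast
  then show ?thesis by (simp add: globally_def d_def[symmetric] transition_def)
qed

lemma globally_cong:
  assumes "\<And>c z. c \<in> \<A> \<Longrightarrow> z \<in> ran_ch c \<Longrightarrow> T c z = T' c z"
  shows "globally \<A> T = globally \<A> T'"
  unfolding globally_def using assms chart_at by (intro ext) blast

lemma globally_continuous: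
  fixes T :: "'m chart \<Rightarrow> complex \<Rightarrow> real"
  assumes T: "invariant T" and "\<And>c. c \<in> \<A> \<Longrightarrow> continuous_on (ran_ch c) (T c)"
  shows "continuous_on UNIV (globally \<A> T)"
proof -
  have "continuous_on (dom_ch c) (globally \<A> T)" if c: "c \<in> \<A>" for c
  proof -
    have "continuous_on (dom_ch c) (\<lambda>p. T c (snd c p))"
      by (intro continuous_on_compose2[OF assms(2)[OF c] continuous_snd[OF c]]) auto
    moreover have "globally \<A> T p = T c (snd c p)" if "p \<in> dom_ch c" for p
      using globally_eq[OF T c, of "snd c p"] that pt_snd[OF c] by simp
    ultimately show ?thesis by (simp cong: continuous_on_cong)
  qed
  then have "continuous_on (\<Union>c\<in>\<A>. dom_ch c) (globally \<A> T)"
    using dom_open by (intro continuous_on_open_UN) auto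
  then show ?thesis by (simp add: cover)
qed

end

section \<open>The divergence theorem\<close>

lemma norm_cbasis [simp]: "cmod (cbasis k) = 1"
  by (simp add: cbasis_def)

lemma has_real_derivative_line:
  fixes g :: "complex \<Rightarrow> real"
  assumes "g differentiable (at (z + t *\<^sub>R cbasis k))"
  shows "((\<lambda>t. g (z + t *\<^sub>R cbasis k)) has_real_derivative pd k g (z + t *\<^sub>R cbasis k)) (at t)"
proof -
  let ?L = "frechet_derivative g (at (z + t *\<^sub>R cbasis k))"
  have g: "(g has_derivative ?L) (at (z + t *\<^sub>R cbasis k))" using assms frechet_derivative_works by blast
  have "((\<lambda>t. z + t *\<^sub>R cbasis k) has_derivative (\<lambda>t. t *\<^sub>R cbasis k)) (at t)"
    by (auto intro!: derivative_eq_intros)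
  from has_derivative_compose[OF this g]
  have "((\<lambda>t. g (z + t *\<^sub>R cbasis k)) has_derivative (\<lambda>s. ?L (s *\<^sub>R cbasis k))) (at t)" .
  moreover have "?L (s *\<^sub>R cbasis k) = pd k g (z + t *\<^sub>R cbasis k) * s" for s
    using linear_scale[OF has_derivative_linear[OF g]] by (simp add: pd_def)
  ultimately show ?thesis by (simp add: has_field_derivative_def)
qed

text \<open>Difference quotients have integral zero by translation invariance of the Lebesgue measure.\<close>

lemma integral_pd_compact_support:
  fixes g :: "complex \<Rightarrow> real"
  assumes g: "Ck_on 1 UNIV g" and K: "compact K" and g0: "\<And>z. z \<notin> K \<Longrightarrow> g z = 0"
  shows "integrable lborel (pd k g)" "(\<integral>z. pd k g z \<partial>lborel) = 0"
proof -
  obtain R where R: "K \<subseteq> cball 0 R" using compact_imp_bounded[OF K] by (metis bounded_iff mem_cball_0 subsetI)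
  have gd: "g differentiable (at z)" for z using Ck_on_differentiable[OF g zero_less_one] by simp
  have gc: "continuous_on UNIV g" by (rule Ck_on_continuous[OF g])
  have pc: "continuous_on UNIV (pd k g)" using g by simp
  have p0: "pd k g z = 0" if "z \<notin> K" for z
    using pd_cong[of "- K" z g "\<lambda>_. 0" k] K that g0 by (simp add: compact_imp_closed open_Compl)
  obtain B where B0: "\<And>z. z \<in> K \<Longrightarrow> norm (pd k g z) \<le> B"
    using compact_imp_bounded[OF compact_continuous_image[OF continuous_on_subset[OF pc] K]] unfolding bounded_iff by auto
  define C where "C = max B 0"
  have C: "\<bar>pd k g z\<bar> \<le> C" "C \<ge> 0" for z
    using B0[of z] p0[of z] by (cases "z \<in> K"; auto simp: C_def)+
  \<comment> \<open>The dominating function; the radius is enlarged by 1 because the difference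
    quotients shift the support by \<open>h n\<close>, which is at most 1.\<close>
  define W where "W z = C * indicator (cball 0 (R + 1)) z" for z :: complex
  have W: "integrable lborel W"
    unfolding W_def by (intro integrable_mult_right integrable_real_indicator emeasure_bounded_finite) auto
  have gint: "integrable lborel g"
  proof -
    have "(\<lambda>z. indicator K z *\<^sub>R g z) = g" using g0 by (auto simp: indicator_def fun_eq_iff)
    then show ?thesis using borel_integrable_compact[OF K continuous_on_subset[OF gc]] by simp
  qed
  define h where "h n = inverse (real (Suc n))" for n
  have h: "h n > 0" "h n \<le> 1" for n by (simp_all add: h_def field_simps)
  define s where "s n z = (g (z + h n *\<^sub>R cbasis k) - g z) / h n" for n z
  have tr: "(\<integral>z. g (z + a) \<partial>lborel) = (\<integral>z. g z \<partial>lborel)" "integrable lborel (\<lambda>z. g (z + a))" for a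
  proof -
    have m: "(\<lambda>z. a + z) \<in> borel_measurable lborel" by simp
    have gm: "g \<in> borel_measurable borel" by (rule borel_measurable_continuous_onI[OF gc])
    have "(\<integral>z. g z \<partial>lborel) = (\<integral>z. g z \<partial>distr lborel borel ((+) a))" by (simp add: lborel_distr_plus)
    also have "\<dots> = (\<integral>z. g (a + z) \<partial>lborel)" by (rule integral_distr) (use gm in auto)
    finally show "(\<integral>z. g (z + a) \<partial>lborel) = (\<integral>z. g z \<partial>lborel)" by (simp add: add.commute)
    have "integrable (distr lborel borel ((+) a)) g" using gint by (simp add: lborel_distr_plus)
    then show "integrable lborel (\<lambda>z. g (z + a))"
      using gm by (subst (asm) integrable_distr_eq) (auto simp: add.commute)
  qed
  have s0: "(\<integral>z. s n z \<partial>lborel) = 0" for n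
    unfolding s_def using tr gint by simp
  have lim: "(\<lambda>n. s n z) \<longlonglongrightarrow> pd k g z" for z
  proof -
    have "((\<lambda>t. g (z + t *\<^sub>R cbasis k)) has_real_derivative pd k g z) (at 0)"
      using has_real_derivative_line[of g z 0 k] gd by simp
    then have *: "((\<lambda>t. (g (z + (0 + t) *\<^sub>R cbasis k) - g (z + 0 *\<^sub>R cbasis k)) / t) \<longlongrightarrow> pd k g z) (at 0)"
      by (rule DERIV_D)
    have "filterlim h (at 0) sequentially"
    proof -
      have "h \<longlonglongrightarrow> 0" unfolding h_def[abs_def] by (rule LIMSEQ_inverse_real_of_nat)
      moreover have "h n \<noteq> 0" for n using h(1)[of n] by simp
      ultimately show ?thesis unfolding filterlim_at by simp
    qed
    from filterlim_compose[OF * this] show ?thesis by (simp add: s_def)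
  qed
  \<comment> \<open>On the large disc the mean value theorem bounds the quotient by the maximum of
    the derivative; outside, both values of g are zero.\<close>
  have bd: "norm (s n z) \<le> W z" for n z
  proof (cases "z \<in> cball 0 (R + 1)")
    case True
    have "\<exists>t>0. t < h n \<and> g (z + h n *\<^sub>R cbasis k) - g (z + 0 *\<^sub>R cbasis k) = (h n - 0) * pd k g (z + t *\<^sub>R cbasis k)"
      by (rule MVT2[OF h(1)]) (rule has_real_derivative_line[OF gd])
    then obtain t where "g (z + h n *\<^sub>R cbasis k) - g z = h n * pd k g (z + t *\<^sub>R cbasis k)" by auto
    then have "s n z = pd k g (z + t *\<^sub>R cbasis k)" using h(1)[of n] by (simp add: s_def)
    then show ?thesis using C True by (simp add: W_def)
  next
    case False
    have "cmod z \<le> cmod (z + h n *\<^sub>R cbasis k) + cmod (h n *\<^sub>R cbasis k)"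
      using norm_triangle_ineq4[of "z + h n *\<^sub>R cbasis k" "h n *\<^sub>R cbasis k"] by simp
    also have "cmod (h n *\<^sub>R cbasis k) \<le> 1" using h[of n] by simp
    finally have "z + h n *\<^sub>R cbasis k \<notin> K" "z \<notin> K" using False R by (auto simp: subset_iff) 
    then show ?thesis using g0 C(2) by (simp add: s_def W_def)
  qed
  have sm: "s n \<in> borel_measurable lborel" for n
  proof -
    have "continuous_on UNIV (s n)"
      unfolding s_def[abs_def] using h(1)[of n] by (intro continuous_intros continuous_on_compose2[OF gc]) auto
    then show ?thesis using borel_measurable_continuous_onI by simp
  qed
  have pm: "pd k g \<in> borel_measurable lborel" using borel_measurable_continuous_onI[OF pc] by simp
  show "integrable lborel (pd k g)"
    by (rule integrable_dominated_convergence[where s = s, OF pm sm W]) (use lim bd in auto)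
  have "(\<lambda>n. \<integral>z. s n z \<partial>lborel) \<longlonglongrightarrow> (\<integral>z. pd k g z \<partial>lborel)"
    by (rule integral_dominated_convergence[where s = s, OF pm sm W]) (use lim bd in auto)
  then show "(\<integral>z. pd k g z \<partial>lborel) = 0"
    unfolding s0 using LIMSEQ_unique tendsto_const by metis
qed

text \<open>Squaring smooths the corner of max 0 t: the result is continuously differentiable, which
  is the regularity that the bump functions are given.\<close>

lemma DERIV_max_0_sq: "((\<lambda>t::real. (max 0 t)\<^sup>2) has_real_derivative 2 * max 0 t) (at t)"
proof (rule linorder_cases[of t 0])
  assume t: "t < 0"
  have "((\<lambda>t::real. 0) has_real_derivative 0) (at t)" by simp
  moreover have "\<forall>\<^sub>F x in nhds t. (max 0 x)\<^sup>2 = 0"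
    using eventually_nhds_in_open[of "{..<0}" t] t by (auto elim!: eventually_mono)
  ultimately show ?thesis using t DERIV_cong_ev[of t t "\<lambda>x. (max 0 x)\<^sup>2" "\<lambda>_. 0"] by simp
next
  assume t: "t = 0"
  have "(\<lambda>h. ((max 0 (0 + h))\<^sup>2 - (max 0 0)\<^sup>2) / h) \<midarrow>0\<rightarrow> (0::real)"
  proof (rule Lim_null_comparison)
    show "\<forall>\<^sub>F h in at 0. norm (((max 0 (0 + h))\<^sup>2 - (max 0 0)\<^sup>2) / h) \<le> \<bar>h::real\<bar>"
      by (intro always_eventually) (auto simp: max_def power2_eq_square)
    show "(\<lambda>h::real. \<bar>h\<bar>) \<midarrow>0\<rightarrow> 0" by (intro tendsto_rabs_zero tendsto_ident_at)
  qed
  then show ?thesis unfolding t DERIV_def by simp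
next
  assume t: "t > 0"
  have "((\<lambda>t::real. t\<^sup>2) has_real_derivative 2 * t) (at t)" by (auto intro!: derivative_eq_intros)
  moreover have "\<forall>\<^sub>F x in nhds t. (max 0 x)\<^sup>2 = x\<^sup>2"
    using eventually_nhds_in_open[of "{0<..}" t] t by (auto elim!: eventually_mono)
  ultimately show ?thesis using t DERIV_cong_ev[of t t "\<lambda>x. (max 0 x)\<^sup>2" "\<lambda>x. x\<^sup>2"] by simp
qed

lemma Ck_on_max_0_sq:
  fixes u :: "complex \<Rightarrow> real"
  assumes S: "open S" and u: "Ck_on 1 S u"
  shows "Ck_on 1 S (\<lambda>z. (max 0 (u z))\<^sup>2)"
proof -
  have d: "u differentiable (at z)" if "z \<in> S" for z using Ck_on_differentiable[OF u zero_less_one that] .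
  have "continuous_on S (\<lambda>z. 2 * max 0 (u z) * pd k u z)" for k
    using u Ck_on_continuous[OF u] by (intro continuous_intros) auto
  then have "continuous_on S (pd k (\<lambda>z. (max 0 (u z))\<^sup>2))" for k
    using pd_real_comp[OF d DERIV_max_0_sq] by (simp cong: continuous_on_cong)
  then show ?thesis using differentiable_real_comp[OF d DERIV_max_0_sq] by simp
qed

section \<open>Partitions of unity of class C^1\<close>

context curve
begin

definition C1fun :: "('m \<Rightarrow> real) \<Rightarrow> bool" where
  "C1fun f \<longleftrightarrow> (\<forall>d\<in>\<A>. Ck_on 1 (ran_ch d) (\<lambda>z. f (pt d z)))"

text \<open>The squared positive part of r^2 - |z - x|^2 is positive exactly on the open disc and of
  class C^1. A divergence contains only first derivatives, so this class serves for the partition of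
  unity.\<close>

lemma bump_exists:
  "\<exists>c K b. c \<in> \<A> \<and> compact K \<and> K \<subseteq> dom_ch c \<and> (\<forall>m. m \<notin> K \<longrightarrow> b m = 0) \<and> b p > 0 \<and> (\<forall>m. b m \<ge> 0) \<and>
     C1fun b \<and> open {m. b m > 0}"
proof -
  obtain c where c: "c \<in> \<A>" "p \<in> dom_ch c" using chart_exists by blast
  define x where "x = snd c p"
  obtain r where r: "r > 0" "cball x r \<subseteq> ran_ch c"
    using open_contains_cball ran_open[OF c(1)] c(2) unfolding x_def by (metis imageI)
  define \<beta> where "\<beta> z = (max 0 (r * r - ((Re z - Re x) * (Re z - Re x) + (Im z - Im x) * (Im z - Im x))))\<^sup>2" for z
  define b where "b m = (if m \<in> dom_ch c then \<beta> (snd c m) else 0)" for m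
  define K where "K = pt c ` cball x r"
  have \<beta>_sq: "\<beta> z = (max 0 (r * r - (cmod (z - x))\<^sup>2))\<^sup>2" for z
    unfolding cmod_sq by (simp add: \<beta>_def)
  have \<beta>_pos: "\<beta> z > 0 \<longleftrightarrow> z \<in> ball x r" for z
  proof -
    have "\<beta> z > 0 \<longleftrightarrow> (cmod (z - x))\<^sup>2 < r\<^sup>2" unfolding \<beta>_sq by (auto simp: max_def power2_eq_square[of r])
    also have "\<dots> \<longleftrightarrow> cmod (z - x) < r" using r(1) by (meson norm_ge_zero power2_less_imp_less power_strict_mono pos2 less_imp_le)
    finally show ?thesis by (simp add: dist_norm norm_minus_commute)
  qed
  have \<beta>_nn: "\<beta> z \<ge> 0" for z by (simp add: \<beta>_def)
  have \<beta>: "Ck_on 1 UNIV \<beta>"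
  proof -
    have re: "Ck_on 1 UNIV Re" "Ck_on 1 UNIV Im"
      using Ck_on_bounded_linear[OF bounded_linear_Re open_UNIV holomorphic_Ck_on[OF open_UNIV holomorphic_on_ident]]
        Ck_on_bounded_linear[OF bounded_linear_Im open_UNIV holomorphic_Ck_on[OF open_UNIV holomorphic_on_ident]] by auto
    show ?thesis unfolding \<beta>_def[abs_def]
      by (intro Ck_on_max_0_sq Ck_on_diff Ck_on_add Ck_on_mult Ck_on_const open_UNIV re)
  qed
  have K: "compact K"
    unfolding K_def by (intro compact_continuous_image continuous_on_subset[OF continuous_pt[OF c(1)] r(2)] compact_cball)
  have Kd: "K \<subseteq> dom_ch c" unfolding K_def using pt_dom[OF c(1)] r(2) by auto
  have b0: "b m = 0" if "m \<notin> K" for m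
  proof (rule ccontr)
    assume "b m \<noteq> 0"
    then have "m \<in> dom_ch c" "\<beta> (snd c m) > 0" using \<beta>_nn[of "snd c m"] by (auto simp: b_def split: if_splits)
    then have "m = pt c (snd c m)" "snd c m \<in> cball x r" using \<beta>_pos pt_snd[OF c(1)] by auto
    then show False using that unfolding K_def by blast
  qed
  have "C1fun b"
    unfolding C1fun_def
  proof
    fix d assume d: "d \<in> \<A>"
    \<comment> \<open>Off K the function is zero. As K lies in the chart c, the overlap with c and
      the complement of K cover the range of d.\<close>
    define O1 where "O1 = {z \<in> ran_ch d. pt d z \<in> - K}"
    have O1: "open O1" unfolding O1_def using K by (intro open_pt_vimage[OF d]) (simp add: compact_imp_closed open_Compl)
    have un: "ran_ch d = \<Union>{overlap d c, O1}"
      using overlap_iff[OF d, of _ c] Kd pt_dom[OF d] by (force simp: O1_def)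
    have 1: "Ck_on 1 (overlap d c) (\<lambda>z. b (pt d z))"
    proof -
      have "Ck_on 1 (overlap d c) (\<lambda>z. \<beta> (transition d c z))"
        by (rule Ck_on_compose[OF overlap_open[OF d c(1)] open_UNIV _ holomorphic_Ck_on[OF overlap_open[OF d c(1)] transition_holomorphic[OF d c(1)]] \<beta>]) simp
      moreover have "b (pt d z) = \<beta> (transition d c z)" if "z \<in> overlap d c" for z
        using that overlap_iff[OF d] by (simp add: b_def transition_def)
      ultimately show ?thesis using Ck_on_cong[OF overlap_open[OF d c(1)], of "\<lambda>z. b (pt d z)" "\<lambda>z. \<beta> (transition d c z)"] by simp
    qed
    have 2: "Ck_on 1 O1 (\<lambda>z. b (pt d z))"
      using Ck_on_cong[OF O1, of "\<lambda>z. b (pt d z)" "\<lambda>_. 0"] Ck_on_const[of 1 O1 "0::real"] by (simp add: O1_def b0 del: Ck_on.simps)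
    show "Ck_on 1 (ran_ch d) (\<lambda>z. b (pt d z))"
      unfolding un by (rule Ck_on_Union) (use 1 2 O1 overlap_open[OF d c(1)] in \<open>auto simp del: Ck_on.simps\<close>)
  qed
  moreover have "b p > 0" using c r(1) by (simp add: b_def \<beta>_pos x_def[symmetric])
  moreover have "open {m. b m > 0}"
  proof -
    have "{m. b m > 0} = {m \<in> dom_ch c. snd c m \<in> ball x r}" using \<beta>_pos by (auto simp: b_def)
    then show ?thesis using open_snd_vimage[OF c(1) open_ball] by simp
  qed
  moreover have "\<forall>m. b m \<ge> 0" using \<beta>_nn by (simp add: b_def)
  ultimately show ?thesis using c(1) K Kd b0 by blast
qed

text \<open>Finitely many bumps, indexed by their centres, are positive somewhere at each point by
  compactness, so division by their sum is possible.\<close>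

lemma partition_of_unity:
  "\<exists>(I :: 'm set) c K \<zeta>. finite I \<and> (\<forall>i\<in>I. c i \<in> \<A> \<and> compact (K i) \<and> K i \<subseteq> dom_ch (c i) \<and>
     (\<forall>m. m \<notin> K i \<longrightarrow> \<zeta> i m = 0) \<and> C1fun (\<zeta> i)) \<and> (\<forall>m. (\<Sum>i\<in>I. \<zeta> i m) = (1 :: real))"
proof -
  obtain c K b where b: "\<And>p. c p \<in> \<A>" "\<And>p. compact (K p)" "\<And>p. K p \<subseteq> dom_ch (c p)" "\<And>p m. m \<notin> K p \<Longrightarrow> b p m = 0"
    "\<And>p. b p p > 0" "\<And>p m. b p m \<ge> 0" "\<And>p. C1fun (b p)" "\<And>p. open {m. b p m > 0}"
    using bump_exists by metis
  obtain I where I: "finite I" "UNIV \<subseteq> (\<Union>p\<in>I. {m. b p m > 0})"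
    by (rule compactE_image[OF compact_M, of UNIV "\<lambda>p. {m. b p m > 0}"]) (use b(5,8) in auto)
  define B where "B m = (\<Sum>i\<in>I. b i m)" for m
  have Bp: "B m > 0" for m
  proof -
    obtain i where "i \<in> I" "b i m > 0" using I(2) by blast
    then show ?thesis unfolding B_def using I(1) b(6) by (intro sum_pos2[of I i]) auto
  qed
  have "C1fun (\<lambda>m. b i m / B m)" for i
    unfolding C1fun_def B_def[symmetric]
  proof
    fix d assume d: "d \<in> \<A>"
    have "Ck_on 1 (ran_ch d) (\<lambda>z. b j (pt d z))" for j using b(7) d unfolding C1fun_def by blast
    then have "Ck_on 1 (ran_ch d) (\<lambda>z. b i (pt d z) / (\<Sum>j\<in>I. b j (pt d z)))"
      using Bp ran_open[OF d] by (intro Ck_on_divide Ck_on_sum) (auto simp: B_def less_le)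
    then show "Ck_on 1 (ran_ch d) (\<lambda>z. b i (pt d z) / B (pt d z))" by (simp add: B_def)
  qed
  moreover have "(\<Sum>i\<in>I. b i m / B m) = 1" for m
    using Bp[of m] by (simp add: sum_divide_distrib[symmetric] B_def)
  ultimately show ?thesis
    using I(1) b by (intro exI[of _ I] exI[of _ c] exI[of _ K] exI[of _ "\<lambda>i m. b i m / B m"]) auto
qed

end

section \<open>The data of the theorem in charts\<close>

lemma det_Re_conj:
  assumes "cmat (transpose P) ** \<beta> = \<alpha> ** cmat (transpose P)" "det P \<noteq> 0"
  shows "det (map_matrix Re \<beta>) = det (map_matrix Re \<alpha>)"
proof -
  have "transpose P ** map_matrix Re \<beta> = map_matrix Re (cmat (transpose P) ** \<beta>)"
    "map_matrix Re \<alpha> ** transpose P = map_matrix Re (\<alpha> ** cmat (transpose P))"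
    by (simp_all add: mat2)
  then have "det (transpose P ** map_matrix Re \<beta>) = det (map_matrix Re \<alpha> ** transpose P)"
    using assms(1) by simp
  then show ?thesis using assms(2) by (simp add: det_mul det_transpose)
qed

locale cotangent_curve = curve \<A> w
  for \<A> :: "('m::t2_space) chart set" and w :: "'m chart \<Rightarrow> complex \<Rightarrow> real" +
  fixes J :: "'m chart \<Rightarrow> complex \<Rightarrow> real^2^2" and \<alpha> :: "'m chart \<Rightarrow> complex \<Rightarrow> complex^2^2"
  assumes cotangent_point: "cotangent_point \<A> w J \<alpha>"
    and norm_less: "\<And>p. (1/4) * norm2 \<A> w J \<alpha> p < 1"
begin

lemma prepatch_chart:
  assumes c: "c \<in> \<A>"
  shows "prepatch (ran_ch c) (w c) (J c) (\<alpha> c)"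
  using cotangent_point c w_Ck[OF c] w_pos[OF c] ran_open[OF c]
  by unfold_locales (auto simp: cotangent_point_def form_mat_def intro: Cinf_on_Ck_on)

lemma J_transition: "c \<in> \<A> \<Longrightarrow> d \<in> \<A> \<Longrightarrow> z \<in> overlap c d \<Longrightarrow>
    J d (transition c d z) ** jac (transition c d) z = jac (transition c d) z ** J c z"
  and \<alpha>_transition: "c \<in> \<A> \<Longrightarrow> d \<in> \<A> \<Longrightarrow> z \<in> overlap c d \<Longrightarrow>
    cmat (transpose (jac (transition c d) z)) ** \<alpha> d (transition c d z) = \<alpha> c z ** cmat (transpose (jac (transition c d) z))"
  using cotangent_point by (auto simp: cotangent_point_def overlap_def Let_def)

lemma norm_sq_Dfun:
  assumes c: "c \<in> \<A>" and z: "z \<in> ran_ch c"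
  shows "norm_sq w J \<alpha> c z = 4 * Dfun (\<alpha> c) z"
proof -
  interpret prepatch "ran_ch c" "w c" "J c" "\<alpha> c" by (rule prepatch_chart[OF c])
  have "met w J c z = G z" by (simp add: met_def form_mat_def G_def)
  then show ?thesis using norm_sq_eq[OF z] by (simp add: norm_sq_def Let_def)
qed

lemma det_jac_pos: "c \<in> \<A> \<Longrightarrow> d \<in> \<A> \<Longrightarrow> z \<in> overlap c d \<Longrightarrow> det (jac (transition c d) z) > 0"
  using w_pos[of c z] w_pos[of d "transition c d z"] overlap_sub[of c d] transition_ran[of c d z] kaehler
  unfolding kaehler_form_def overlap_def by (metis subsetD zero_less_mult_pos)

text \<open>Argued directly with determinants rather than through \<open>transition_patch\<close>,
  since that locale contains \<open>Dfun < 1\<close>, and this bound is deduced from the present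
  lemma via \<open>norm2_eq\<close>.\<close>

lemma invariant_Dfun: "invariant (\<lambda>c. Dfun (\<alpha> c))"
  unfolding invariant_def Dfun_def using det_Re_conj[OF \<alpha>_transition] det_jac_pos by (simp add: less_le)

lemma norm2_eq:
  assumes c: "c \<in> \<A>" and z: "z \<in> ran_ch c"
  shows "norm2 \<A> w J \<alpha> (pt c z) = 4 * Dfun (\<alpha> c) z"
proof -
  have *: "norm2 \<A> w J \<alpha> = globally \<A> (\<lambda>c z. 4 * Dfun (\<alpha> c) z)"
    unfolding norm2_def by (rule globally_cong) (rule norm_sq_Dfun)
  show ?thesis
    unfolding * by (rule globally_eq[OF _ c z]) (use invariant_Dfun in \<open>simp add: invariant_def\<close>)
qed

lemma patch_chart:
  assumes c: "c \<in> \<A>"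
  shows "patch (ran_ch c) (w c) (J c) (\<alpha> c)"
proof -
  have "Dfun (\<alpha> c) z < 1" if "z \<in> ran_ch c" for z
    using norm_less[of "pt c z"] norm2_eq[OF c that] by simp
  then show ?thesis using prepatch_chart[OF c] by (simp add: patch_def patch_axioms_def)
qed

lemma transition_patch_chart:
  assumes c: "c \<in> \<A>" and d: "d \<in> \<A>"
  shows "transition_patch (overlap c d) (w c) (J c) (\<alpha> c) (ran_ch d) (w d) (J d) (\<alpha> d) (transition c d)"
proof -
  have "w c z = w d (transition c d z) * det (jac (transition c d) z)" if "z \<in> overlap c d" for z
    using kaehler c d that unfolding kaehler_form_def overlap_def by blast
  then show ?thesis
    unfolding transition_patch_def transition_patch_axioms_def
    using patch_subset[OF patch_chart[OF c] overlap_open[OF c d] overlap_sub[OF c d]] patch_chart[OF d]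
      transition_holomorphic[OF c d] transition_ran[OF c d] J_transition[OF c d] \<alpha>_transition[OF c d] by auto
qed

section \<open>Global vector fields and integrals of their divergence\<close>

definition vector_field :: "('m chart \<Rightarrow> complex \<Rightarrow> real^2) \<Rightarrow> bool" where
  "vector_field V \<longleftrightarrow> (\<forall>c\<in>\<A>. \<forall>i. Ck_on 1 (ran_ch c) (\<lambda>y. V c y $ i)) \<and>
     (\<forall>c\<in>\<A>. \<forall>d\<in>\<A>. \<forall>z\<in>overlap c d. conf (deriv (transition c d) z) *v V c z = V d (transition c d z))"

lemma vector_field_Ck: "vector_field V \<Longrightarrow> c \<in> \<A> \<Longrightarrow> Ck_on 1 (ran_ch c) (\<lambda>y. V c y $ i)"
  unfolding vector_field_def by blast

lemma invariant_div:
  assumes V: "vector_field V"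
  shows "invariant (\<lambda>c. divw (w c) (V c))"
  unfolding invariant_def
proof safe
  fix c d z assume c: "c \<in> \<A>" and d: "d \<in> \<A>" and z: "z \<in> overlap c d"
  interpret transition_patch "overlap c d" "w c" "J c" "\<alpha> c" "ran_ch d" "w d" "J d" "\<alpha> d" "transition c d"
    by (rule transition_patch_chart[OF c d])
  show "divw (w c) (V c) z = divw (w d) (V d) (transition c d z)"
    by (rule div_law[OF z]) (use V c d Ck_on_differentiable[OF vector_field_Ck[OF V d] zero_less_one transition_ran[OF c d z]] in \<open>auto simp: vector_field_def\<close>)
qed

lemma continuous_div:
  assumes V: "vector_field V" and c: "c \<in> \<A>"
  shows "continuous_on (ran_ch c) (divw (w c) (V c))"
proof -
  have "Ck_on 1 (ran_ch c) (\<lambda>y. w c y * V c y $ i)" for i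
    by (intro Ck_on_mult ran_open c w_Ck vector_field_Ck V)
  then have "continuous_on (ran_ch c) (pd i (\<lambda>y. w c y * V c y $ i))" for i by simp
  then show ?thesis
    unfolding divw_def[abs_def] using w_pos[OF c] Ck_on_continuous[OF w_Ck[OF c]]
    by (intro continuous_intros) force+
qed

lemma vector_field_scale:
  assumes V: "vector_field V" and f: "C1fun f"
  shows "vector_field (\<lambda>c z. f (pt c z) *\<^sub>R V c z)"
proof -
  have "Ck_on 1 (ran_ch c) (\<lambda>y. f (pt c y) * V c y $ i)" if "c \<in> \<A>" for c i
    by (intro Ck_on_mult ran_open that vector_field_Ck V) (use f that in \<open>simp only: C1fun_def\<close>)
  then show ?thesis
    using V pt_transition unfolding vector_field_def by (auto simp: matrix_vector_mult_scaleR simp del: Ck_on.simps)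
qed

text \<open>As K is compact inside the chart, the components of w V extended by zero are C^1 with
  compact support in the plane. The density w cancels the denominator of the divergence, which
  leaves integrals of partial derivatives.\<close>

lemma integral_div_supported:
  assumes V: "vector_field V" and c: "c \<in> \<A>" and K: "compact K" "K \<subseteq> dom_ch c"
    and V0: "\<And>d z. d \<in> \<A> \<Longrightarrow> z \<in> ran_ch d \<Longrightarrow> pt d z \<notin> K \<Longrightarrow> V d z = 0"
  shows "(\<integral>p. globally \<A> (\<lambda>c. divw (w c) (V c)) p \<partial>\<mu>) = 0"
proof -
  let ?T = "\<lambda>c. divw (w c) (V c)"
  have Kc: "closed K" using K(1) compact_imp_closed by blast
  have T0: "?T d z = 0" if d: "d \<in> \<A>" "z \<in> ran_ch d" "pt d z \<notin> K" for d z
  proof -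
    have "pd i (\<lambda>y. w d y * V d y $ i) z = pd i (\<lambda>_. 0) z" for i
      by (rule pd_cong[OF open_pt_vimage[OF d(1), of "- K"]]) (use d V0 Kc in auto)
    then show ?thesis by (simp add: divw_def)
  qed
  have g0: "globally \<A> ?T p = 0" if "p \<notin> K" for p
    unfolding globally_def using chart_at[of p] that pt_snd by (intro T0) auto
  define g where "g i z = (if z \<in> ran_ch c then w c z * V c z $ i else 0)" for i z
  define L where "L = snd c ` K"
  have L: "compact L" "L \<subseteq> ran_ch c"
    unfolding L_def using K by (auto intro!: compact_continuous_image continuous_on_subset[OF continuous_snd[OF c]])
  have gL: "g i z = 0" if "z \<notin> L" for i z
  proof (cases "z \<in> ran_ch c")
    case True
    have "pt c z \<notin> K" using that snd_pt[OF c True] unfolding L_def by (metis imageI)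
    then show ?thesis using V0[OF c True] by (simp add: g_def)
  qed (simp add: g_def)
  have g: "Ck_on 1 UNIV (g i)" for i
  proof -
    have 1: "Ck_on 1 (ran_ch c) (g i)"
    proof -
      have "Ck_on 1 (ran_ch c) (\<lambda>y. w c y * V c y $ i)"
        by (intro Ck_on_mult ran_open c w_Ck vector_field_Ck V)
      then show ?thesis using Ck_on_cong[OF ran_open[OF c], of "g i" "\<lambda>y. w c y * V c y $ i"] by (simp add: g_def del: Ck_on.simps)
    qed
    have oL: "open (- L)" using L(1) by (simp add: compact_imp_closed open_Compl)
    have 2: "Ck_on 1 (- L) (g i)"
      using Ck_on_cong[OF oL, of "g i" "\<lambda>_. 0"] Ck_on_const[of 1 "- L" "0::real"] gL by (simp del: Ck_on.simps)
    have "Ck_on 1 (\<Union>{ran_ch c, - L}) (g i)"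
      by (rule Ck_on_Union) (use 1 2 oL ran_open[OF c] in \<open>auto simp del: Ck_on.simps\<close>)
    moreover have "\<Union>{ran_ch c, - L} = UNIV" using L(2) by auto
    ultimately show ?thesis by simp
  qed
  have "(\<integral>p. globally \<A> ?T p \<partial>\<mu>) = (\<integral>z. (if z \<in> ran_ch c then w c z * globally \<A> ?T (pt c z) else 0) \<partial>lborel)"
  proof (rule integral_chart[OF c])
    show "globally \<A> ?T \<in> borel_measurable borel"
      by (intro borel_measurable_continuous_onI globally_continuous invariant_div V continuous_div)
  qed (use g0 K in auto)
  also have "\<dots> = (\<integral>z. (\<Sum>i\<in>UNIV. pd i (g i) z) \<partial>lborel)"
  proof (intro Bochner_Integration.integral_cong refl)
    fix z
    show "(if z \<in> ran_ch c then w c z * globally \<A> ?T (pt c z) else 0) = (\<Sum>i\<in>UNIV. pd i (g i) z)"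
    proof (cases "z \<in> ran_ch c")
      case True
      have "pd i (g i) z = pd i (\<lambda>y. w c y * V c y $ i) z" for i
        by (rule pd_cong[OF ran_open[OF c] True]) (simp add: g_def)
      then show ?thesis
        using True w_pos[OF c True] globally_eq[OF invariant_div[OF V] c True] by (simp add: divw_def)
    next
      case False
      then have "z \<in> - L" using L(2) by blast
      have "pd i (g i) z = pd i (\<lambda>_. 0) z" for i
        by (rule pd_cong[of "- L"]) (use \<open>z \<in> - L\<close> L(1) gL in \<open>auto simp: compact_imp_closed open_Compl\<close>)
      then show ?thesis using False by simp
    qed
  qed
  also have "\<dots> = (\<Sum>i\<in>UNIV. \<integral>z. pd i (g i) z \<partial>lborel)"
    by (rule Bochner_Integration.integral_sum) (rule integral_pd_compact_support[OF g L(1) gL])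
  also have "\<dots> = 0"
    using integral_pd_compact_support(2)[OF g L(1) gL] by simp
  finally show ?thesis .
qed

text \<open>The cut-off functions are put inside the divergence: V is the sum of the fields
  \<zeta>_i V, each supported in one chart, and the divergence is additive.\<close>

theorem divergence_theorem:
  assumes V: "vector_field V"
  shows "(\<integral>p. globally \<A> (\<lambda>c. divw (w c) (V c)) p \<partial>\<mu>) = 0"
proof -
  obtain I :: "'m set" and c K \<zeta> where I: "finite I" and i: "\<And>i. i \<in> I \<Longrightarrow> c i \<in> \<A> \<and> compact (K i) \<and> K i \<subseteq> dom_ch (c i) \<and>
     (\<forall>m. m \<notin> K i \<longrightarrow> \<zeta> i m = 0) \<and> C1fun (\<zeta> i)" and one: "\<And>m. (\<Sum>i\<in>I. \<zeta> i m) = (1 :: real)"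
    using partition_of_unity by blast
  define W where "W i c z = \<zeta> i (pt c z) *\<^sub>R V c z" for i c z
  have W: "vector_field (W i)" if "i \<in> I" for i
    unfolding W_def using vector_field_scale[OF V] i[OF that] by blast
  have sum: "divw (w d) (V d) z = (\<Sum>i\<in>I. divw (w d) (W i d) z)" if d: "d \<in> \<A>" and z: "z \<in> ran_ch d" for d z
  proof -
    have df: "(\<lambda>y. w d y * W i d y $ k) differentiable (at z)" if "i \<in> I" for i k
      by (intro Ck_on_differentiable[OF _ zero_less_one z] Ck_on_mult ran_open d w_Ck vector_field_Ck W that)
    have "pd k (\<lambda>y. w d y * V d y $ k) z = (\<Sum>i\<in>I. pd k (\<lambda>y. w d y * W i d y $ k) z)" for k
    proof -
      have "w d y * V d y $ k = (\<Sum>i\<in>I. w d y * W i d y $ k)" for y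
        using one[of "pt d y"] by (simp add: W_def flip: sum_distrib_left sum_distrib_right)
      then show ?thesis using pd_sum[of I "\<lambda>i y. w d y * W i d y $ k" z k] df by simp
    qed
    then show ?thesis by (simp add: divw_def sum_2 sum.distrib add_divide_distrib sum_divide_distrib)
  qed
  have int: "integrable \<mu> (globally \<A> (\<lambda>c. divw (w c) (W i c)))" if "i \<in> I" for i
    by (intro integrable_continuous globally_continuous invariant_div continuous_div W that)
  have "globally \<A> (\<lambda>c. divw (w c) (V c)) p = (\<Sum>i\<in>I. globally \<A> (\<lambda>c. divw (w c) (W i c)) p)" for p
    unfolding globally_def using chart_at[of p] by (intro sum) auto
  then have "(\<integral>p. globally \<A> (\<lambda>c. divw (w c) (V c)) p \<partial>\<mu>) = (\<Sum>i\<in>I. \<integral>p. globally \<A> (\<lambda>c. divw (w c) (W i c)) p \<partial>\<mu>)"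
    using int by simp
  also have "\<dots> = 0"
  proof (intro sum.neutral ballI)
    fix j assume j: "j \<in> I"
    show "(\<integral>p. globally \<A> (\<lambda>c. divw (w c) (W j c)) p \<partial>\<mu>) = 0"
      by (rule integral_div_supported[OF W[OF j], of "c j" "K j"]) (use i[OF j] in \<open>auto simp: W_def\<close>)
  qed
  finally show ?thesis .
qed

end

section \<open>The real moment map\<close>

text \<open>The value in the chart c reads only the c-components of the families, which may thus be
  replaced by constant ones as in the patch formulas.\<close>

lemma Q_field_chart: "Q_field w J \<alpha> c = Q_field (\<lambda>_. w c) (\<lambda>_. J c) (\<lambda>_. \<alpha> c) c"
  by (intro ext) (simp add: Q_field_def grad_pairing_def met_def[abs_def] form_mat_def)

lemma scal_chart: "scal w J c = scal (\<lambda>_. w c) (\<lambda>_. J c) c"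
  by (intro ext) (simp add: scal_def met_def[abs_def] form_mat_def)

context cotangent_curve
begin

definition "Y c = ham (w c) (kappa (w c) (J c) (\<alpha> c))"

lemma vector_field_Y: "vector_field Y"
  unfolding vector_field_def
proof (intro conjI ballI allI)
  fix c i assume cA: "c \<in> \<A>"
  interpret patch "ran_ch c" "w c" "J c" "\<alpha> c" by (rule patch_chart[OF cA])
  show "Ck_on 1 (ran_ch c) (\<lambda>y. Y c y $ i)" unfolding Y_def by (rule ham_nth) (rule kappa_Ck)
next
  fix c d z assume cA: "c \<in> \<A>" and d: "d \<in> \<A>" and z: "z \<in> overlap c d"
  interpret transition_patch "overlap c d" "w c" "J c" "\<alpha> c" "ran_ch d" "w d" "J d" "\<alpha> d" "transition c d"
    by (rule transition_patch_chart[OF cA d])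
  show "conf (deriv (transition c d) z) *v Y c z = Y d (transition c d z)"
    unfolding Y_def by (rule Y_law[OF z])
qed

text \<open>At a given p, \<open>globally\<close> evaluates all terms in the same chart, so the
  identity of the patch applies point by point. Invariance of the sum of the left-hand terms is
  thereby inherited from the divergence of Y.\<close>

lemma second_order_terms:
  "globally \<A> (laplacian w J (\<lambda>q. ln (1 + sqrt (1 - (1/4) * norm2 \<A> w J \<alpha> q)))) p
   + globally \<A> (divergence w J (\<lambda>c z. psi \<A> w J \<alpha> (pt c z) *\<^sub>R Q_field w J \<alpha> c z)) p
   = globally \<A> (\<lambda>c. divw (w c) (Y c)) p"
proof -
  define ch where "ch = chart_at \<A> p"
  have cA: "ch \<in> \<A>" "snd ch p \<in> ran_ch ch" using chart_at[of p] by (auto simp: ch_def)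
  interpret patch "ran_ch ch" "w ch" "J ch" "\<alpha> ch" by (rule patch_chart[OF cA(1)])
  have m: "met w J ch = G" by (rule ext) (simp add: met_def form_mat_def G_def)
  have s: "sqrt (1 - (1/4) * norm2 \<A> w J \<alpha> (pt ch y)) = sfun (\<alpha> ch) y" if "y \<in> ran_ch ch" for y
    using norm2_eq[OF cA(1) that] by (simp add: sfun_def)
  show ?thesis
    unfolding globally_def ch_def[symmetric] laplacian_def divergence_def m Q_field_chart[of w J \<alpha> ch] Y_def
    by (rule laplacian_plus_divergence[OF cA(2)]) (use s in \<open>simp_all add: psi_def\<close>)
qed

lemma scal_invariant: "invariant (scal w J)"
  unfolding invariant_def
proof (intro ballI)
  fix c d z assume cA: "c \<in> \<A>" and d: "d \<in> \<A>" and z: "z \<in> overlap c d"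
  interpret transition_patch "overlap c d" "w c" "J c" "\<alpha> c" "ran_ch d" "w d" "J d" "\<alpha> d" "transition c d"
    by (rule transition_patch_chart[OF cA d])
  show "scal w J c z = scal w J d (transition c d z)"
    unfolding scal_chart[of w J c] scal_chart[of w J d] by (rule scal_law[OF z])
qed

lemma scal_global_continuous: "continuous_on UNIV (globally \<A> (scal w J))"
proof (rule globally_continuous[OF scal_invariant])
  fix c assume cA: "c \<in> \<A>"
  interpret patch "ran_ch c" "w c" "J c" "\<alpha> c" by (rule patch_chart[OF cA])
  show "continuous_on (ran_ch c) (scal w J c)" unfolding scal_chart[of w J c] by (rule scal_continuous)
qed

context
  fixes h assumes h: "smooth_fun \<A> h"
begin

lemma h_Cinf: "c \<in> \<A> \<Longrightarrow> Cinf_on (ran_ch c) (h \<circ> pt c)"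
  using h by (simp add: smooth_fun_def)

lemma h_Ck: "c \<in> \<A> \<Longrightarrow> Ck_on n (ran_ch c) (h \<circ> pt c)"
  by (rule Cinf_on_Ck_on[OF ran_open h_Cinf])

lemma h_continuous: "continuous_on UNIV h"
proof -
  have "continuous_on UNIV (globally \<A> (\<lambda>c. h \<circ> pt c))"
    by (rule globally_continuous) (use Ck_on_continuous[OF h_Ck] pt_transition in \<open>auto simp: invariant_def\<close>)
  moreover have "globally \<A> (\<lambda>c. h \<circ> pt c) = h"
    using chart_at pt_snd by (intro ext) (simp add: globally_def)
  ultimately show ?thesis by simp
qed

lemma vector_field_flux: "vector_field (\<lambda>c. flux (w c) (J c) (\<alpha> c) (h \<circ> pt c))"
  unfolding vector_field_def
proof (intro conjI ballI allI)
  fix c i assume cA: "c \<in> \<A>"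
  interpret patch "ran_ch c" "w c" "J c" "\<alpha> c" by (rule patch_chart[OF cA])
  have "Ck_on 1 (ran_ch c) (\<lambda>y. (sfun (\<alpha> c) y - 1) * (\<Sum>j\<in>UNIV. J c y $ i $ j * ham (w c) (\<lambda>k. pd k (h \<circ> pt c)) y $ j)
      - (h \<circ> pt c) y * ham (w c) (kappa (w c) (J c) (\<alpha> c)) y $ i)"
    by (intro Ck_on_diff Ck_on_mult Ck_on_sum Ck_on_const S sfun_Ck J_nth ham_nth Ck_on_pd h_Ck cA kappa_Ck)
  then show "Ck_on 1 (ran_ch c) (\<lambda>y. flux (w c) (J c) (\<alpha> c) (h \<circ> pt c) y $ i)"
    by (simp add: flux_def matrix_vector_mult_def del: Ck_on.simps)
next
  fix c d z assume cA: "c \<in> \<A>" and d: "d \<in> \<A>" and z: "z \<in> overlap c d"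
  interpret transition_patch "overlap c d" "w c" "J c" "\<alpha> c" "ran_ch d" "w d" "J d" "\<alpha> d" "transition c d"
    by (rule transition_patch_chart[OF cA d])
  show "conf (deriv (transition c d) z) *v flux (w c) (J c) (\<alpha> c) (h \<circ> pt c) z
      = flux (w d) (J d) (\<alpha> d) (h \<circ> pt d) (transition c d z)"
    by (rule flux_law[OF z _ h_Ck[OF d]]) (simp add: pt_transition[OF cA d])
qed

lemma dc_rho_global:
  "globally \<A> (dc_rho_at w J \<alpha> h) p = h p * globally \<A> (\<lambda>c. divw (w c) (Y c)) p
     + globally \<A> (\<lambda>c. divw (w c) (flux (w c) (J c) (\<alpha> c) (h \<circ> pt c))) p"
proof -
  define ch where "ch = chart_at \<A> p"
  have cA: "ch \<in> \<A>" "p \<in> dom_ch ch" using chart_at[of p] by (auto simp: ch_def)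
  then have z: "snd ch p \<in> ran_ch ch" by blast
  interpret patch "ran_ch ch" "w ch" "J ch" "\<alpha> ch" by (rule patch_chart[OF cA(1)])
  have "Cinf_on (ran_ch ch) (w ch)" using kaehler cA(1) by (simp add: kaehler_form_def)
  note dc = dc_rho_at_eq[of "ran_ch ch" w ch J \<alpha>, OF patch_chart[OF cA(1)] this z]
  show ?thesis
    unfolding globally_def ch_def[symmetric] dc Y_def
    using local_identity[OF z h_Ck[OF cA(1)]] pt_snd[OF cA] by simp
qed

lemma real_moment_map_eq:
  "real_moment_map \<A> w J \<alpha> h = (\<integral>p. h p *
     (2 * globally \<A> (scal w J) p - 2 * average \<mu> (globally \<A> (scal w J)) + globally \<A> (\<lambda>c. divw (w c) (Y c)) p) \<partial>\<mu>)"
proof -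
  define s a E B where "s = globally \<A> (scal w J)" and "a = average \<mu> s"
    and "E = globally \<A> (\<lambda>c. divw (w c) (Y c))"
    and "B = globally \<A> (\<lambda>c. divw (w c) (flux (w c) (J c) (\<alpha> c) (h \<circ> pt c)))"
  have s: "continuous_on UNIV s" unfolding s_def by (rule scal_global_continuous)
  have E: "continuous_on UNIV E"
    unfolding E_def by (intro globally_continuous invariant_div continuous_div vector_field_Y)
  have B: "integrable \<mu> B"
    unfolding B_def by (intro integrable_continuous globally_continuous invariant_div continuous_div vector_field_flux)
  \<comment> \<open>The Bochner integral is additive only on integrable functions; here continuity
    on the compact curve provides integrability.\<close>
  have i1: "integrable \<mu> (\<lambda>p. 2 * (s p - a) * h p)" and i2: "integrable \<mu> (\<lambda>p. h p * E p)"
    by (intro integrable_continuous continuous_intros s h_continuous E)+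
  have "real_moment_map \<A> w J \<alpha> h = (\<integral>p. 2 * (s p - a) * h p \<partial>\<mu>) + (\<integral>p. h p * E p + B p \<partial>\<mu>)"
    unfolding real_moment_map_def Let_def \<mu>_def[symmetric] s_def[symmetric] a_def[symmetric] dc_rho_global E_def B_def ..
  also have "(\<integral>p. h p * E p + B p \<partial>\<mu>) = (\<integral>p. h p * E p \<partial>\<mu>)"
    using i2 B divergence_theorem[OF vector_field_flux] by (simp add: B_def)
  also have "(\<integral>p. 2 * (s p - a) * h p \<partial>\<mu>) + (\<integral>p. h p * E p \<partial>\<mu>) = (\<integral>p. 2 * (s p - a) * h p + h p * E p \<partial>\<mu>)"
    by (rule Bochner_Integration.integral_add[OF i1 i2, symmetric])
  also have "\<dots> = (\<integral>p. h p * (2 * s p - 2 * a + E p) \<partial>\<mu>)"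
    by (intro Bochner_Integration.integral_cong refl) (simp add: algebra_simps)
  finally show ?thesis unfolding s_def a_def E_def .
qed

end

end

theorem theorem1p3:
  fixes \<A> :: "('m::t2_space) chart set"
    and \<omega>\<^sub>0 :: "'m chart \<Rightarrow> complex \<Rightarrow> real"
    and J :: "'m chart \<Rightarrow> complex \<Rightarrow> real^2^2"
    and \<alpha> :: "'m chart \<Rightarrow> complex \<Rightarrow> complex^2^2"
  assumes "compact_complex_curve \<A>"
    and "kaehler_form \<A> \<omega>\<^sub>0"
    and "cotangent_point \<A> \<omega>\<^sub>0 J \<alpha>"
    and "\<forall>p. (1/4) * norm2 \<A> \<omega>\<^sub>0 J \<alpha> p < 1"
  shows "\<forall>h \<in> C0inf \<A> \<omega>\<^sub>0.
    real_moment_map \<A> \<omega>\<^sub>0 J \<alpha> h =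
      (\<integral>p. h p *
         (2 * globally \<A> (scal \<omega>\<^sub>0 J) p
          - 2 * average (area_measure \<A> \<omega>\<^sub>0) (globally \<A> (scal \<omega>\<^sub>0 J))
          + globally \<A> (laplacian \<omega>\<^sub>0 J
              (\<lambda>q. ln (1 + sqrt (1 - (1/4) * norm2 \<A> \<omega>\<^sub>0 J \<alpha> q)))) p
          + globally \<A> (divergence \<omega>\<^sub>0 J
              (\<lambda>c z. psi \<A> \<omega>\<^sub>0 J \<alpha> (pt c z) *\<^sub>R Q_field \<omega>\<^sub>0 J \<alpha> c z)) p)
       \<partial>area_measure \<A> \<omega>\<^sub>0)"
proof
  fix h assume "h \<in> C0inf \<A> \<omega>\<^sub>0"
  then have h: "smooth_fun \<A> h" by (simp add: C0inf_def)
  interpret cotangent_curve \<A> \<omega>\<^sub>0 J \<alpha>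
    using assms by unfold_locales auto
  show "real_moment_map \<A> \<omega>\<^sub>0 J \<alpha> h =
      (\<integral>p. h p *
         (2 * globally \<A> (scal \<omega>\<^sub>0 J) p
          - 2 * average (area_measure \<A> \<omega>\<^sub>0) (globally \<A> (scal \<omega>\<^sub>0 J))
          + globally \<A> (laplacian \<omega>\<^sub>0 J
              (\<lambda>q. ln (1 + sqrt (1 - (1/4) * norm2 \<A> \<omega>\<^sub>0 J \<alpha> q)))) p
          + globally \<A> (divergence \<omega>\<^sub>0 J
              (\<lambda>c z. psi \<A> \<omega>\<^sub>0 J \<alpha> (pt c z) *\<^sub>R Q_field \<omega>\<^sub>0 J \<alpha> c z)) p)
       \<partial>area_measure \<A> \<omega>\<^sub>0)"
    unfolding real_moment_map_eq[OF h] \<mu>_def second_order_terms[symmetric] by (simp only: add.assoc)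
qed

end
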